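(* Let $\xi>0$ be fixed. Fix an initial and a final condition $q_{in}=(x_{in},y_{in},\theta_{in})$ and $q_{fin}=(x_{fin},y_{fin},\theta_{fin})$ in $\mathbb{R}^2\times S^1$. The only two following cases are possible. (1) There exists a solution (global minimizer) of the problem $\mathbf{(P_{curve})}$ from $q_{in}$ to $q_{fin}$. (2) The problem $\mathbf{(P_{curve})}$ from $q_{in}$ to $q_{fin}$ admits neither a global minimizer, nor a local minimizer, nor a geodesic (connecting $q_{in}$ to $q_{fin}$). Moreover both cases occur, depending on the boundary conditions: there are pairs $(q_{in},q_{fin})$ for which (1) holds and pairs $(q_{in},q_{fin})$ for which (2) holds.
   Context: Here $S^1=\mathbb{R}/2\pi\mathbb{Z}$ and $M=\mathbb{R}^2\times S^1$. Problem $\mathbf{(P_{curve})}$ from $q_{in}$ to $q_{fin}$ (with parameter $\xi>0$): among all $\ell\ge 0$ (the length $\ell$ is free), all integrable controls $v\in L^1([0,\ell],\mathbb{R})$ and all absolutely continuous curves $q=(x,y,\theta):[0,\ell]\to M$ satisfying, for a.e. $s$, $$\frac{dx}{ds}=\cos\theta(s),\qquad \frac{dy}{ds}=\sin\theta(s),\qquad \frac{d\theta}{ds}=v(s),$$ with $q(0)=q_{in}$ and $q(\ell)=q_{fin}$, minimize the cost $\int_0^\ell\sqrt{\xi^2+v(s)^2}\,ds$. (For such a curve $s$ is the arclength of the planar curve $(x,y)$ and $v(s)$ is its curvature.) Such pairs $(q,v)$ are called admissible for $(q_{in},q_{fin})$. Topology: the set $\bigcup_{T\ge0}W^{1,1}([0,T],M)$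 is endowed with the following distance. Given $q_1$ defined on $[0,T_1]$ and $q_2$ defined on $[0,T_2]$, extend each to $[0,\max\{T_1,T_2\}]$ by its constant final value, and set $\|q_1-q_2\|_{W^{1,1}}:=|q_1(0)-q_2(0)|+\|\dot q_1-\dot q_2\|_{L^1}$ (derivatives viewed in $\mathbb{R}^3$). Global minimizer (solution): an admissible pair of least cost among all admissible pairs for $(q_{in},q_{fin})$. Local minimizer: an admissible pair $(q,v)$ for which there is an open neighbourhood $B$ of $q$ in $\bigcup_{T\ge0}W^{1,1}([0,T],M)$, with respect to the topology induced by the distance $\|q_1-q_2\|_{W^{1,1}}$, such that every admissible pair $(\bar q,\bar v)$ for $(q_{in},q_{fin})$ with $\bar q\in B$ has cost greater than or equal to that of $(q,v)$. Geodesic connecting $q_{in}$ to $q_{fin}$: an admissible pair $(q,v)$ for $(q_{in},q_{fin})$ such that for every sufficiently small interval $[t_1,t_2]$ contained in the domain of $q$, the restriction $(q,v)|_{[t_1,t_2]}$ is (up to translation of the parameter) a global minimizer of $\mathbf{(P_{curve})}$ from $q(t_1)$ to $q(t_2)$. *)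

theory Defs
  imports "HOL-Analysis.Analysis"
begin

section \<open>The circle \<open>\<real>/2\<pi>\<int>\<close> with its quotient metric\<close>

definition angle_eq :: "real \<Rightarrow> real \<Rightarrow> bool" where
  "angle_eq x y \<longleftrightarrow> (\<exists>k::int. x = y + 2 * pi * of_int k)"

lemma equivp_angle_eq: "equivp angle_eq"
proof (rule equivpI)
  show "reflp angle_eq"
    unfolding reflp_def angle_eq_def by (intro allI exI[of _ 0]) simp
  show "symp angle_eq"
  proof (rule sympI)
    fix x y assume "angle_eq x y"
    then obtain k :: int where "x = y + 2 * pi * of_int k"
      unfolding angle_eq_def by blast
    then have "y = x + 2 * pi * of_int (- k)" by simp
    then show "angle_eq y x" unfolding angle_eq_def by blast
  qed
  show "transp angle_eq"
  proof (rule transpI)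
    fix x y z assume "angle_eq x y" "angle_eq y z"
    then obtain k l :: int where "x = y + 2 * pi * of_int k" "y = z + 2 * pi * of_int l"
      unfolding angle_eq_def by blast
    then have "x = z + 2 * pi * of_int (k + l)" by (simp add: algebra_simps)
    then show "angle_eq x z" unfolding angle_eq_def by blast
  qed
qed

quotient_type circle = real / angle_eq
  by (rule equivp_angle_eq)

lift_definition circle_of :: "real \<Rightarrow> circle" is "\<lambda>x. x" .

lift_definition cos_circle :: "circle \<Rightarrow> real" is cos
  by (auto simp: angle_eq_def cos_add)

lift_definition sin_circle :: "circle \<Rightarrow> real" is sin
  by (auto simp: angle_eq_def sin_add)

lemma circle_of_eq_iff:
  "circle_of x = circle_of y \<longleftrightarrow> (\<exists>k::int. x = y + 2 * pi * of_int k)"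
  by transfer (simp add: angle_eq_def)

lemma circle_of_surj: "\<exists>x. circle_of x = p"
  by transfer (rule exI, rule equivp_reflp[OF equivp_angle_eq])

lemma cos_circle_of [simp]: "cos_circle (circle_of x) = cos x"
  by transfer simp

lemma sin_circle_of [simp]: "sin_circle (circle_of x) = sin x"
  by transfer simp

instantiation circle :: metric_space
begin

definition dist_circle :: "circle \<Rightarrow> circle \<Rightarrow> real" where
  "dist_circle p p' = Inf {\<bar>x - y\<bar> | x y. circle_of x = p \<and> circle_of y = p'}"

definition uniformity_circle :: "(circle \<times> circle) filter" where
  "uniformity_circle = (INF e\<in>{0<..}. principal {(p, p'). dist p p' < e})"

definition open_circle :: "circle set \<Rightarrow> bool" where
  "open_circle U \<longleftrightarrow> (\<forall>p\<in>U. \<forall>\<^sub>F (p', r) in uniformity. p' = p \<longrightarrow> r \<in> U)"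

lemma dist_circle_le: "dist (circle_of x) (circle_of y) \<le> \<bar>x - y\<bar>"
  unfolding dist_circle_def
  by (rule cInf_lower) (auto intro!: bdd_belowI[of _ 0])

lemma dist_circle_attained:
  "\<exists>x y. circle_of x = p \<and> circle_of y = p' \<and> dist p p' = \<bar>x - y\<bar>"
proof -
  obtain x0 y0 where xy: "circle_of x0 = p" "circle_of y0 = p'"
    using circle_of_surj by metis
  define z where "z = (x0 - y0) / (2 * pi)"
  define y1 where "y1 = y0 + 2 * pi * of_int (round z)"
  have y1: "circle_of y1 = p'"
    using xy unfolding y1_def by (metis circle_of_eq_iff)
  have z: "x0 - y0 = 2 * pi * z" unfolding z_def by simp
  have low: "\<bar>x0 - y1\<bar> \<le> \<bar>x - y\<bar>" if "circle_of x = p" "circle_of y = p'" for x y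
  proof -
    have "circle_of x = circle_of x0" "circle_of y = circle_of y0"
      using that xy by simp_all
    then obtain k l :: int
      where kl: "x = x0 + 2 * pi * of_int k" "y = y0 + 2 * pi * of_int l"
      unfolding circle_of_eq_iff by blast
    have "\<bar>x0 - y1\<bar> = \<bar>2 * pi * (z - of_int (round z))\<bar>"
      unfolding y1_def using z by (simp add: algebra_simps)
    also have "\<dots> = 2 * pi * \<bar>z - of_int (round z)\<bar>"
      by (simp add: abs_mult)
    also have "\<dots> \<le> 2 * pi * \<bar>z - of_int (l - k)\<bar>"
      by (intro mult_left_mono round_diff_minimal) simp
    also have "\<dots> = \<bar>2 * pi * (z - of_int (l - k))\<bar>"
      by (simp add: abs_mult)
    also have "2 * pi * (z - of_int (l - k)) = x - y"
      unfolding kl using z by (simp add: algebra_simps)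
    finally show ?thesis .
  qed
  have "dist p p' = \<bar>x0 - y1\<bar>"
    unfolding dist_circle_def by (rule cInf_eq_minimum) (use xy y1 low in auto)
  then show ?thesis using xy y1 by blast
qed

instance
proof
  fix p p' r :: circle
  show "uniformity = (INF e\<in>{0<..}. principal {(p, p'). dist p p' < (e::real)} :: (circle \<times> circle) filter)"
    by (rule uniformity_circle_def)
  show "open U = (\<forall>p\<in>U. \<forall>\<^sub>F (p', r) in uniformity. p' = p \<longrightarrow> r \<in> U)" for U :: "circle set"
    by (rule open_circle_def)
  show "dist p p' = 0 \<longleftrightarrow> p = p'"
  proof
    assume "dist p p' = 0"
    then show "p = p'" using dist_circle_attained[of p p'] by auto
  next
    assume "p = p'"
    obtain x where "circle_of x = p" using circle_of_surj by blast
    then have "dist p p \<le> 0" using dist_circle_le[of x x] by simp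
    moreover have "dist p p \<ge> 0" using dist_circle_attained[of p p] by auto
    ultimately show "dist p p' = 0" using \<open>p = p'\<close> by simp
  qed
  show "dist p p' \<le> dist p r + dist p' r"
  proof -
    obtain x z where 1: "circle_of x = p" "circle_of z = r" "dist p r = \<bar>x - z\<bar>"
      using dist_circle_attained by blast
    obtain y w where 2: "circle_of y = p'" "circle_of w = r" "dist p' r = \<bar>y - w\<bar>"
      using dist_circle_attained by blast
    obtain k :: int where k: "z = w + 2 * pi * of_int k"
      using 1 2 circle_of_eq_iff[of z w] by auto
    define y' where "y' = y + 2 * pi * of_int k"
    have "circle_of y' = p'"
      using 2 unfolding y'_def by (metis circle_of_eq_iff)
    then have "dist p p' \<le> \<bar>x - y'\<bar>" using dist_circle_le[of x y'] 1 by simp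
    also have "\<dots> \<le> \<bar>x - z\<bar> + \<bar>y' - z\<bar>" by simp
    also have "y' - z = y - w" unfolding y'_def k by simp
    finally show ?thesis using 1 2 by simp
  qed
qed

end


section \<open>Curves in \<open>M = \<real>\<^sup>2 \<times> S\<^sup>1\<close>\<close>

text \<open>The product metric on this type is
  \<open>dist (x, y, \<theta>) (x', y', \<theta>') = sqrt ((x - x')\<^sup>2 + (y - y')\<^sup>2 + (dist \<theta> \<theta>')\<^sup>2)\<close>.\<close>

type_synonym M = "real \<times> real \<times> circle"

definition M_of :: "real \<times> real \<times> real \<Rightarrow> M" where
  "M_of = (\<lambda>(x, y, t). (x, y, circle_of t))"

definition heading :: "M \<Rightarrow> circle" where
  "heading p = snd (snd p)"

text \<open>The derivative of a curve in \<open>M\<close>, viewed in \<open>\<real>\<^sup>3\<close>, is the derivative of a lift along the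
  covering \<^term>\<open>M_of\<close>. The lift is only required to be regular at the point of differentiation;
  there any two such lifts differ locally by a constant, so the derivative is unique.\<close>

definition has_velocity :: "(real \<Rightarrow> M) \<Rightarrow> real \<times> real \<times> real \<Rightarrow> real filter \<Rightarrow> bool" where
  "has_velocity q w F \<longleftrightarrow> (\<exists>p. (\<forall>t. M_of (p t) = q t) \<and> (p has_vector_derivative w) F)"

definition velocity :: "(real \<Rightarrow> M) \<Rightarrow> real \<Rightarrow> real \<times> real \<times> real" where
  "velocity q t = (THE w. has_velocity q w (at t))"

definition abs_continuous_on :: "real set \<Rightarrow> (real \<Rightarrow> 'a::metric_space) \<Rightarrow> bool" where
  "abs_continuous_on S f \<longleftrightarrow>
     (\<forall>\<epsilon>>0. \<exists>\<delta>>0. \<forall>D. finite D \<longrightarrow> (\<forall>(a, b)\<in>D. a \<le> b \<and> {a..b} \<subseteq> S) \<longrightarrow>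
        disjoint_family_on (\<lambda>(a, b). {a<..<b}) D \<longrightarrow> (\<Sum>(a, b)\<in>D. b - a) < \<delta> \<longrightarrow>
        (\<Sum>(a, b)\<in>D. dist (f a) (f b)) < \<epsilon>)"

text \<open>A curve on \<open>[0, T]\<close> is encoded by the pair of \<open>T\<close> and a total function, whose values outside
  \<open>[0, T]\<close> are irrelevant everywhere below.\<close>

type_synonym curve = "real \<times> (real \<Rightarrow> M)"

definition W11 :: "curve set" where
  "W11 = {(T, q). 0 \<le> T \<and> abs_continuous_on {0..T} q}"

definition extend :: "curve \<Rightarrow> real \<Rightarrow> M" where
  "extend = (\<lambda>(T, q) t. q (min T t))"

definition W11_dist :: "curve \<Rightarrow> curve \<Rightarrow> real" where
  "W11_dist c\<^sub>1 c\<^sub>2 = dist (snd c\<^sub>1 0) (snd c\<^sub>2 0) +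
     (LINT t:{0..max (fst c\<^sub>1) (fst c\<^sub>2)}|lebesgue.
        norm (velocity (extend c\<^sub>1) t - velocity (extend c\<^sub>2) t))"

definition W11_open :: "curve set \<Rightarrow> bool" where
  "W11_open B \<longleftrightarrow> B \<subseteq> W11 \<and> (\<forall>c\<in>B. \<exists>r>0. \<forall>c'\<in>W11. W11_dist c c' < r \<longrightarrow> c' \<in> B)"


section \<open>The optimal control problem\<close>

definition admissible :: "M \<Rightarrow> M \<Rightarrow> real \<Rightarrow> (real \<Rightarrow> M) \<Rightarrow> (real \<Rightarrow> real) \<Rightarrow> bool" where
  "admissible q_in q_fin l q v \<longleftrightarrow>
     0 \<le> l \<and> set_integrable lebesgue {0..l} v \<and> abs_continuous_on {0..l} q \<and>
     (AE s in lebesgue. s \<in> {0..l} \<longrightarrow>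
        has_velocity q (cos_circle (heading (q s)), sin_circle (heading (q s)), v s)
          (at s within {0..l})) \<and>
     q 0 = q_in \<and> q l = q_fin"

definition cost :: "real \<Rightarrow> real \<Rightarrow> (real \<Rightarrow> real) \<Rightarrow> real" where
  "cost \<xi> l v = (LINT s:{0..l}|lebesgue. sqrt (\<xi>\<^sup>2 + (v s)\<^sup>2))"

definition global_minimizer ::
    "real \<Rightarrow> M \<Rightarrow> M \<Rightarrow> real \<Rightarrow> (real \<Rightarrow> M) \<Rightarrow> (real \<Rightarrow> real) \<Rightarrow> bool" where
  "global_minimizer \<xi> q_in q_fin l q v \<longleftrightarrow>
     admissible q_in q_fin l q v \<and>
     (\<forall>l' q' v'. admissible q_in q_fin l' q' v' \<longrightarrow> cost \<xi> l v \<le> cost \<xi> l' v')"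

definition local_minimizer ::
    "real \<Rightarrow> M \<Rightarrow> M \<Rightarrow> real \<Rightarrow> (real \<Rightarrow> M) \<Rightarrow> (real \<Rightarrow> real) \<Rightarrow> bool" where
  "local_minimizer \<xi> q_in q_fin l q v \<longleftrightarrow>
     admissible q_in q_fin l q v \<and>
     (\<exists>B. W11_open B \<and> (l, q) \<in> B \<and>
        (\<forall>l' q' v'. admissible q_in q_fin l' q' v' \<and> (l', q') \<in> B \<longrightarrow>
           cost \<xi> l v \<le> cost \<xi> l' v'))"

definition geodesic ::
    "real \<Rightarrow> M \<Rightarrow> M \<Rightarrow> real \<Rightarrow> (real \<Rightarrow> M) \<Rightarrow> (real \<Rightarrow> real) \<Rightarrow> bool" where
  "geodesic \<xi> q_in q_fin l q v \<longleftrightarrow>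
     admissible q_in q_fin l q v \<and>
     (\<exists>\<delta>>0. \<forall>t\<^sub>1 t\<^sub>2. 0 \<le> t\<^sub>1 \<and> t\<^sub>1 \<le> t\<^sub>2 \<and> t\<^sub>2 \<le> l \<and> t\<^sub>2 - t\<^sub>1 \<le> \<delta> \<longrightarrow>
        global_minimizer \<xi> (q t\<^sub>1) (q t\<^sub>2) (t\<^sub>2 - t\<^sub>1) (\<lambda>s. q (t\<^sub>1 + s)) (\<lambda>s. v (t\<^sub>1 + s)))"

end

theory Submission
  imports Defs
begin

text \<open>
  The dichotomy holds because every local minimizer and every geodesic is itself a global
  minimizer. If one of them exists then case (1) holds; if no global minimizer exists then neither of
  them does, and this is case (2). Both kinds of curves are compared with a third notion, the normal
  extremals of the Pontryagin maximum principle (\<open>extremal_on\<close>): there are a constant spatial momentum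
  \<open>(p1, p2)\<close> and a momentum \<open>h\<close> conjugate to the angle with \<open>h' = p1 sin \<theta> - p2 cos \<theta>\<close> and
  \<open>v = \<xi> h / sqrt (1 - h\<^sup>2)\<close>, and the Hamiltonian \<open>p1 cos \<theta> + p2 sin \<theta> - \<xi> sqrt (1 - h\<^sup>2)\<close>
  vanishes.

  \<^item> Local minimizers are extremals (\<open>local_minimizer_imp_extremal\<close>). The curve is varied by adding a
  function to its tangent angle and by applying a homothety, which changes the free length. Sussmann's
  open mapping theorem on \<open>\<real>\<^sup>3\<close> (two end point coordinates and the cost) gives Lagrange multipliers
  (\<open>multiplier_rule\<close>); the lemma of du Bois-Reymond turns them into the equation for \<open>h\<close>, and the homothety
  fixes the value of the Hamiltonian. The momentum satisfies \<open>\<bar>h\<bar> < 1\<close> in the interior of the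
  domain, that is, interior cusps do not occur.

  \<^item> Geodesics are extremals (\<open>geodesic_imp_extremal\<close>). Short pieces minimize globally, hence locally, hence
  are extremals; overlapping extremals have the same momenta, since \<open>h\<close> is determined by the control.

  \<^item> Extremals are global minimizers (\<open>extremal_imp_global_minimizer\<close>). Let \<open>X\<close> be the coordinate of the
  plane in the direction of \<open>(p1, p2)\<close> and \<open>\<Theta>\<close> the angle with that direction. Forgetting the other
  coordinate leaves a two-dimensional problem with the same cost. An extremal has \<open>cos \<Theta> > 0\<close> inside its
  domain, so it is a graph \<open>\<Theta>(X)\<close>, and its cost is the integral over \<open>X\<close> of
  \<open>sqrt (\<xi>\<^sup>2 sec\<^sup>2 \<Theta> + (d\<Theta>/dX)\<^sup>2)\<close>. This Lagrangian is jointly convex because \<open>sec\<close> is convex, so an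
  extremal graph minimizes among graphs. A general competitor is reduced to this situation by folding its
  angle into \<open>[- \<pi>/2, \<pi>/2]\<close> and replacing \<open>X\<close> by its running maximum, neither of which increases the
  cost (\<open>calibration_inequality\<close>).

  Finally both cases occur. A point is joined to itself by the curve of length zero. From \<open>(0, 0, 0)\<close> to
  \<open>(- 1, 0, 0)\<close> there is no minimizer: along an extremal the velocity has positive inner product with
  \<open>(p1, p2)\<close>, which by the initial heading means \<open>p1 \<ge> 0\<close> and by the displacement \<open>- p1 > 0\<close>.
\<close>

section \<open>Absolutely continuous functions\<close>

text \<open>A one-sided fundamental theorem of calculus. By Cousin's lemma there is a tagged division finer than any
  gauge. The intervals with tag in the null set \<open>N\<close> lie in an open set of small measure, so absolute
  continuity makes their total increment small; on every other interval the local bound applies. The bound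
  is asked of difference quotients over intervals around \<open>t\<close>, since the function to which the lemma is
  applied involves a running maximum, for which such bounds are at hand but derivatives are not.\<close>

lemma ac_increment_le_integral:
  fixes f g :: "real \<Rightarrow> real"
  assumes ab: "a \<le> b" and ac: "abs_continuous_on {a..b} f"
    and g: "g integrable_on {a..b}" and N: "negligible N"
    and loc: "\<And>t \<epsilon>. t \<in> {a..b} \<Longrightarrow> t \<notin> N \<Longrightarrow> \<epsilon> > 0 \<Longrightarrow>
      \<exists>\<delta>>0. \<forall>u w. a \<le> u \<longrightarrow> u \<le> t \<longrightarrow> t \<le> w \<longrightarrow> w \<le> b \<longrightarrow> w - u < \<delta> \<longrightarrow>
        f w - f u \<le> (g t + \<epsilon>) * (w - u)"
  shows "f b - f a \<le> integral {a..b} g"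
proof (rule field_le_epsilon)
  fix e :: real assume e: "e > 0"
  define \<epsilon> where "\<epsilon> = e / (b - a + 2)"
  have \<epsilon>: "\<epsilon> > 0" "\<epsilon> * (b - a + 2) = e" using e ab by (auto simp: \<epsilon>_def)
  define I where "I = integral {a..b} g"
  define g' where "g' t = (if t \<in> N then 0 else g t)" for t
  have "(g has_integral I) {a..b}" unfolding I_def using g by (rule integrable_integral)
  then have "(g' has_integral I) {a..b}"
    by (rule has_integral_spike[OF N, rotated]) (auto simp: g'_def)
  from this[unfolded has_integral_real, rule_format, OF \<epsilon>(1)]
  obtain \<gamma>1 where \<gamma>1g: "gauge \<gamma>1"
    and \<gamma>1p: "\<forall>p. p tagged_division_of {a..b} \<and> \<gamma>1 fine p \<longrightarrow>
      norm ((\<Sum>(x,k)\<in>p. measure lborel k *\<^sub>R g' x) - I) < \<epsilon>"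
    by (elim exE conjE)
  from ac[unfolded abs_continuous_on_def, rule_format, OF \<epsilon>(1)]
  obtain \<delta>0 where \<delta>0p: "\<delta>0 > 0"
    and \<delta>0a: "\<forall>D. finite D \<longrightarrow> (\<forall>(s, t)\<in>D. s \<le> t \<and> {s..t} \<subseteq> {a..b}) \<longrightarrow>
        disjoint_family_on (\<lambda>(s, t). {s<..<t}) D \<longrightarrow> (\<Sum>(s, t)\<in>D. t - s) < \<delta>0 \<longrightarrow>
        (\<Sum>(s, t)\<in>D. dist (f s) (f t)) < \<epsilon>"
    by (elim exE conjE)
  obtain U where U: "open U" "N \<subseteq> U" "U \<in> lmeasurable" "measure lebesgue U < \<delta>0"
  proof -
    have Ns: "N \<in> null_sets lebesgue" using N by (simp add: negligible_iff_null_sets)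
    then obtain T where T: "open T" "N \<subseteq> T" "T - N \<in> lmeasurable"
      "emeasure lebesgue (T - N) < ennreal \<delta>0"
      using sets_lebesgue_outer_open[of N \<delta>0] \<delta>0p by auto
    have eq: "emeasure lebesgue T = emeasure lebesgue (T - N)"
      using Ns T(1) by (simp add: emeasure_Diff_null_set)
    have "emeasure lebesgue T < ennreal \<delta>0" using T(4) eq by simp
    moreover have fin: "T \<in> lmeasurable" using calculation T(1)
      by (auto simp: fmeasurable_def dest: order_less_trans[OF _ ennreal_less_top])
    ultimately have "measure lebesgue T < \<delta>0"
      using \<delta>0p by (simp add: emeasure_eq_measure2 ennreal_less_iff)
    with fin have "T \<in> lmeasurable" "measure lebesgue T < \<delta>0" by auto
    then show thesis using that T by blast
  qed
  have "\<exists>d. \<forall>t\<in>{a..b} - N. d t > 0 \<and> (\<forall>u w. a \<le> u \<longrightarrow> u \<le> t \<longrightarrow> t \<le> w \<longrightarrow> w \<le> b \<longrightarrow> w - u < d t \<longrightarrow>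
        f w - f u \<le> (g t + \<epsilon>) * (w - u))"
    using loc[OF _ _ \<epsilon>(1)] by (intro bchoice) auto
  then obtain d where d: "\<And>t. t \<in> {a..b} \<Longrightarrow> t \<notin> N \<Longrightarrow> d t > 0"
    "\<And>t u w. t \<in> {a..b} \<Longrightarrow> t \<notin> N \<Longrightarrow> a \<le> u \<Longrightarrow> u \<le> t \<Longrightarrow> t \<le> w \<Longrightarrow> w \<le> b \<Longrightarrow> w - u < d t \<Longrightarrow>
        f w - f u \<le> (g t + \<epsilon>) * (w - u)"
    by (metis DiffI)
  define \<gamma> where "\<gamma> x = \<gamma>1 x \<inter> (if x \<in> N then U else if x \<in> {a..b} then ball x (d x / 2) else UNIV)" for x
  have "gauge \<gamma>"
    using \<gamma>1g U(1,2) d(1) unfolding gauge_def \<gamma>_def by (auto intro!: open_Int)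
  then obtain p where p: "p tagged_division_of {a..b}" "\<gamma> fine p"
    by (rule fine_division_exists_real)
  have pf: "finite p" using p(1) by blast
  have K: "\<exists>u w. k = {u..w} \<and> u \<le> w \<and> u \<le> x \<and> x \<le> w \<and> a \<le> u \<and> w \<le> b \<and> x \<in> {a..b}" if xk: "(x, k) \<in> p" for x k
  proof -
    obtain u w where "k = cbox u w" using tagged_division_ofD(4)[OF p(1) xk] by blast
    moreover have "x \<in> k" "k \<subseteq> {a..b}"
      using tagged_division_ofD(2,3)[OF p(1) that] by auto
    ultimately show ?thesis by (intro exI[of _ u] exI[of _ w]) auto
  qed
  have fine1: "\<gamma>1 fine p" using p(2) unfolding fine_def \<gamma>_def by blast
  define pN where "pN = {(x, k) \<in> p. x \<in> N}"
  have pN: "pN \<subseteq> p" "finite pN" using pf unfolding pN_def by (auto intro: finite_subset)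
  define ends :: "real \<times> real set \<Rightarrow> real \<times> real" where "ends = (\<lambda>(x, k). (Inf k, Sup k))"
  have disj: "interior k \<inter> interior k' = {}" if "(x, k) \<in> p" "(x', k') \<in> p" "(x, k) \<noteq> (x', k')" for x k x' k'
    using tagged_division_ofD(5)[OF p(1) that] .
  have inj: "inj_on ends pN"
  proof (rule inj_onI, clarify)
    fix x k x' k' assume A: "(x, k) \<in> pN" "(x', k') \<in> pN" "ends (x, k) = ends (x', k')"
    then have P: "(x, k) \<in> p" "(x', k') \<in> p" using pN by auto
    obtain u w where 1: "k = {u..w}" "u \<le> w" "u \<le> x" "x \<le> w" using K[OF P(1)] by blast
    obtain u' w' where 2: "k' = {u'..w'}" "u' \<le> w'" "u' \<le> x'" "x' \<le> w'" using K[OF P(2)] by blast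
    have eq: "u = u'" "w = w'" using A(3) 1 2 by (auto simp: ends_def)
    show "x = x' \<and> k = k'"
    proof (rule ccontr)
      assume "\<not> ?thesis"
      then have ne: "(x, k) \<noteq> (x', k')" by simp
      then have "{u<..<w} = {}" using disj[OF P] 1 2 eq by simp
      then have "u = w" using 1(2) by (simp add: order_antisym)
      then have "x = x'" "k = k'" using 1 2 eq by auto
      then show False using ne by simp
    qed
  qed
  have sumN: "(\<Sum>(x, k)\<in>pN. f (Sup k) - f (Inf k)) \<le> \<epsilon>"
  proof -
    have "(\<Sum>(x, k)\<in>pN. f (Sup k) - f (Inf k)) \<le> (\<Sum>z\<in>pN. dist (f (fst (ends z))) (f (snd (ends z))))"
      by (rule sum_mono) (auto simp: ends_def dist_real_def)
    also have "\<dots> = (\<Sum>(s, t)\<in>ends ` pN. dist (f s) (f t))"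
      by (subst sum.reindex[OF inj]) (auto simp: o_def case_prod_beta)
    also have "\<dots> < \<epsilon>"
    proof (rule \<delta>0a[THEN spec, THEN mp, THEN mp, THEN mp, THEN mp])
      show "finite (ends ` pN)" using pN by simp
      show "\<forall>(s, t)\<in>ends ` pN. s \<le> t \<and> {s..t} \<subseteq> {a..b}"
      proof
        fix e assume "e \<in> ends ` pN"
        then obtain x k where A: "(x, k) \<in> pN" "e = ends (x, k)" by auto
        have "(x, k) \<in> p" using A pN by auto
        then obtain u w where 1: "k = {u..w}" "u \<le> w" "a \<le> u" "w \<le> b" using K by blast
        show "case e of (s, t) \<Rightarrow> s \<le> t \<and> {s..t} \<subseteq> {a..b}"
          using 1 A(2) by (simp add: ends_def)
      qed
      show "disjoint_family_on (\<lambda>(s, t). {s<..<t}) (ends ` pN)"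
        unfolding disjoint_family_on_def
      proof (intro ballI impI)
        fix e e' assume "e \<in> ends ` pN" "e' \<in> ends ` pN" "e \<noteq> e'"
        then obtain x k x' k' where A: "(x, k) \<in> pN" "(x', k') \<in> pN" "e = ends (x, k)" "e' = ends (x', k')"
          by auto
        then have ne: "(x, k) \<noteq> (x', k')" using \<open>e \<noteq> e'\<close> by auto
        have P: "(x, k) \<in> p" "(x', k') \<in> p" using A pN by auto
        obtain u w where 1: "k = {u..w}" "u \<le> w" using K[OF P(1)] by blast
        obtain u' w' where 2: "k' = {u'..w'}" "u' \<le> w'" using K[OF P(2)] by blast
        show "(case e of (s, t) \<Rightarrow> {s<..<t}) \<inter> (case e' of (s, t) \<Rightarrow> {s<..<t}) = {}"
          using disj[OF P ne] 1 2 A(3,4) by (simp add: ends_def)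
      qed
      have "(\<Sum>(s, t)\<in>ends ` pN. t - s) = (\<Sum>(x, k)\<in>pN. measure lebesgue k)"
        using pN K by (subst sum.reindex[OF inj]) (force simp: ends_def case_prod_beta intro!: sum.cong)
      also have "\<dots> = measure lebesgue (\<Union>(snd ` pN))"
      proof -
        have "(\<Sum>z\<in>pN. measure lebesgue (snd z)) = measure lebesgue (\<Union>(snd ` pN))"
        proof (rule measure_negligible_finite_Union_image[symmetric])
          show "finite pN" by (rule pN)
          show "snd z \<in> lmeasurable" if "z \<in> pN" for z
          proof -
            have "(fst z, snd z) \<in> p" using that pN by auto
            then obtain u w where "snd z = {u..w}" using K by blast
            then show ?thesis by simp
          qed
          show "pairwise (\<lambda>x y. negligible (snd x \<inter> snd y)) pN"
          proof (rule pairwiseI)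
            fix z z' assume z: "z \<in> pN" "z' \<in> pN" "z \<noteq> z'"
            have P: "(fst z, snd z) \<in> p" "(fst z', snd z') \<in> p" using z pN by auto
            obtain u w where 1: "snd z = {u..w}" using K[OF P(1)] by blast
            obtain u' w' where 2: "snd z' = {u'..w'}" using K[OF P(2)] by blast
            have "interior (snd z) \<inter> interior (snd z') = {}" using disj[OF P] z(3) by (simp add: prod_eq_iff)
            have "snd z \<inter> snd z' \<subseteq> {u, w, u', w'}"
            proof (intro subsetI, rule ccontr)
              fix y assume y: "y \<in> snd z \<inter> snd z'" "y \<notin> {u, w, u', w'}"
              then have "u \<le> y" "y \<le> w" "u' \<le> y" "y \<le> w'" "y \<noteq> u" "y \<noteq> w" "y \<noteq> u'" "y \<noteq> w'"
                unfolding 1 2 by simp_all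
              then have "y \<in> {u<..<w}" "y \<in> {u'<..<w'}" by auto
              then have "y \<in> interior (snd z) \<inter> interior (snd z')" unfolding 1 2 by simp
              then show False using \<open>interior (snd z) \<inter> interior (snd z') = {}\<close> by blast
            qed
            then show "negligible (snd z \<inter> snd z')"
              by (rule negligible_subset[rotated]) auto
          qed
        qed
        then show ?thesis by (simp add: case_prod_beta)
      qed
      also have "\<dots> \<le> measure lebesgue U"
      proof (rule measure_mono_fmeasurable)
        show "\<Union> (snd ` pN) \<subseteq> U"
        proof clarsimp
          fix t x k assume "(x, k) \<in> pN" "t \<in> k"
          then have "k \<subseteq> \<gamma> x" "x \<in> N" using p(2) pN unfolding fine_def pN_def by auto
          then show "t \<in> U" using \<open>t \<in> k\<close> unfolding \<gamma>_def by auto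
        qed
        have "\<And>z. z \<in> pN \<Longrightarrow> snd z \<in> sets lebesgue" using pN K by force
        then show "\<Union> (snd ` pN) \<in> sets lebesgue" using pN by (intro sets.finite_Union) auto
      qed (rule U)
      finally show "(\<Sum>(s, t)\<in>ends ` pN. t - s) < \<delta>0" using U(4) by simp
    qed
    finally show ?thesis by simp
  qed
  have "f b - f a = (\<Sum>(x,k)\<in>p. f (Sup k) - f (Inf k))"
    using additive_tagged_division_1[OF ab p(1), of f] by simp
  also have "\<dots> = (\<Sum>(x,k)\<in>p - pN. f (Sup k) - f (Inf k)) + (\<Sum>(x,k)\<in>pN. f (Sup k) - f (Inf k))"
    by (rule sum.subset_diff) (use pN pf in auto)
  also have "(\<Sum>(x,k)\<in>p - pN. f (Sup k) - f (Inf k)) \<le> (\<Sum>(x,k)\<in>p - pN. measure lborel k * (g' x + \<epsilon>))"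
  proof (rule sum_mono, clarify)
    fix x k assume xk: "(x, k) \<in> p" "(x, k) \<notin> pN"
    obtain u w where k: "k = {u..w}" "u \<le> w" "u \<le> x" "x \<le> w" "a \<le> u" "w \<le> b" "x \<in> {a..b}"
      using K[OF xk(1)] by blast
    have xN: "x \<notin> N" using xk by (simp add: pN_def)
    have "k \<subseteq> \<gamma> x" using p(2) xk unfolding fine_def by auto
    then have "k \<subseteq> ball x (d x / 2)" using xN k(7) unfolding \<gamma>_def by auto
    moreover have "u \<in> k" "w \<in> k" using k by auto
    ultimately have "u \<in> ball x (d x / 2)" "w \<in> ball x (d x / 2)" by blast+
    then have "x - u < d x / 2" "w - x < d x / 2" using k(3,4) by (auto simp: dist_real_def)
    then have "w - u < d x" by linarith
    then show "f (Sup k) - f (Inf k) \<le> measure lborel k * (g' x + \<epsilon>)"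
      using d(2)[OF k(7) xN k(5,3,4,6)] k xN by (simp add: g'_def mult.commute)
  qed
  also have "(\<Sum>(x,k)\<in>p - pN. measure lborel k * (g' x + \<epsilon>)) =
      (\<Sum>(x,k)\<in>p - pN. measure lborel k * g' x) + \<epsilon> * (\<Sum>(x,k)\<in>p - pN. measure lborel k)"
    by (simp add: case_prod_beta sum.distrib sum_distrib_left algebra_simps)
  also have "(\<Sum>(x,k)\<in>p - pN. measure lborel k * g' x) = (\<Sum>(x,k)\<in>p. measure lborel k * g' x)"
    using pf by (intro sum.mono_neutral_left) (auto simp: pN_def g'_def)
  also have "(\<Sum>(x,k)\<in>p - pN. measure lborel k) \<le> (\<Sum>(x,k)\<in>p. measure lborel k)"
    using pf by (intro sum_mono2) auto
  also have "(\<Sum>(x,k)\<in>p. measure lborel k) = b - a"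
    using additive_content_tagged_division[of p a b] p(1) ab by simp
  finally have "f b - f a \<le> (\<Sum>(x,k)\<in>p. measure lborel k * g' x) + \<epsilon> * (b - a) + \<epsilon>"
    using sumN \<epsilon>(1) by (simp add: mult_left_mono)
  moreover have "(\<Sum>(x,k)\<in>p. measure lborel k * g' x) < I + \<epsilon>"
    using \<gamma>1p p(1) fine1 by fastforce
  ultimately show "f b - f a \<le> integral {a..b} g + e"
    using \<epsilon>(2) unfolding I_def by (simp add: algebra_simps)
qed

lemma abs_continuous_on_subset:
  assumes "abs_continuous_on S f" "T \<subseteq> S"
  shows "abs_continuous_on T f"
  unfolding abs_continuous_on_def
proof (intro allI impI)
  fix \<epsilon> :: real assume "\<epsilon> > 0"
  from assms(1)[unfolded abs_continuous_on_def, rule_format, OF this]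
  obtain \<delta> where \<delta>: "\<delta> > 0" and ac: "\<forall>D. finite D \<longrightarrow> (\<forall>(a, b)\<in>D. a \<le> b \<and> {a..b} \<subseteq> S) \<longrightarrow>
        disjoint_family_on (\<lambda>(a, b). {a<..<b}) D \<longrightarrow> (\<Sum>(a, b)\<in>D. b - a) < \<delta> \<longrightarrow>
        (\<Sum>(a, b)\<in>D. dist (f a) (f b)) < \<epsilon>"
    by (elim exE conjE)
  show "\<exists>\<delta>>0. \<forall>D. finite D \<longrightarrow> (\<forall>(a, b)\<in>D. a \<le> b \<and> {a..b} \<subseteq> T) \<longrightarrow>
        disjoint_family_on (\<lambda>(a, b). {a<..<b}) D \<longrightarrow> (\<Sum>(a, b)\<in>D. b - a) < \<delta> \<longrightarrow>
        (\<Sum>(a, b)\<in>D. dist (f a) (f b)) < \<epsilon>"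
  proof (intro exI conjI allI impI)
    fix D assume D: "finite D" "\<forall>(a, b)\<in>D. a \<le> b \<and> {a..b} \<subseteq> T"
      "disjoint_family_on (\<lambda>(a, b). {a<..<b}) D" "(\<Sum>(a, b)\<in>D. b - a) < \<delta>"
    have "\<forall>(a, b)\<in>D. a \<le> b \<and> {a..b} \<subseteq> S" using D(2) assms(2) by fastforce
    then show "(\<Sum>(a, b)\<in>D. dist (f a) (f b)) < \<epsilon>"
      using ac D by simp
  qed (rule \<delta>)
qed

text \<open>Sums and compositions with Lipschitz functions are instances of this comparison; so are continuous lifts of
  an angle, because it is asked for small intervals only.\<close>

lemma abs_continuous_on_dominated:
  fixes f :: "real \<Rightarrow> 'a::metric_space" and g :: "real \<Rightarrow> 'b::metric_space"
  assumes g: "abs_continuous_on S g" and \<eta>: "\<eta> > 0" and C: "C \<ge> 0" and L: "L \<ge> 0"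
    and le: "\<And>s t. s \<in> S \<Longrightarrow> t \<in> S \<Longrightarrow> s \<le> t \<Longrightarrow> t - s < \<eta> \<Longrightarrow>
      dist (f s) (f t) \<le> C * (t - s) + L * dist (g s) (g t)"
  shows "abs_continuous_on S f"
  unfolding abs_continuous_on_def
proof (intro allI impI)
  fix \<epsilon> :: real assume \<epsilon>: "\<epsilon> > 0"
  have "\<epsilon> / (2 * (L + 1)) > 0" using \<epsilon> L by simp
  from g[unfolded abs_continuous_on_def, rule_format, OF this]
  obtain \<delta> where \<delta>: "\<delta> > 0" and ac: "\<forall>D. finite D \<longrightarrow> (\<forall>(a, b)\<in>D. a \<le> b \<and> {a..b} \<subseteq> S) \<longrightarrow>
        disjoint_family_on (\<lambda>(a, b). {a<..<b}) D \<longrightarrow> (\<Sum>(a, b)\<in>D. b - a) < \<delta> \<longrightarrow>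
        (\<Sum>(a, b)\<in>D. dist (g a) (g b)) < \<epsilon> / (2 * (L + 1))"
    by (elim exE conjE)
  define \<delta>' where "\<delta>' = min \<eta> (min \<delta> (\<epsilon> / (2 * (C + 1))))"
  have \<delta>': "\<delta>' > 0" using \<eta> \<delta> \<epsilon> C by (simp add: \<delta>'_def)
  show "\<exists>\<delta>>0. \<forall>D. finite D \<longrightarrow> (\<forall>(a, b)\<in>D. a \<le> b \<and> {a..b} \<subseteq> S) \<longrightarrow>
        disjoint_family_on (\<lambda>(a, b). {a<..<b}) D \<longrightarrow> (\<Sum>(a, b)\<in>D. b - a) < \<delta> \<longrightarrow>
        (\<Sum>(a, b)\<in>D. dist (f a) (f b)) < \<epsilon>"
  proof (intro exI conjI allI impI)
    fix D assume D: "finite D" "\<forall>(a, b)\<in>D. a \<le> b \<and> {a..b} \<subseteq> S"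
      "disjoint_family_on (\<lambda>(a, b). {a<..<b}) D" "(\<Sum>(a, b)\<in>D. b - a) < \<delta>'"
    have sg: "(\<Sum>(a, b)\<in>D. dist (g a) (g b)) < \<epsilon> / (2 * (L + 1))"
      using ac D by (simp add: \<delta>'_def)
    have "(\<Sum>(a, b)\<in>D. dist (f a) (f b)) \<le> (\<Sum>(a, b)\<in>D. C * (b - a) + L * dist (g a) (g b))"
    proof (rule sum_mono, clarify)
      fix a b assume ab: "(a, b) \<in> D"
      have "b - a \<le> (\<Sum>(a, b)\<in>D. b - a)"
        using D(1,2) ab member_le_sum[of "(a, b)" D "\<lambda>(a, b). b - a"] by fastforce
      then have "b - a < \<eta>" using D(4) by (simp add: \<delta>'_def)
      moreover have "a \<le> b" "{a..b} \<subseteq> S" using D(2) ab by auto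
      ultimately show "dist (f a) (f b) \<le> C * (b - a) + L * dist (g a) (g b)"
        by (intro le) auto
    qed
    also have "\<dots> = C * (\<Sum>(a, b)\<in>D. b - a) + L * (\<Sum>(a, b)\<in>D. dist (g a) (g b))"
      by (simp add: case_prod_beta sum.distrib sum_distrib_left)
    also have "C * (\<Sum>(a, b)\<in>D. b - a) \<le> C * (\<epsilon> / (2 * (C + 1)))"
      using D(4) C by (intro mult_left_mono) (auto simp: \<delta>'_def)
    also have "\<dots> < \<epsilon> / 2" using C \<epsilon> by (simp add: field_simps)
    also have "L * (\<Sum>(a, b)\<in>D. dist (g a) (g b)) \<le> L * (\<epsilon> / (2 * (L + 1)))"
      using sg L by (intro mult_left_mono) auto
    also have "\<dots> \<le> \<epsilon> / 2" using L \<epsilon> by (simp add: field_simps)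
    finally show "(\<Sum>(a, b)\<in>D. dist (f a) (f b)) < \<epsilon>" by simp
  qed (rule \<delta>')
qed

lemma abs_continuous_on_lipschitz:
  assumes "C \<ge> 0" "\<And>s t. s \<in> S \<Longrightarrow> t \<in> S \<Longrightarrow> s \<le> t \<Longrightarrow> dist (f s) (f t) \<le> C * (t - s)"
  shows "abs_continuous_on S f"
proof (rule abs_continuous_on_dominated[where \<eta> = 1 and C = C and L = 0 and g = "\<lambda>_. 0::real"])
  show "abs_continuous_on S (\<lambda>_. 0::real)"
    unfolding abs_continuous_on_def by (auto intro!: exI[of _ 1])
qed (use assms in auto)

lemma abs_continuous_on_imp_continuous_on:
  assumes "abs_continuous_on {a..b} f"
  shows "continuous_on {a..b} f"
  unfolding continuous_on_iff
proof (intro ballI allI impI)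
  fix x \<epsilon> :: real assume x: "x \<in> {a..b}" and \<epsilon>: "\<epsilon> > 0"
  from assms[unfolded abs_continuous_on_def, rule_format, OF \<epsilon>]
  obtain \<delta> where \<delta>: "\<delta> > 0" and ac: "\<forall>D. finite D \<longrightarrow> (\<forall>(s, t)\<in>D. s \<le> t \<and> {s..t} \<subseteq> {a..b}) \<longrightarrow>
        disjoint_family_on (\<lambda>(a, b). {a<..<b}) D \<longrightarrow> (\<Sum>(a, b)\<in>D. b - a) < \<delta> \<longrightarrow>
        (\<Sum>(a, b)\<in>D. dist (f a) (f b)) < \<epsilon>"
    by (elim exE conjE)
  have *: "dist (f s) (f t) < \<epsilon>" if "s \<in> {a..b}" "t \<in> {a..b}" "s \<le> t" "t - s < \<delta>" for s t
    using ac[THEN spec, of "{(s, t)}"] that by (simp add: disjoint_family_on_def)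
  show "\<exists>\<delta>>0. \<forall>x'\<in>{a..b}. dist x' x < \<delta> \<longrightarrow> dist (f x') (f x) < \<epsilon>"
  proof (intro exI conjI ballI impI)
    fix x' assume "x' \<in> {a..b}" "dist x' x < \<delta>"
    then show "dist (f x') (f x) < \<epsilon>"
      using *[of x x'] *[of x' x] x by (cases "x \<le> x'") (auto simp: dist_real_def dist_commute)
  qed (rule \<delta>)
qed

lemma abs_continuous_on_dilation:
  assumes f: "abs_continuous_on {a..b} f" and c: "c > 0"
  shows "abs_continuous_on {c * a..c * b} (\<lambda>s. f (s / c))"
  unfolding abs_continuous_on_def
proof (intro allI impI)
  fix \<epsilon> :: real assume \<epsilon>: "\<epsilon> > 0"
  from f[unfolded abs_continuous_on_def, rule_format, OF \<epsilon>]
  obtain \<delta> where \<delta>: "\<delta> > 0" and ac: "\<forall>D. finite D \<longrightarrow> (\<forall>(s, t)\<in>D. s \<le> t \<and> {s..t} \<subseteq> {a..b}) \<longrightarrow>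
        disjoint_family_on (\<lambda>(a, b). {a<..<b}) D \<longrightarrow> (\<Sum>(a, b)\<in>D. b - a) < \<delta> \<longrightarrow>
        (\<Sum>(a, b)\<in>D. dist (f a) (f b)) < \<epsilon>"
    by (elim exE conjE)
  show "\<exists>\<delta>>0. \<forall>D. finite D \<longrightarrow> (\<forall>(s, t)\<in>D. s \<le> t \<and> {s..t} \<subseteq> {c * a..c * b}) \<longrightarrow>
        disjoint_family_on (\<lambda>(a, b). {a<..<b}) D \<longrightarrow> (\<Sum>(a, b)\<in>D. b - a) < \<delta> \<longrightarrow>
        (\<Sum>(s, t)\<in>D. dist (f (s / c)) (f (t / c))) < \<epsilon>"
  proof (intro exI conjI allI impI)
    show "c * \<delta> > 0" using c \<delta> by simp
    fix D assume D: "finite D" "\<forall>(s, t)\<in>D. s \<le> t \<and> {s..t} \<subseteq> {c * a..c * b}"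
      "disjoint_family_on (\<lambda>(a, b). {a<..<b}) D" "(\<Sum>(a, b)\<in>D. b - a) < c * \<delta>"
    define h :: "real \<times> real \<Rightarrow> real \<times> real" where "h = (\<lambda>(s, t). (s / c, t / c))"
    have inj: "inj_on h D" using c by (auto simp: inj_on_def h_def)
    have 2: "\<forall>(s, t)\<in>h ` D. s \<le> t \<and> {s..t} \<subseteq> {a..b}"
    proof
      fix e assume "e \<in> h ` D"
      then obtain s t where st: "(s, t) \<in> D" "e = (s / c, t / c)" by (auto simp: h_def)
      then have "s \<le> t" "c * a \<le> s" "t \<le> c * b" using D(2) by auto
      then show "case e of (s, t) \<Rightarrow> s \<le> t \<and> {s..t} \<subseteq> {a..b}"
        using c st(2) by (simp add: pos_le_divide_eq pos_divide_le_eq divide_right_mono mult.commute)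
    qed
    have 3: "disjoint_family_on (\<lambda>(a, b). {a<..<b}) (h ` D)"
      unfolding disjoint_family_on_def
    proof (intro ballI impI)
      fix e e' assume "e \<in> h ` D" "e' \<in> h ` D" "e \<noteq> e'"
      then obtain z z' where z: "z \<in> D" "z' \<in> D" "e = h z" "e' = h z'" "z \<noteq> z'"
        by (metis imageE)
      have "(case z of (s, t) \<Rightarrow> {s<..<t}) \<inter> (case z' of (s, t) \<Rightarrow> {s<..<t}) = {}"
        by (rule D(3)[unfolded disjoint_family_on_def, THEN bspec, THEN bspec, THEN mp, OF z(1,2,5)])
      moreover have "x * c \<in> (case z of (s, t) \<Rightarrow> {s<..<t})" if "x \<in> (case h z of (s, t) \<Rightarrow> {s<..<t})" for x z
        using that c by (cases z) (simp add: h_def pos_divide_less_eq pos_less_divide_eq)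
      ultimately show "(case e of (s, t) \<Rightarrow> {s<..<t}) \<inter> (case e' of (s, t) \<Rightarrow> {s<..<t}) = {}"
        unfolding z(3,4) by (metis IntI disjoint_iff)
    qed
    have 4: "(\<Sum>(a, b)\<in>h ` D. b - a) < \<delta>"
    proof -
      have "(\<Sum>(a, b)\<in>h ` D. b - a) = (\<Sum>(a, b)\<in>D. b - a) / c"
        unfolding sum.reindex[OF inj] by (simp add: h_def case_prod_beta sum_divide_distrib diff_divide_distrib)
      also have "\<dots> < c * \<delta> / c" by (rule divide_strict_right_mono[OF D(4) c])
      also have "c * \<delta> / c = \<delta>" using c by simp
      finally show ?thesis .
    qed
    have "(\<Sum>(a, b)\<in>h ` D. dist (f a) (f b)) < \<epsilon>"
      by (rule ac[THEN spec, THEN mp, THEN mp, THEN mp, THEN mp]) (use D(1) 2 3 4 in simp_all)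
    then show "(\<Sum>(s, t)\<in>D. dist (f (s / c)) (f (t / c))) < \<epsilon>"
      unfolding sum.reindex[OF inj] by (simp add: h_def case_prod_beta)
  qed
qed

text \<open>A derivative controls the increment over any interval containing the point, not only intervals with
  the point as an end.\<close>

lemma has_real_derivative_straddle:
  fixes f :: "real \<Rightarrow> real"
  assumes der: "(f has_real_derivative D) (at t within {a..b})" and t: "t \<in> {a..b}" and \<epsilon>: "\<epsilon> > 0"
  shows "\<exists>\<delta>>0. \<forall>u w. a \<le> u \<longrightarrow> u \<le> t \<longrightarrow> t \<le> w \<longrightarrow> w \<le> b \<longrightarrow> w - u < \<delta> \<longrightarrow>
        \<bar>f w - f u - D * (w - u)\<bar> \<le> \<epsilon> * (w - u)"
proof -
  have "(f has_derivative (*) D) (at t within {a..b})"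
    by (rule der[unfolded has_field_derivative_def])
  then have "\<forall>e>0. \<exists>d>0. \<forall>y\<in>{a..b}. norm (y - t) < d \<longrightarrow>
      norm (f y - f t - D * (y - t)) \<le> e * norm (y - t)"
    unfolding has_derivative_within_alt by (rule conjunct2)
  from this[THEN spec, THEN mp, OF \<epsilon>] obtain d where d: "d > 0" and d2: "\<forall>y\<in>{a..b}. norm (y - t) < d \<longrightarrow>
      norm (f y - f t - D * (y - t)) \<le> \<epsilon> * norm (y - t)"
    by (elim exE conjE)
  show ?thesis
  proof (intro exI conjI allI impI)
    fix u w assume uw: "a \<le> u" "u \<le> t" "t \<le> w" "w \<le> b" "w - u < d"
    have "\<bar>f w - f t - D * (w - t)\<bar> \<le> \<epsilon> * (w - t)" "\<bar>f u - f t - D * (u - t)\<bar> \<le> \<epsilon> * (t - u)"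
    proof -
      have "norm (f w - f t - D * (w - t)) \<le> \<epsilon> * norm (w - t)"
        by (intro d2[rule_format]) (use uw t in auto)
      then show "\<bar>f w - f t - D * (w - t)\<bar> \<le> \<epsilon> * (w - t)" using uw(3) by simp
      have "norm (f u - f t - D * (u - t)) \<le> \<epsilon> * norm (u - t)"
        by (intro d2[rule_format]) (use uw t in auto)
      then show "\<bar>f u - f t - D * (u - t)\<bar> \<le> \<epsilon> * (t - u)" using uw(2) by simp
    qed
    moreover have "f w - f u - D * (w - u) = (f w - f t - D * (w - t)) - (f u - f t - D * (u - t))"
      by (simp add: right_diff_distrib)
    moreover have "\<epsilon> * (w - u) = \<epsilon> * (w - t) + \<epsilon> * (t - u)"
      by (simp add: right_diff_distrib)
    ultimately show "\<bar>f w - f u - D * (w - u)\<bar> \<le> \<epsilon> * (w - u)"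
      using abs_triangle_ineq4[of "f w - f t - D * (w - t)" "f u - f t - D * (u - t)"] by linarith
  qed (rule d)
qed

lemma ac_increment_eq_integral:
  fixes f g :: "real \<Rightarrow> real"
  assumes ab: "a \<le> b" and ac: "abs_continuous_on {a..b} f"
    and g: "g integrable_on {a..b}" and N: "negligible N"
    and der: "\<And>t. t \<in> {a..b} \<Longrightarrow> t \<notin> N \<Longrightarrow> (f has_real_derivative g t) (at t within {a..b})"
  shows "f b - f a = integral {a..b} g"
proof -
  have der': "\<exists>\<delta>>0. \<forall>u w. a \<le> u \<longrightarrow> u \<le> t \<longrightarrow> t \<le> w \<longrightarrow> w \<le> b \<longrightarrow> w - u < \<delta> \<longrightarrow>
        \<bar>f w - f u - g t * (w - u)\<bar> \<le> \<epsilon> * (w - u)" if t: "t \<in> {a..b}" "t \<notin> N" and \<epsilon>: "\<epsilon> > 0" for t \<epsilon>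
    by (rule has_real_derivative_straddle[OF der[OF t] t(1) \<epsilon>])
  have 1: "f b - f a \<le> integral {a..b} g"
  proof (rule ac_increment_le_integral[OF ab ac g N])
    fix t \<epsilon> :: real assume "t \<in> {a..b}" "t \<notin> N" "\<epsilon> > 0"
    from der'[OF this] obtain \<delta> where \<delta>: "\<delta> > 0" and *: "\<forall>u w. a \<le> u \<longrightarrow> u \<le> t \<longrightarrow> t \<le> w \<longrightarrow> w \<le> b \<longrightarrow> w - u < \<delta> \<longrightarrow>
        \<bar>f w - f u - g t * (w - u)\<bar> \<le> \<epsilon> * (w - u)" by (elim exE conjE)
    show "\<exists>\<delta>>0. \<forall>u w. a \<le> u \<longrightarrow> u \<le> t \<longrightarrow> t \<le> w \<longrightarrow> w \<le> b \<longrightarrow> w - u < \<delta> \<longrightarrow>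
      f w - f u \<le> (g t + \<epsilon>) * (w - u)"
    proof (intro exI conjI allI impI)
      fix u w assume "a \<le> u" "u \<le> t" "t \<le> w" "w \<le> b" "w - u < \<delta>"
      from *[rule_format, OF this] show "f w - f u \<le> (g t + \<epsilon>) * (w - u)"
        unfolding distrib_right by linarith
    qed (rule \<delta>)
  qed
  have ac': "abs_continuous_on {a..b} (\<lambda>t. - f t)"
    by (rule abs_continuous_on_dominated[OF ac zero_less_one order_refl zero_le_one]) (simp add: dist_real_def)
  have g': "(\<lambda>t. - g t) integrable_on {a..b}" using g by (rule integrable_neg)
  have 2: "- f b - - f a \<le> integral {a..b} (\<lambda>t. - g t)"
  proof (rule ac_increment_le_integral[OF ab ac' g' N])
    fix t \<epsilon> :: real assume "t \<in> {a..b}" "t \<notin> N" "\<epsilon> > 0"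
    from der'[OF this] obtain \<delta> where \<delta>: "\<delta> > 0" and *: "\<forall>u w. a \<le> u \<longrightarrow> u \<le> t \<longrightarrow> t \<le> w \<longrightarrow> w \<le> b \<longrightarrow> w - u < \<delta> \<longrightarrow>
        \<bar>f w - f u - g t * (w - u)\<bar> \<le> \<epsilon> * (w - u)" by (elim exE conjE)
    show "\<exists>\<delta>>0. \<forall>u w. a \<le> u \<longrightarrow> u \<le> t \<longrightarrow> t \<le> w \<longrightarrow> w \<le> b \<longrightarrow> w - u < \<delta> \<longrightarrow>
      - f w - - f u \<le> (- g t + \<epsilon>) * (w - u)"
    proof (intro exI conjI allI impI)
      fix u w assume "a \<le> u" "u \<le> t" "t \<le> w" "w \<le> b" "w - u < \<delta>"
      from *[rule_format, OF this] show "- f w - - f u \<le> (- g t + \<epsilon>) * (w - u)"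
        unfolding distrib_right mult_minus_left by linarith
    qed (rule \<delta>)
  qed
  have "integral {a..b} (\<lambda>t. - g t) = - integral {a..b} g" by (rule integral_neg)
  then show ?thesis using 1 2 by linarith
qed

section \<open>Lifting curves to the universal cover\<close>

lemma abs_cos_diff_le: "\<bar>cos a - cos b\<bar> \<le> \<bar>a - b :: real\<bar>"
proof -
  have "\<bar>cos a - cos b\<bar> = 2 * (\<bar>sin ((a + b) / 2)\<bar> * \<bar>sin ((b - a) / 2)\<bar>)"
    by (simp add: cos_diff_cos abs_mult)
  also have "\<dots> \<le> 2 * (1 * \<bar>(b - a) / 2\<bar>)"
    by (intro mult_left_mono mult_mono abs_sin_le_one abs_sin_x_le_abs_x) auto
  finally show ?thesis by (simp add: abs_minus_commute)
qed

lemma abs_sin_diff_le: "\<bar>sin a - sin b\<bar> \<le> \<bar>a - b :: real\<bar>"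
  using abs_cos_diff_le[of "pi / 2 - a" "pi / 2 - b"] by (simp add: cos_diff abs_minus_commute)

lemma dist_cos_circle_le: "dist (cos_circle p) (cos_circle p') \<le> dist p p'"
  using dist_circle_attained[of p p'] abs_cos_diff_le by (auto simp: dist_real_def)

lemma dist_sin_circle_le: "dist (sin_circle p) (sin_circle p') \<le> dist p p'"
  using dist_circle_attained[of p p'] abs_sin_diff_le by (auto simp: dist_real_def)

lemma circle_of_eqI:
  assumes "cos_circle p = cos a" "sin_circle p = sin a"
  shows "p = circle_of a"
proof -
  obtain b where b: "circle_of b = p" using circle_of_surj by blast
  have "sin b = sin a \<and> cos b = cos a" using assms unfolding b[symmetric] by simp
  then obtain n :: int where "b = a + 2 * pi * of_int n" using sin_cos_eq_iff[of b a] by auto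
  then show ?thesis using b circle_of_eq_iff by metis
qed

lemma dist_circle_of_eq:
  assumes "\<bar>a - b\<bar> \<le> pi"
  shows "dist (circle_of a) (circle_of b) = \<bar>a - b\<bar>"
proof (rule antisym[OF dist_circle_le])
  obtain x y where xy: "circle_of x = circle_of a" "circle_of y = circle_of b"
    "dist (circle_of a) (circle_of b) = \<bar>x - y\<bar>" using dist_circle_attained by blast
  then obtain k m :: int where km: "x = a + 2 * pi * of_int k" "y = b + 2 * pi * of_int m"
    unfolding circle_of_eq_iff by blast
  define n where "n = k - m"
  have "\<bar>a - b\<bar> \<le> \<bar>a - b + 2 * pi * of_int n\<bar>"
  proof (cases "n = 0")
    case False
    then have "1 \<le> \<bar>real_of_int n\<bar>" by linarith
    then have "2 * pi * 1 \<le> 2 * pi * \<bar>real_of_int n\<bar>" by (intro mult_left_mono) auto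
    also have "\<dots> = \<bar>2 * pi * of_int n\<bar>" by (simp add: abs_mult)
    finally show ?thesis using assms by linarith
  qed simp
  also have "a - b + 2 * pi * of_int n = x - y" by (simp add: km n_def algebra_simps)
  finally show "\<bar>a - b\<bar> \<le> dist (circle_of a) (circle_of b)" using xy by simp
qed

text \<open>The difference of two lifts takes values in the multiples of \<open>2\<pi>\<close>. If both are continuous at \<open>t\<close>, it is
  locally constant there, so the derivative does not depend on the lift.\<close>

lemma has_velocity_lift:
  assumes vel: "has_velocity q (a, b, c) (at t within S)" and t: "t \<in> S"
    and q: "\<And>s. q s = (x s, y s, circle_of (\<theta> s))" and \<theta>: "continuous (at t within S) \<theta>"
  shows "(x has_real_derivative a) (at t within S)" "(y has_real_derivative b) (at t within S)"
    "(\<theta> has_real_derivative c) (at t within S)"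
proof -
  obtain p where p: "\<And>s. M_of (p s) = q s" "(p has_vector_derivative (a, b, c)) (at t within S)"
    using vel unfolding has_velocity_def by blast
  define \<theta>p where "\<theta>p s = snd (snd (p s))" for s
  have eq: "x s = fst (p s)" "y s = fst (snd (p s))" "circle_of (\<theta> s) = circle_of (\<theta>p s)" for s
    using p(1)[of s] q[of s] by (auto simp: M_of_def case_prod_beta \<theta>p_def)
  have 2: "((\<lambda>s. snd (p s)) has_vector_derivative (b, c)) (at t within S)"
    using bounded_linear.has_vector_derivative[OF bounded_linear_snd p(2)] by simp
  have "((\<lambda>s. fst (p s)) has_vector_derivative a) (at t within S)"
    using bounded_linear.has_vector_derivative[OF bounded_linear_fst p(2)] by simp
  then show "(x has_real_derivative a) (at t within S)"
    unfolding has_real_derivative_iff_has_vector_derivative eq(1)[abs_def] .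
  have "((\<lambda>s. fst (snd (p s))) has_vector_derivative b) (at t within S)"
    using bounded_linear.has_vector_derivative[OF bounded_linear_fst 2] by simp
  then show "(y has_real_derivative b) (at t within S)"
    unfolding has_real_derivative_iff_has_vector_derivative eq(2)[abs_def] .
  have "(\<theta>p has_vector_derivative c) (at t within S)"
    using bounded_linear.has_vector_derivative[OF bounded_linear_snd 2] by (simp add: \<theta>p_def[abs_def])
  then have der: "(\<theta>p has_real_derivative c) (at t within S)"
    unfolding has_real_derivative_iff_has_vector_derivative .
  define d where "d s = \<theta>p s - \<theta> s" for s
  have dk: "\<exists>k::int. d s = 2 * pi * of_int k" for s
    using eq(3)[of s, symmetric] unfolding circle_of_eq_iff d_def by force
  have "continuous (at t within S) d"
    unfolding d_def by (intro continuous_diff \<theta> DERIV_continuous[OF der])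
  then have "(d \<longlongrightarrow> d t) (at t within S)" by (simp add: continuous_within)
  then have "eventually (\<lambda>s. dist (d s) (d t) < 2 * pi) (at t within S)"
    by (rule tendstoD) simp
  then have ev: "eventually (\<lambda>s. \<theta>p s - d t = \<theta> s) (at t within S)"
  proof eventually_elim
    case (elim s)
    obtain k where k: "d s = 2 * pi * of_int k" using dk by blast
    obtain m where m: "d t = 2 * pi * of_int m" using dk by blast
    have "d s - d t = 2 * pi * of_int (k - m)" using k m by (simp add: algebra_simps)
    then have "2 * pi * \<bar>real_of_int (k - m)\<bar> < 2 * pi * 1"
      using elim by (simp add: dist_real_def abs_mult)
    then have "\<bar>real_of_int (k - m)\<bar> < 1" using mult_less_cancel_left_pos[of "2 * pi"] by simp
    then have "k = m" by linarith
    then show ?case using k m by (simp add: d_def)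
  qed
  have "((\<lambda>s. \<theta>p s - d t) has_real_derivative c) (at t within S)"
    using der by (auto intro!: derivative_eq_intros)
  then show "(\<theta> has_real_derivative c) (at t within S)"
    unfolding has_field_derivative_def
    by (rule has_derivative_transform_eventually[OF _ ev]) (auto simp: d_def t)
qed

lemma velocity_lift:
  assumes q: "\<And>s. q s = (x s, y s, circle_of (\<theta> s))"
    and x: "(x has_real_derivative a) (at t)" and y: "(y has_real_derivative b) (at t)"
    and \<theta>: "(\<theta> has_real_derivative c) (at t)"
  shows "velocity q t = (a, b, c)"
  unfolding velocity_def
proof (rule the_equality)
  have "((\<lambda>s. (x s, y s, \<theta> s)) has_vector_derivative (a, b, c)) (at t)"
    using x y \<theta> unfolding has_real_derivative_iff_has_vector_derivative
    by (intro has_vector_derivative_Pair)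
  then show "has_velocity q (a, b, c) (at t)"
    unfolding has_velocity_def by (intro exI[of _ "\<lambda>s. (x s, y s, \<theta> s)"]) (auto simp: M_of_def q)
  fix w assume w: "has_velocity q w (at t)"
  obtain a' b' c' where w': "w = (a', b', c')" by (cases w)
  note * = has_velocity_lift[OF w[unfolded w'] UNIV_I q DERIV_continuous[OF \<theta>]]
  show "w = (a, b, c)"
    using DERIV_unique[OF *(1) x] DERIV_unique[OF *(2) y] DERIV_unique[OF *(3) \<theta>] w' by simp
qed

lemma lipschitz_of_bounded_derivative:
  fixes f :: "real \<Rightarrow> real"
  assumes "\<And>t. t \<in> {a..b} \<Longrightarrow> (f has_real_derivative f' t) (at t within {a..b})"
    and "\<And>t. t \<in> {a..b} \<Longrightarrow> \<bar>f' t\<bar> \<le> C" and "s \<in> {a..b}" "t \<in> {a..b}"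
  shows "\<bar>f s - f t\<bar> \<le> C * \<bar>s - t\<bar>"
  using field_differentiable_bound[of "{a..b}" f f' C t s] assms by (auto simp: abs_minus_commute)

lemma dist_M_le: "dist (x, y, p) (x', y', p' :: circle) \<le> \<bar>x - x'\<bar> + \<bar>y - y'\<bar> + dist p p'" for x y x' y' :: real
proof -
  have "dist (x, y, p) (x', y', p') \<le> dist x x' + dist (y, p) (y', p')"
    unfolding dist_Pair_Pair[of x] by (rule sqrt_sum_squares_le_sum) auto
  also have "dist (y, p) (y', p') \<le> dist y y' + dist p p'"
    unfolding dist_Pair_Pair by (rule sqrt_sum_squares_le_sum) auto
  finally show ?thesis by (simp add: dist_real_def)
qed

lemma admissible_of_lift:
  assumes l: "0 \<le> l" and ac: "abs_continuous_on {0..l} \<theta>"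
    and v: "set_integrable lebesgue {0..l} v" and N: "negligible N"
    and \<theta>: "\<And>t. t \<in> {0..l} \<Longrightarrow> t \<notin> N \<Longrightarrow> (\<theta> has_real_derivative v t) (at t within {0..l})"
    and x: "\<And>t. t \<in> {0..l} \<Longrightarrow> (x has_real_derivative cos (\<theta> t)) (at t within {0..l})"
    and y: "\<And>t. t \<in> {0..l} \<Longrightarrow> (y has_real_derivative sin (\<theta> t)) (at t within {0..l})"
    and q: "\<And>t. q t = (x t, y t, circle_of (\<theta> t))"
  shows "admissible (q 0) (q l) l q v"
  unfolding admissible_def
proof (intro conjI refl l v)
  show "abs_continuous_on {0..l} q"
  proof (rule abs_continuous_on_dominated[OF ac zero_less_one, of 2 1])
    fix s t assume st: "s \<in> {0..l}" "t \<in> {0..l}" "s \<le> t"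
    have "\<bar>x s - x t\<bar> \<le> 1 * \<bar>s - t\<bar>" "\<bar>y s - y t\<bar> \<le> 1 * \<bar>s - t\<bar>"
      using lipschitz_of_bounded_derivative[OF x abs_cos_le_one st(1,2)]
        lipschitz_of_bounded_derivative[OF y abs_sin_le_one st(1,2)] by auto
    then show "dist (q s) (q t) \<le> 2 * (t - s) + 1 * dist (\<theta> s) (\<theta> t)"
      using dist_M_le[of "x s" "y s" "circle_of (\<theta> s)" "x t" "y t" "circle_of (\<theta> t)"]
        dist_circle_le[of "\<theta> s" "\<theta> t"] st(3) by (simp add: q dist_real_def)
  qed auto
  show "AE s in lebesgue. s \<in> {0..l} \<longrightarrow>
        has_velocity q (cos_circle (heading (q s)), sin_circle (heading (q s)), v s)
          (at s within {0..l})"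
  proof (rule AE_I')
    show "N \<in> null_sets lebesgue" using N by (simp add: negligible_iff_null_sets)
    show "{s \<in> space lebesgue. \<not> (s \<in> {0..l} \<longrightarrow>
        has_velocity q (cos_circle (heading (q s)), sin_circle (heading (q s)), v s)
          (at s within {0..l}))} \<subseteq> N"
    proof (rule subsetI, rule ccontr)
      fix s assume s': "s \<in> {s \<in> space lebesgue. \<not> (s \<in> {0..l} \<longrightarrow>
        has_velocity q (cos_circle (heading (q s)), sin_circle (heading (q s)), v s)
          (at s within {0..l}))}" and "s \<notin> N"
      then have s: "s \<notin> N" "s \<in> {0..l}"
        and no: "\<not> has_velocity q (cos_circle (heading (q s)), sin_circle (heading (q s)), v s)
          (at s within {0..l})" by blast+
      have "((\<lambda>s. (x s, y s, \<theta> s)) has_vector_derivative (cos (\<theta> s), sin (\<theta> s), v s)) (at s within {0..l})"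
        using x[OF s(2)] y[OF s(2)] \<theta>[OF s(2,1)] unfolding has_real_derivative_iff_has_vector_derivative
        by (intro has_vector_derivative_Pair)
      then have "has_velocity q (cos_circle (heading (q s)), sin_circle (heading (q s)), v s)
          (at s within {0..l})"
        unfolding has_velocity_def
        by (intro exI[of _ "\<lambda>s. (x s, y s, \<theta> s)"]) (auto simp: M_of_def q heading_def)
      then show False using no by blast
    qed
  qed
qed

text \<open>The heading is a path in the unit circle of \<open>\<complex>\<close> and has a continuous logarithm. Lifting is a local
  isometry, which carries absolute continuity over to \<open>\<theta>\<close>. The planar coordinates are primitives of
  continuous functions, so their derivatives exist everywhere and not only almost everywhere.\<close>

lemma admissible_lift:
  assumes "admissible q_in q_fin l q v"
  obtains x y \<theta> :: "real \<Rightarrow> real" and N where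
    "\<And>t. q t = (x t, y t, circle_of (\<theta> t))" "abs_continuous_on {0..l} \<theta>" "continuous_on {0..l} \<theta>"
    "negligible N"
    "\<And>t. t \<in> {0..l} \<Longrightarrow> t \<notin> N \<Longrightarrow> (\<theta> has_real_derivative v t) (at t within {0..l})"
    "\<And>t. t \<in> {0..l} \<Longrightarrow> (x has_real_derivative cos (\<theta> t)) (at t within {0..l})"
    "\<And>t. t \<in> {0..l} \<Longrightarrow> (y has_real_derivative sin (\<theta> t)) (at t within {0..l})"
proof -
  have l: "0 \<le> l" and v: "set_integrable lebesgue {0..l} v" and ac: "abs_continuous_on {0..l} q"
    and ae: "AE s in lebesgue. s \<in> {0..l} \<longrightarrow>
        has_velocity q (cos_circle (heading (q s)), sin_circle (heading (q s)), v s)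
          (at s within {0..l})"
    using assms unfolding admissible_def by auto
  define x where "x t = fst (q t)" for t
  define y where "y t = fst (snd (q t))" for t
  define c where "c t = Complex (cos_circle (heading (q t))) (sin_circle (heading (q t)))" for t
  have dh: "dist (heading (q s)) (heading (q t)) \<le> dist (q s) (q t)" for s t
    unfolding heading_def by (intro order_trans[OF dist_snd_le] dist_snd_le)
  have contq: "continuous_on {0..l} q" by (rule abs_continuous_on_imp_continuous_on[OF ac])
  have "continuous_on {0..l} (\<lambda>t. f (heading (q t)))"
    if "\<And>p p'. dist (f p) (f p') \<le> dist p p'" for f :: "circle \<Rightarrow> real"
    unfolding continuous_on_iff
  proof (intro ballI allI impI)
    fix t e :: real assume "t \<in> {0..l}" "e > 0"
    with contq obtain d where "d > 0" "\<And>s. s \<in> {0..l} \<Longrightarrow> dist s t < d \<Longrightarrow> dist (q s) (q t) < e"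
      unfolding continuous_on_iff by metis
    then show "\<exists>d>0. \<forall>s\<in>{0..l}. dist s t < d \<longrightarrow> dist (f (heading (q s))) (f (heading (q t))) < e"
      using that dh by (meson le_less_trans)
  qed
  from this[of cos_circle, OF dist_cos_circle_le] this[of sin_circle, OF dist_sin_circle_le]
  have "continuous_on {0..l} c"
    unfolding c_def Complex_eq by (intro continuous_intros)
  moreover have norm_c: "cmod (c t) = 1" for t
  proof -
    obtain a where "circle_of a = heading (q t)" using circle_of_surj by blast
    then have "c t = Complex (cos a) (sin a)" unfolding c_def
      using cos_circle_of[of a] sin_circle_of[of a] by simp
    then show ?thesis by (simp add: cmod_def)
  qed
  moreover have "c t \<noteq> 0" for t using norm_c[of t] by auto
  moreover have "contractible {0..l}" by (intro convex_imp_contractible convex_real_interval)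
  ultimately obtain g where g: "continuous_on {0..l} g" "\<And>t. t \<in> {0..l} \<Longrightarrow> c t = exp (g t)"
    using continuous_logarithm_on_contractible[of "{0..l}" c] by metis
  define \<theta> where "\<theta> t = (if t \<in> {0..l} then Im (g t) else SOME a. circle_of a = heading (q t))" for t
  have "continuous_on {0..l} (\<lambda>t. Im (g t))" by (intro continuous_intros g)
  then have cont\<theta>: "continuous_on {0..l} \<theta>"
    by (rule continuous_on_eq) (simp add: \<theta>_def)
  have lift: "circle_of (\<theta> t) = heading (q t)" for t
  proof (cases "t \<in> {0..l}")
    case True
    have "exp (Re (g t)) = 1" using g(2)[OF True] norm_c[of t] by (simp add: norm_exp_eq_Re)
    then have "c t = Complex (cos (\<theta> t)) (sin (\<theta> t))"
      using g(2)[OF True] True by (simp add: complex_eq_iff Re_exp Im_exp \<theta>_def)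
    then show ?thesis unfolding c_def by (intro circle_of_eqI[symmetric]) auto
  next
    case False
    then show ?thesis using someI_ex[OF circle_of_surj, of "heading (q t)"]
      by (simp only: \<theta>_def if_False)
  qed
  then have q: "q t = (x t, y t, circle_of (\<theta> t))" for t
    by (simp add: x_def y_def heading_def)
  have ac\<theta>: "abs_continuous_on {0..l} \<theta>"
  proof -
    have "uniformly_continuous_on {0..l} \<theta>"
      by (rule compact_uniformly_continuous[OF cont\<theta>]) simp
    then obtain \<eta> where \<eta>: "\<eta> > 0" "\<And>s t. s \<in> {0..l} \<Longrightarrow> t \<in> {0..l} \<Longrightarrow> dist t s < \<eta> \<Longrightarrow> dist (\<theta> t) (\<theta> s) < pi"
      unfolding uniformly_continuous_on_def using pi_gt_zero by metis
    show ?thesis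
    proof (rule abs_continuous_on_dominated[OF ac \<eta>(1), of 0 1])
      fix s t assume st: "s \<in> {0..l}" "t \<in> {0..l}" "s \<le> t" "t - s < \<eta>"
      have "dist (\<theta> s) (\<theta> t) < pi" using \<eta>(2)[OF st(2,1)] st(3,4) by (simp add: dist_real_def)
      then have "dist (\<theta> s) (\<theta> t) = dist (heading (q s)) (heading (q t))"
        using dist_circle_of_eq[of "\<theta> s" "\<theta> t"] by (simp add: lift dist_real_def)
      then show "dist (\<theta> s) (\<theta> t) \<le> 0 * (t - s) + 1 * dist (q s) (q t)" using dh[of s t] by simp
    qed auto
  qed
  obtain N where N: "N \<in> null_sets lebesgue" "{s \<in> space lebesgue. \<not> (s \<in> {0..l} \<longrightarrow>
        has_velocity q (cos_circle (heading (q s)), sin_circle (heading (q s)), v s)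
          (at s within {0..l}))} \<subseteq> N"
    using ae unfolding eventually_ae_filter by blast
  have negN: "negligible N" using N(1) by (simp add: negligible_iff_null_sets)
  have der: "(x has_real_derivative cos (\<theta> t)) (at t within {0..l})"
    "(y has_real_derivative sin (\<theta> t)) (at t within {0..l})"
    "(\<theta> has_real_derivative v t) (at t within {0..l})" if t: "t \<in> {0..l}" "t \<notin> N" for t
  proof -
    have "has_velocity q (cos_circle (heading (q t)), sin_circle (heading (q t)), v t) (at t within {0..l})"
      using N(2) t by auto
    then have "has_velocity q (cos (\<theta> t), sin (\<theta> t), v t) (at t within {0..l})"
      by (simp add: q heading_def)
    from has_velocity_lift[OF this t(1) q] cont\<theta> t(1)
    show "(x has_real_derivative cos (\<theta> t)) (at t within {0..l})"
      "(y has_real_derivative sin (\<theta> t)) (at t within {0..l})"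
      "(\<theta> has_real_derivative v t) (at t within {0..l})"
      by (auto simp: continuous_on_eq_continuous_within)
  qed
  have everywhere: "(f has_real_derivative k t) (at t within {0..l})"
    if acf: "abs_continuous_on {0..l} f" and k: "continuous_on {0..l} k"
      and d: "\<And>t. t \<in> {0..l} \<Longrightarrow> t \<notin> N \<Longrightarrow> (f has_real_derivative k t) (at t within {0..l})"
      and t: "t \<in> {0..l}" for f k t
  proof -
    have "((\<lambda>u. integral {0..u} k) has_real_derivative k t) (at t within {0..l})"
      by (rule integral_has_real_derivative[OF k t])
    then have "((\<lambda>u. f 0 + integral {0..u} k) has_real_derivative k t) (at t within {0..l})"
      by (auto intro!: derivative_eq_intros)
    moreover have "f 0 + integral {0..u} k = f u" if u: "u \<in> {0..l}" for u
    proof -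
      have sub: "{0..u} \<subseteq> {0..l}" using u by auto
      have "f u - f 0 = integral {0..u} k"
        by (rule ac_increment_eq_integral[OF _ abs_continuous_on_subset[OF acf sub]
              integrable_continuous_interval[OF continuous_on_subset[OF k sub]] negN])
          (use u in \<open>auto intro: DERIV_subset[OF d sub]\<close>)
      then show ?thesis by simp
    qed
    ultimately show ?thesis
      by (rule has_field_derivative_transform_within[OF _ zero_less_one t])
  qed
  have acx: "abs_continuous_on {0..l} x" "abs_continuous_on {0..l} y"
  proof -
    have "dist (x s) (x t) \<le> dist (q s) (q t)" "dist (y s) (y t) \<le> dist (q s) (q t)" for s t
      unfolding x_def y_def by (rule dist_fst_le, rule order_trans[OF dist_fst_le dist_snd_le])
    then show "abs_continuous_on {0..l} x" "abs_continuous_on {0..l} y"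
      by (auto intro!: abs_continuous_on_dominated[OF ac zero_less_one, of 0 1])
  qed
  show thesis
  proof (rule that[OF q ac\<theta> cont\<theta> negN])
    show "(\<theta> has_real_derivative v t) (at t within {0..l})" if "t \<in> {0..l}" "t \<notin> N" for t
      using der(3) that by blast
    show "(x has_real_derivative cos (\<theta> t)) (at t within {0..l})" if "t \<in> {0..l}" for t
      by (rule everywhere[OF acx(1) _ der(1) that]) (auto intro!: continuous_intros cont\<theta>)
    show "(y has_real_derivative sin (\<theta> t)) (at t within {0..l})" if "t \<in> {0..l}" for t
      by (rule everywhere[OF acx(2) _ der(2) that]) (auto intro!: continuous_intros cont\<theta>)
  qed
qed

section \<open>Convexity of the reduced Lagrangian\<close>

text \<open>The convex function \<open>sec\<close> lies above its tangent at \<open>\<beta>\<close>; multiplying by \<open>cos \<Theta> cos\<^sup>2 \<beta>\<close> gives a form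
  that remains true where \<open>sec \<Theta>\<close> is infinite.\<close>

lemma sec_above_tangent:
  fixes \<Theta> \<beta> :: real
  assumes \<Theta>: "- (pi / 2) \<le> \<Theta>" "\<Theta> \<le> pi / 2" and \<beta>: "- (pi / 2) < \<beta>" "\<beta> < pi / 2"
  shows "cos \<Theta> * (cos \<beta> + sin \<beta> * (\<Theta> - \<beta>)) \<le> (cos \<beta>)\<^sup>2"
proof (cases "cos \<Theta> = 0")
  case False
  let ?I = "{- (pi / 2)<..<pi / 2}"
  have pos: "cos x > 0" if "x \<in> ?I" for x using that cos_gt_zero_pi[of x] by auto
  have "\<Theta> \<noteq> pi / 2" "\<Theta> \<noteq> - (pi / 2)" using False by (metis cos_pi_half, metis cos_minus cos_pi_half)
  then have \<Theta>I: "\<Theta> \<in> ?I" using \<Theta> by auto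
  have "convex_on ?I (\<lambda>x. 1 / cos x)"
  proof (rule f''_ge0_imp_convex)
    fix x assume x: "x \<in> ?I"
    show "((\<lambda>x. 1 / cos x) has_real_derivative sin x / (cos x)\<^sup>2) (at x)"
      using pos[OF x] by (auto intro!: derivative_eq_intros simp: power2_eq_square)
    show "((\<lambda>x. sin x / (cos x)\<^sup>2) has_real_derivative
        (cos x * (cos x)\<^sup>2 + sin x * (2 * cos x * sin x)) / ((cos x)\<^sup>2 * (cos x)\<^sup>2)) (at x)"
      using pos[OF x] by (auto intro!: derivative_eq_intros)
    have "sin x * (2 * cos x * sin x) = 2 * cos x * (sin x)\<^sup>2" by (simp add: power2_eq_square)
    then show "0 \<le> (cos x * (cos x)\<^sup>2 + sin x * (2 * cos x * sin x)) / ((cos x)\<^sup>2 * (cos x)\<^sup>2)"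
      using pos[OF x] by (intro divide_nonneg_nonneg add_nonneg_nonneg) auto
  qed simp
  then have "sin \<beta> / (cos \<beta>)\<^sup>2 * (\<Theta> - \<beta>) \<le> 1 / cos \<Theta> - 1 / cos \<beta>"
  proof (rule convex_on_imp_above_tangent)
    show "((\<lambda>x. 1 / cos x) has_real_derivative sin \<beta> / (cos \<beta>)\<^sup>2) (at \<beta> within ?I)"
      using pos[of \<beta>] \<beta> by (auto intro!: derivative_eq_intros simp: power2_eq_square)
  qed (use \<beta> \<Theta>I in auto)
  then have "cos \<Theta> * (cos \<beta>)\<^sup>2 * (sin \<beta> / (cos \<beta>)\<^sup>2 * (\<Theta> - \<beta>)) \<le> cos \<Theta> * (cos \<beta>)\<^sup>2 * (1 / cos \<Theta> - 1 / cos \<beta>)"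
    using pos[OF \<Theta>I] by (intro mult_left_mono) auto
  moreover have "cos \<Theta> * (cos \<beta>)\<^sup>2 * (sin \<beta> / (cos \<beta>)\<^sup>2 * (\<Theta> - \<beta>)) = cos \<Theta> * (sin \<beta> * (\<Theta> - \<beta>))"
    using pos[of \<beta>] \<beta> by simp
  moreover have "cos \<Theta> * (cos \<beta>)\<^sup>2 * (1 / cos \<Theta> - 1 / cos \<beta>) = (cos \<beta>)\<^sup>2 - cos \<Theta> * cos \<beta>"
    using pos[of \<beta>] \<beta> pos[OF \<Theta>I] by (simp add: field_simps power2_eq_square)
  ultimately show ?thesis by (simp add: distrib_left)
qed simp

lemma cos_arcsin_sin: "cos (arcsin (sin a)) = \<bar>cos a\<bar>"
  by (simp add: cos_arcsin cos_squared_eq[symmetric] real_sqrt_abs)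

text \<open>Folding the angle into \<open>[- \<pi>/2, \<pi>/2]\<close> by reflection in the axis \<open>cos = 0\<close>: this keeps \<open>\<bar>cos\<bar>\<close>, and
  \<open>cos (arcsin (sin a) - arcsin (sin b)) = \<bar>cos a cos b\<bar> + sin a sin b \<ge> cos (a - b)\<close>.\<close>

lemma arcsin_sin_nonexpansive: "\<bar>arcsin (sin a) - arcsin (sin b)\<bar> \<le> \<bar>a - b\<bar>"
proof (cases "\<bar>a - b\<bar> \<ge> pi")
  case True
  have "\<bar>arcsin (sin a) - arcsin (sin b)\<bar> \<le> pi"
    using arcsin_bounded[of "sin a"] arcsin_bounded[of "sin b"] by (simp add: abs_le_iff)
  with True show ?thesis by simp
next
  case False
  have bd: "\<bar>arcsin (sin a) - arcsin (sin b)\<bar> \<le> pi"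
    using arcsin_bounded[of "sin a"] arcsin_bounded[of "sin b"] by (simp add: abs_le_iff)
  have "cos \<bar>a - b\<bar> = cos a * cos b + sin a * sin b" by (simp add: cos_diff)
  also have "\<dots> \<le> \<bar>cos a\<bar> * \<bar>cos b\<bar> + sin a * sin b" by (simp flip: abs_mult)
  also have "\<dots> = cos \<bar>arcsin (sin a) - arcsin (sin b)\<bar>" by (simp add: cos_diff cos_arcsin_sin)
  finally show ?thesis
    using cos_mono_le_eq[of "\<bar>a - b\<bar>" "\<bar>arcsin (sin a) - arcsin (sin b)\<bar>"] False bd by simp
qed

lemma tendsto_straddle:
  fixes f :: "real \<Rightarrow> real"
  assumes der: "(f has_real_derivative D) (at t within {a..b})" and t: "t \<in> {a..b}"
    and uw: "\<And>n. a \<le> u n" "\<And>n. u n \<le> t" "\<And>n. t \<le> w n" "\<And>n. w n \<le> b" "\<And>n. u n < w n"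
    and lim: "(\<lambda>n. w n - u n) \<longlonglongrightarrow> 0"
  shows "(\<lambda>n. (f (w n) - f (u n)) / (w n - u n)) \<longlonglongrightarrow> D"
proof (rule LIMSEQ_I)
  fix r :: real assume r: "r > 0"
  then have r2: "r / 2 > 0" by simp
  from has_real_derivative_straddle[OF der t r2]
  obtain \<delta> where \<delta>: "\<delta> > 0" and *: "\<forall>u w. a \<le> u \<longrightarrow> u \<le> t \<longrightarrow> t \<le> w \<longrightarrow> w \<le> b \<longrightarrow> w - u < \<delta> \<longrightarrow>
      \<bar>f w - f u - D * (w - u)\<bar> \<le> r / 2 * (w - u)" by (elim exE conjE)
  from LIMSEQ_D[OF lim \<delta>] obtain no where no: "\<And>n. n \<ge> no \<Longrightarrow> \<bar>w n - u n\<bar> < \<delta>" by auto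
  show "\<exists>no. \<forall>n\<ge>no. norm ((f (w n) - f (u n)) / (w n - u n) - D) < r"
  proof (intro exI allI impI)
    fix n assume "n \<ge> no"
    then have "w n - u n < \<delta>" using no[of n] by simp
    then have 1: "\<bar>f (w n) - f (u n) - D * (w n - u n)\<bar> \<le> r / 2 * (w n - u n)"
      by (intro *[THEN spec, THEN spec, THEN mp, THEN mp, THEN mp, THEN mp, THEN mp] uw)
    have pos: "w n - u n > 0" using uw(5)[of n] by simp
    have "(f (w n) - f (u n)) / (w n - u n) - D = (f (w n) - f (u n) - D * (w n - u n)) / (w n - u n)"
      using pos by (simp add: diff_divide_distrib)
    then have "\<bar>(f (w n) - f (u n)) / (w n - u n) - D\<bar> = \<bar>f (w n) - f (u n) - D * (w n - u n)\<bar> / (w n - u n)"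
      using pos by (simp add: abs_divide)
    also have "\<dots> \<le> r / 2" using 1 pos by (simp add: pos_divide_le_eq)
    finally show "norm ((f (w n) - f (u n)) / (w n - u n) - D) < r" using r by simp
  qed
qed

text \<open>The Cauchy-Schwarz inequality for \<open>(sqrt (1 - h\<^sup>2), \<bar>h\<bar>)\<close> and \<open>(\<xi>, \<bar>v\<bar>)\<close>: the cost density dominates
  its linearization at any momentum \<open>h\<close>.\<close>

lemma cauchy_schwarz_cost:
  fixes \<xi> h v :: real
  assumes "\<xi> > 0" "\<bar>h\<bar> < 1"
  shows "\<xi> * sqrt (1 - h\<^sup>2) + \<bar>h\<bar> * \<bar>v\<bar> \<le> sqrt (\<xi>\<^sup>2 + v\<^sup>2)"
proof (rule real_le_rsqrt)
  have h: "h\<^sup>2 \<le> 1" using assms by (simp add: abs_square_le_1)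
  define r where "r = sqrt (1 - h\<^sup>2)"
  have r: "r\<^sup>2 = 1 - h\<^sup>2" using h by (simp add: r_def)
  have "(\<xi> * r + \<bar>h\<bar> * \<bar>v\<bar>)\<^sup>2 + (\<xi> * \<bar>h\<bar> - r * \<bar>v\<bar>)\<^sup>2 = (\<xi>\<^sup>2 + v\<^sup>2) * (r\<^sup>2 + h\<^sup>2)"
  proof -
    have "(\<xi> * r + \<bar>h\<bar> * \<bar>v\<bar>)\<^sup>2 + (\<xi> * \<bar>h\<bar> - r * \<bar>v\<bar>)\<^sup>2 = (\<xi>\<^sup>2 + \<bar>v\<bar>\<^sup>2) * (r\<^sup>2 + \<bar>h\<bar>\<^sup>2)"
      by algebra
    then show ?thesis by simp
  qed
  then have "(\<xi> * r + \<bar>h\<bar> * \<bar>v\<bar>)\<^sup>2 + (\<xi> * \<bar>h\<bar> - r * \<bar>v\<bar>)\<^sup>2 = \<xi>\<^sup>2 + v\<^sup>2" by (simp add: r)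
  then show "(\<xi> * sqrt (1 - h\<^sup>2) + \<bar>h\<bar> * \<bar>v\<bar>)\<^sup>2 \<le> \<xi>\<^sup>2 + v\<^sup>2"
    unfolding r_def[symmetric] using zero_le_power2[of "\<xi> * \<bar>h\<bar> - r * \<bar>v\<bar>"] by linarith
qed

lemma set_borel_measurable_comp:
  fixes f :: "'a \<Rightarrow> 'b::euclidean_space" and F :: "'b \<Rightarrow> 'c::euclidean_space"
  assumes f: "set_borel_measurable M A f" and A: "A \<in> sets M" and F: "continuous_on UNIV F"
  shows "set_borel_measurable M A (\<lambda>x. F (f x))"
proof -
  have Fm: "F \<in> borel_measurable borel" using F by (rule borel_measurable_continuous_onI)
  have "(\<lambda>x. indicator A x *\<^sub>R F (indicator A x *\<^sub>R f x)) \<in> borel_measurable M"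
    by (intro borel_measurable_scaleR borel_measurable_indicator A
        measurable_compose[OF f[unfolded set_borel_measurable_def] Fm])
  moreover have "(\<lambda>x. indicator A x *\<^sub>R F (indicator A x *\<^sub>R f x)) = (\<lambda>x. indicator A x *\<^sub>R F (f x))"
    by (auto simp: indicator_def)
  ultimately show ?thesis unfolding set_borel_measurable_def by simp
qed

lemma set_integrable_cost:
  fixes v :: "real \<Rightarrow> real"
  assumes v: "set_integrable lebesgue {a..b} v"
  shows "set_integrable lebesgue {a..b} (\<lambda>s. sqrt (\<xi>\<^sup>2 + (v s)\<^sup>2))"
proof (rule set_integrable_bound)
  have "set_integrable lebesgue {a..b} (\<lambda>s. \<bar>\<xi>\<bar>)"
    using absolutely_integrable_on_const[of "{a..b}"] by simp
  then show "set_integrable lebesgue {a..b} (\<lambda>s. \<bar>\<xi>\<bar> + \<bar>v s\<bar>)"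
    by (rule set_integral_add(1)) (rule set_integrable_abs[OF v])
  show "set_borel_measurable lebesgue {a..b} (\<lambda>s. sqrt (\<xi>\<^sup>2 + (v s)\<^sup>2))"
    using v by (intro set_borel_measurable_comp[where F = "\<lambda>v. sqrt (\<xi>\<^sup>2 + v\<^sup>2)"])
      (auto simp: set_integrable_def set_borel_measurable_def intro!: continuous_intros)
  show "AE x in lebesgue. x \<in> {a..b} \<longrightarrow> norm (sqrt (\<xi>\<^sup>2 + (v x)\<^sup>2)) \<le> norm (\<bar>\<xi>\<bar> + \<bar>v x\<bar>)"
  proof (rule AE_I2, rule impI)
    fix x
    show "norm (sqrt (\<xi>\<^sup>2 + (v x)\<^sup>2)) \<le> norm (\<bar>\<xi>\<bar> + \<bar>v x\<bar>)"
      using sqrt_sum_squares_le_sum_abs[of \<xi> "v x"] by simp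
  qed
qed

lemma cost_eq_integral:
  assumes "set_integrable lebesgue {0..l} v"
  shows "cost \<xi> l v = integral {0..l} (\<lambda>s. sqrt (\<xi>\<^sup>2 + (v s)\<^sup>2))"
  unfolding cost_def by (rule set_lebesgue_integral_eq_integral(2)[OF set_integrable_cost[OF assms]])

section \<open>The calibration inequality\<close>

definition running_max :: "(real \<Rightarrow> real) \<Rightarrow> real \<Rightarrow> real" where
  "running_max f t = Sup (f ` {0..t})"

lemma running_max_attained:
  assumes "continuous_on {0..T} f" "0 \<le> t" "t \<le> T"
  shows "\<exists>r\<in>{0..t}. running_max f t = f r \<and> (\<forall>s\<in>{0..t}. f s \<le> f r)"
proof -
  have "continuous_on {0..t} f" using assms by (auto intro: continuous_on_subset)
  then obtain r where r: "r \<in> {0..t}" "\<And>s. s \<in> {0..t} \<Longrightarrow> f s \<le> f r"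
    using continuous_attains_sup[of "{0..t}" f] assms by auto
  have "Sup (f ` {0..t}) = f r" by (rule cSup_eq_maximum) (use r in auto)
  then show ?thesis using r unfolding running_max_def by blast
qed

text \<open>The running maximum grows only while the function itself reaches new values, so its increments are
  bounded by the positive part of the derivative.\<close>

lemma running_max_increment:
  assumes der: "\<And>t. t \<in> {0..T} \<Longrightarrow> (f has_real_derivative k t) (at t within {0..T})"
    and uw: "0 \<le> u" "u \<le> w" "w \<le> T"
  shows "\<exists>s\<in>{u..w}. 0 \<le> running_max f w - running_max f u \<and>
    running_max f w - running_max f u \<le> max 0 (k s) * (w - u)"
proof -
  have cont: "continuous_on {0..T} f" by (rule DERIV_continuous_on[OF der])
  obtain r where r: "r \<in> {0..u}" "running_max f u = f r" "\<forall>s\<in>{0..u}. f s \<le> f r"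
    using running_max_attained[OF cont, of u] uw by auto
  obtain r' where r': "r' \<in> {0..w}" "running_max f w = f r'" "\<forall>s\<in>{0..w}. f s \<le> f r'"
    using running_max_attained[OF cont, of w] uw by auto
  have ge: "f r \<le> f r'" using r(1) r'(3) uw by auto
  show ?thesis
  proof (cases "r' \<le> u")
    case True
    then have "f r' \<le> f r" using r(3) r'(1) by simp
    then have "running_max f w - running_max f u = 0" using ge unfolding r(2) r'(2) by simp
    then show ?thesis using uw(2) by (intro bexI[of _ u]) (simp_all only: order_refl atLeastAtMost_iff, simp_all)
  next
    case False
    have "\<exists>z\<in>{u<..<r'}. f r' - f u = (r' - u) * k z"
    proof -
      have "\<exists>z\<in>{u<..<r'}. f r' - f u = (\<lambda>h. k z * h) (r' - u)"
      proof (rule mvt_simple)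
        fix z assume "u \<le> z" "z \<le> r'"
        then have "z \<in> {0..T}" "{u..r'} \<subseteq> {0..T}" using uw r' by auto
        then show "(f has_derivative (\<lambda>h. k z * h)) (at z within {u..r'})"
          using DERIV_subset[OF der[of z], of "{u..r'}"] by (simp add: has_field_derivative_def)
      qed (use False in auto)
      then show ?thesis by (simp add: mult.commute)
    qed
    then obtain z where z: "z \<in> {u<..<r'}" "f r' - f u = (r' - u) * k z" by blast
    have "f u \<le> f r" using r(3) uw(1) by simp
    then have "f r' - f r \<le> (r' - u) * k z" using z(2) by linarith
    also have "\<dots> \<le> (r' - u) * max 0 (k z)" using False by (intro mult_left_mono) simp_all
    also have "\<dots> \<le> (w - u) * max 0 (k z)" using r'(1) by (intro mult_right_mono) simp_all
    finally have "f r' - f r \<le> max 0 (k z) * (w - u)" by (simp only: mult.commute)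
    moreover have "z \<in> {u..w}" using z(1) r'(1) by simp
    ultimately show ?thesis using ge unfolding r(2) r'(2) by (intro bexI[of _ z]) simp_all
  qed
qed

lemma cauchy_mean_value:
  fixes f g :: "real \<Rightarrow> real"
  assumes ab: "a \<le> b" and f: "\<And>x. a \<le> x \<Longrightarrow> x \<le> b \<Longrightarrow> (f has_real_derivative f' x) (at x)"
    and g: "\<And>x. a \<le> x \<Longrightarrow> x \<le> b \<Longrightarrow> (g has_real_derivative g' x) (at x)"
  shows "\<exists>z\<in>{a..b}. (f b - f a) * g' z = f' z * (g b - g a)"
proof (cases "a = b")
  case False
  have "\<exists>z. z > a \<and> z < b \<and> (\<lambda>x. f x * (g b - g a) - g x * (f b - f a)) b - (\<lambda>x. f x * (g b - g a) - g x * (f b - f a)) a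
    = (b - a) * (f' z * (g b - g a) - g' z * (f b - f a))"
  proof (rule MVT2)
    show "a < b" using ab False by simp
    fix x assume "a \<le> x" "x \<le> b"
    then show "((\<lambda>x. f x * (g b - g a) - g x * (f b - f a)) has_real_derivative
        f' x * (g b - g a) - g' x * (f b - f a)) (at x)"
      using f[of x] g[of x] by (auto intro!: derivative_eq_intros)
  qed
  then obtain z where z: "z > a" "z < b" "f b * (g b - g a) - g b * (f b - f a) - (f a * (g b - g a) - g a * (f b - f a))
    = (b - a) * (f' z * (g b - g a) - g' z * (f b - f a))" by auto
  have "f b * (g b - g a) - g b * (f b - f a) - (f a * (g b - g a) - g a * (f b - f a)) = 0" by algebra
  then have "f' z * (g b - g a) - g' z * (f b - f a) = 0" using z ab False by simp
  then show ?thesis using z by (intro bexI[of _ z]) (auto simp: mult.commute)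
qed auto

text \<open>The reference extremal is given by \<open>X\<close> (the coordinate along its momentum), the angle \<open>\<beta>\<close> to that
  direction, the momentum \<open>h\<close> and the accumulated cost \<open>C\<close>. It is calibrated by the function
  \<open>S(\<tau>, \<Theta>) = C \<tau> + h \<tau> (\<Theta> - \<beta> \<tau>)\<close>, where the parameter \<open>\<tau>\<close> stands for the position \<open>X \<tau>\<close>; it is affine in
  \<open>\<Theta>\<close> because the Lagrangian is convex. One finds \<open>dS = P (1 + tan \<beta> (\<Theta> - \<beta>)) dX + h d\<Theta>\<close>. By
  \<open>sec_above_tangent\<close> the first coefficient is at most \<open>P cos \<beta> / cos \<Theta> = \<xi> sqrt (1 - h\<^sup>2) / cos \<Theta>\<close>, so that
  \<open>dS\<close> is bounded by the cost by Cauchy-Schwarz, provided that \<open>dX \<ge> 0\<close>.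

  A competitor need not move forward in \<open>X\<close>. Therefore \<open>S\<close> is evaluated at its folded angle and at the
  running maximum of its coordinate \<open>xc\<close>, clipped to the range \<open>[X a, X b]\<close> of the reference.\<close>

lemma calibration_inequality:
  fixes \<xi> P a b T :: real and X \<beta> h C xc \<theta>c v :: "real \<Rightarrow> real"
  assumes \<xi>: "\<xi> > 0" and P: "P > 0" and ab: "a \<le> b"
    and \<beta>: "\<And>\<tau>. \<tau> \<in> {a..b} \<Longrightarrow> - (pi / 2) < \<beta> \<tau> \<and> \<beta> \<tau> < pi / 2"
    and h1: "\<And>\<tau>. \<tau> \<in> {a..b} \<Longrightarrow> \<bar>h \<tau>\<bar> < 1"
    and Ph: "\<And>\<tau>. \<tau> \<in> {a..b} \<Longrightarrow> P * cos (\<beta> \<tau>) = \<xi> * sqrt (1 - (h \<tau>)\<^sup>2)"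
    and X': "\<And>\<tau>. \<tau> \<in> {a..b} \<Longrightarrow> (X has_real_derivative cos (\<beta> \<tau>)) (at \<tau>)"
    and h': "\<And>\<tau>. \<tau> \<in> {a..b} \<Longrightarrow> (h has_real_derivative P * sin (\<beta> \<tau>)) (at \<tau>)"
    and \<beta>': "\<And>\<tau>. \<tau> \<in> {a..b} \<Longrightarrow> (\<beta> has_real_derivative \<xi> * h \<tau> / sqrt (1 - (h \<tau>)\<^sup>2)) (at \<tau>)"
    and C': "\<And>\<tau>. \<tau> \<in> {a..b} \<Longrightarrow> (C has_real_derivative \<xi> / sqrt (1 - (h \<tau>)\<^sup>2)) (at \<tau>)"
    and T: "0 \<le> T" and ac: "abs_continuous_on {0..T} \<theta>c" and N: "negligible N"
    and xc': "\<And>t. t \<in> {0..T} \<Longrightarrow> (xc has_real_derivative cos (\<theta>c t)) (at t within {0..T})"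
    and \<theta>c': "\<And>t. t \<in> {0..T} \<Longrightarrow> t \<notin> N \<Longrightarrow> (\<theta>c has_real_derivative v t) (at t within {0..T})"
    and v: "set_integrable lebesgue {0..T} v"
    and ends: "xc 0 \<le> X a" "X b \<le> xc T"
  shows "(C b + h b * (arcsin (sin (\<theta>c T)) - \<beta> b)) - (C a + h a * (arcsin (sin (\<theta>c 0)) - \<beta> a))
    \<le> integral {0..T} (\<lambda>t. sqrt (\<xi>\<^sup>2 + (v t)\<^sup>2))"
proof -
  define \<Theta> where "\<Theta> t = arcsin (sin (\<theta>c t))" for t
  define M where "M t = max (X a) (min (X b) (running_max xc t))" for t
  have cos\<beta>: "cos (\<beta> \<tau>) > 0" if "\<tau> \<in> {a..b}" for \<tau>
    using \<beta>[OF that] cos_gt_zero_pi[of "\<beta> \<tau>"] by simp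
  have contX: "continuous_on {a..b} X" and cont\<beta>: "continuous_on {a..b} \<beta>" and conth: "continuous_on {a..b} h"
    by (rule DERIV_continuous_on, rule has_field_derivative_at_within, (rule X' \<beta>' h'), assumption)+
  have cont\<theta>: "continuous_on {0..T} \<theta>c" by (rule abs_continuous_on_imp_continuous_on[OF ac])
  have contxc: "continuous_on {0..T} xc" by (rule DERIV_continuous_on[OF xc'])
  obtain c0 where c0: "c0 > 0" "\<And>\<tau>. \<tau> \<in> {a..b} \<Longrightarrow> c0 \<le> cos (\<beta> \<tau>)"
  proof -
    have "continuous_on {a..b} (\<lambda>\<tau>. cos (\<beta> \<tau>))" by (intro continuous_intros cont\<beta>)
    then obtain z where "z \<in> {a..b}" "\<And>\<tau>. \<tau> \<in> {a..b} \<Longrightarrow> cos (\<beta> z) \<le> cos (\<beta> \<tau>)"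
      using continuous_attains_inf[of "{a..b}" "\<lambda>\<tau>. cos (\<beta> \<tau>)"] ab by auto
    then show thesis using that[of "cos (\<beta> z)"] cos\<beta> by blast
  qed
  have Xgrow: "c0 * (\<tau>2 - \<tau>1) \<le> X \<tau>2 - X \<tau>1" if "a \<le> \<tau>1" "\<tau>1 \<le> \<tau>2" "\<tau>2 \<le> b" for \<tau>1 \<tau>2
  proof (cases "\<tau>1 = \<tau>2")
    case False
    then have "\<tau>1 < \<tau>2" using that by simp
    then have "\<exists>z. z > \<tau>1 \<and> z < \<tau>2 \<and> X \<tau>2 - X \<tau>1 = (\<tau>2 - \<tau>1) * cos (\<beta> z)"
      by (rule MVT2) (use X' that in auto)
    then obtain z where z: "\<tau>1 < z" "z < \<tau>2" "X \<tau>2 - X \<tau>1 = (\<tau>2 - \<tau>1) * cos (\<beta> z)" by blast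
    have "(\<tau>2 - \<tau>1) * c0 \<le> (\<tau>2 - \<tau>1) * cos (\<beta> z)"
      using c0(2)[of z] z that by (intro mult_left_mono) auto
    then show ?thesis using z by (simp add: mult.commute)
  qed simp
  have Xab: "X a \<le> X b" using Xgrow[of a b] c0 ab by (smt (verit) mult_nonneg_nonneg)
  have M_range: "X a \<le> M t" "M t \<le> X b" for t using Xab by (auto simp: M_def)
  have "\<exists>\<tau>. a \<le> \<tau> \<and> \<tau> \<le> b \<and> X \<tau> = M t" for t
    using IVT'[of X a "M t" b] M_range contX ab by blast
  then obtain N' where N': "\<And>t. a \<le> N' t" "\<And>t. N' t \<le> b" "\<And>t. X (N' t) = M t" by metis
  have N'I: "N' t \<in> {a..b}" for t using N'(1,2)[of t] by simp
  have M_step: "\<exists>s\<in>{u..w}. 0 \<le> M w - M u \<and> M w - M u \<le> max 0 (cos (\<theta>c s)) * (w - u)"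
    if uw: "0 \<le> u" "u \<le> w" "w \<le> T" for u w
  proof -
    obtain s where s: "s \<in> {u..w}" "0 \<le> running_max xc w - running_max xc u"
      "running_max xc w - running_max xc u \<le> max 0 (cos (\<theta>c s)) * (w - u)"
      using running_max_increment[OF xc' uw] by blast
    have "0 \<le> M w - M u" "M w - M u \<le> running_max xc w - running_max xc u"
      using s(2) unfolding M_def by (auto simp: max_def min_def)
    then show ?thesis using s by (intro bexI[of _ s]) auto
  qed
  have M_lip: "0 \<le> M w - M u" "M w - M u \<le> w - u" if uw: "0 \<le> u" "u \<le> w" "w \<le> T" for u w
  proof -
    obtain s where s: "0 \<le> M w - M u" "M w - M u \<le> max 0 (cos (\<theta>c s)) * (w - u)"
      using M_step[OF uw] by blast
    moreover have "max 0 (cos (\<theta>c s)) * (w - u) \<le> 1 * (w - u)" using uw by (intro mult_right_mono) auto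
    ultimately show "0 \<le> M w - M u" "M w - M u \<le> w - u" by auto
  qed
  have N'_mono: "N' u \<le> N' w" if uw: "0 \<le> u" "u \<le> w" "w \<le> T" for u w
  proof (rule ccontr)
    assume "\<not> N' u \<le> N' w"
    then have lt: "N' w < N' u" by simp
    then have "c0 * (N' u - N' w) \<le> M u - M w" using Xgrow[of "N' w" "N' u"] N' by simp
    then have "c0 * (N' u - N' w) \<le> 0" using M_lip(1)[OF uw] by simp
    moreover have "c0 * (N' u - N' w) > 0" using c0(1) lt by (intro mult_pos_pos) auto
    ultimately show False by simp
  qed
  have N'_lip: "c0 * (N' w - N' u) \<le> M w - M u" if uw: "0 \<le> u" "u \<le> w" "w \<le> T" for u w
    using Xgrow[of "N' u" "N' w"] N' N'_mono[OF uw] by simp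
  have \<Theta>_bd: "- (pi / 2) \<le> \<Theta> t" "\<Theta> t \<le> pi / 2" for t
    unfolding \<Theta>_def using arcsin_bounded[of "sin (\<theta>c t)"] by auto
  define \<Psi> where "\<Psi> t = C (N' t) + h (N' t) * (\<Theta> t - \<beta> (N' t))" for t
  define D where "D u w = C (N' w) + h (N' w) * (\<Theta> w - \<beta> (N' w)) - (C (N' u) + h (N' u) * (\<Theta> w - \<beta> (N' u)))" for u w
  have \<Psi>_split: "\<Psi> w - \<Psi> u = D u w + h (N' u) * (\<Theta> w - \<Theta> u)" for u w
    by (simp add: \<Psi>_def D_def algebra_simps)
  \<comment> \<open>The change of \<open>S\<close> in \<open>\<tau>\<close> is measured against the change of \<open>X\<close>, so that both derivatives are taken at one\<close>
  \<comment> \<open>intermediate point \<open>z\<close>: \<open>\<partial>S/\<partial>\<tau> = P (cos \<beta> + sin \<beta> (\<Theta> - \<beta>))\<close> and \<open>dX/d\<tau> = cos \<beta>\<close>.\<close>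
  have foot: "\<exists>z\<in>{N' u..N' w}. D u w * cos (\<beta> z) = P * (cos (\<beta> z) + sin (\<beta> z) * (\<Theta> w - \<beta> z)) * (M w - M u)"
    if uw: "0 \<le> u" "u \<le> w" "w \<le> T" for u w
  proof -
    have "\<exists>z\<in>{N' u..N' w}. ((\<lambda>\<tau>. C \<tau> + h \<tau> * (\<Theta> w - \<beta> \<tau>)) (N' w) - (\<lambda>\<tau>. C \<tau> + h \<tau> * (\<Theta> w - \<beta> \<tau>)) (N' u)) * cos (\<beta> z)
       = (P * (cos (\<beta> z) + sin (\<beta> z) * (\<Theta> w - \<beta> z))) * (X (N' w) - X (N' u))"
    proof (rule cauchy_mean_value[OF N'_mono[OF uw]])
      fix z assume z: "N' u \<le> z" "z \<le> N' w"
      then have zI: "z \<in> {a..b}" using N'(1)[of u] N'(2)[of w] by simp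
      show "(X has_real_derivative cos (\<beta> z)) (at z)" by (rule X'[OF zI])
      define r where "r = sqrt (1 - (h z)\<^sup>2)"
      have hz: "(h z)\<^sup>2 < 1" using h1[OF zI] by (simp add: abs_square_less_1)
      have r: "r > 0" "r\<^sup>2 = 1 - (h z)\<^sup>2" using hz by (auto simp: r_def)
      have "\<xi> / r - h z * (\<xi> * h z / r) = \<xi> * (1 - (h z)\<^sup>2) / r"
        using r by (simp add: field_simps power2_eq_square)
      also have "\<dots> = \<xi> * r" unfolding r(2)[symmetric] using r(1) by (simp add: power2_eq_square)
      also have "\<dots> = P * cos (\<beta> z)" using Ph[OF zI] by (simp add: r_def)
      finally have e: "\<xi> / r + (P * sin (\<beta> z) * (\<Theta> w - \<beta> z) + h z * (0 - \<xi> * h z / r))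
          = P * (cos (\<beta> z) + sin (\<beta> z) * (\<Theta> w - \<beta> z))" by (simp add: algebra_simps)
      have "((\<lambda>\<tau>. C \<tau> + h \<tau> * (\<Theta> w - \<beta> \<tau>)) has_real_derivative
          \<xi> / r + (P * sin (\<beta> z) * (\<Theta> w - \<beta> z) + h z * (0 - \<xi> * h z / r))) (at z)"
        using C'[OF zI] h'[OF zI] \<beta>'[OF zI] unfolding r_def[symmetric]
        by (auto intro!: derivative_eq_intros)
      then show "((\<lambda>\<tau>. C \<tau> + h \<tau> * (\<Theta> w - \<beta> \<tau>)) has_real_derivative
          P * (cos (\<beta> z) + sin (\<beta> z) * (\<Theta> w - \<beta> z))) (at z)" unfolding e .
    qed
    then show ?thesis unfolding D_def N'(3) by simp
  qed
  define K where "K = P * (1 + pi) / c0"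
  have K: "K \<ge> 0" using P c0 by (simp add: K_def)
  have D_le: "\<bar>D u w\<bar> \<le> K * (M w - M u)" if uw: "0 \<le> u" "u \<le> w" "w \<le> T" for u w
  proof -
    obtain z where z: "z \<in> {N' u..N' w}" "D u w * cos (\<beta> z) = P * (cos (\<beta> z) + sin (\<beta> z) * (\<Theta> w - \<beta> z)) * (M w - M u)"
      using foot[OF uw] by blast
    have zI: "z \<in> {a..b}" using z N'(1)[of u] N'(2)[of w] by auto
    have "\<bar>\<Theta> w - \<beta> z\<bar> \<le> pi" using \<Theta>_bd[of w] \<beta>[OF zI] by (simp add: abs_le_iff)
    then have "\<bar>sin (\<beta> z)\<bar> * \<bar>\<Theta> w - \<beta> z\<bar> \<le> 1 * pi" by (intro mult_mono) auto
    then have "\<bar>cos (\<beta> z) + sin (\<beta> z) * (\<Theta> w - \<beta> z)\<bar> \<le> 1 + pi"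
      using abs_triangle_ineq[of "cos (\<beta> z)" "sin (\<beta> z) * (\<Theta> w - \<beta> z)"] abs_cos_le_one[of "\<beta> z"]
      unfolding abs_mult by linarith
    then have "\<bar>D u w\<bar> * cos (\<beta> z) \<le> P * (1 + pi) * (M w - M u)"
      using arg_cong[OF z(2), of abs] cos\<beta>[OF zI] P M_lip(1)[OF uw]
      by (auto simp: abs_mult intro!: mult_right_mono mult_left_mono)
    moreover have "\<bar>D u w\<bar> * c0 \<le> \<bar>D u w\<bar> * cos (\<beta> z)" by (intro mult_left_mono c0 zI) auto
    ultimately have "\<bar>D u w\<bar> * c0 \<le> P * (1 + pi) * (M w - M u)" by simp
    then show ?thesis using c0(1) by (simp add: K_def pos_le_divide_eq)
  qed
  have \<Theta>_le: "\<bar>\<Theta> w - \<Theta> u\<bar> \<le> \<bar>\<theta>c w - \<theta>c u\<bar>" for u w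
    unfolding \<Theta>_def by (rule arcsin_sin_nonexpansive)
  have "\<Psi> T - \<Psi> 0 \<le> integral {0..T} (\<lambda>t. sqrt (\<xi>\<^sup>2 + (v t)\<^sup>2))"
  proof (rule ac_increment_le_integral[OF T _ _ N])
    show "abs_continuous_on {0..T} \<Psi>"
    proof (rule abs_continuous_on_dominated[OF ac zero_less_one K zero_le_one])
      fix s t assume st: "s \<in> {0..T}" "t \<in> {0..T}" "s \<le> t"
      have "\<bar>\<Psi> t - \<Psi> s\<bar> \<le> \<bar>D s t\<bar> + \<bar>h (N' s)\<bar> * \<bar>\<Theta> t - \<Theta> s\<bar>"
        unfolding \<Psi>_split by (metis abs_mult abs_triangle_ineq)
      also have "\<bar>D s t\<bar> \<le> K * (t - s)"
        using D_le[of s t] mult_left_mono[OF M_lip(2)[of s t] K] st by auto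
      also have "\<bar>h (N' s)\<bar> * \<bar>\<Theta> t - \<Theta> s\<bar> \<le> 1 * \<bar>\<theta>c t - \<theta>c s\<bar>"
        using h1[OF N'I[of s]] \<Theta>_le by (intro mult_mono) auto
      finally show "dist (\<Psi> s) (\<Psi> t) \<le> K * (t - s) + 1 * dist (\<theta>c s) (\<theta>c t)"
        by (simp add: dist_real_def abs_minus_commute)
    qed
    show "(\<lambda>t. sqrt (\<xi>\<^sup>2 + (v t)\<^sup>2)) integrable_on {0..T}"
      by (rule set_lebesgue_integral_eq_integral(1)[OF set_integrable_cost[OF v]])
    fix t \<epsilon> :: real assume t: "t \<in> {0..T}" "t \<notin> N" and \<epsilon>: "\<epsilon> > 0"
    define g where "g = sqrt (\<xi>\<^sup>2 + (v t)\<^sup>2)"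
    define good where "good \<delta> \<longleftrightarrow> (\<forall>u w. 0 \<le> u \<longrightarrow> u \<le> t \<longrightarrow> t \<le> w \<longrightarrow> w \<le> T \<longrightarrow> w - u < \<delta> \<longrightarrow>
        \<Psi> w - \<Psi> u \<le> (g + \<epsilon>) * (w - u))" for \<delta>
    have "\<exists>\<delta>>0. good \<delta>"
    proof (rule ccontr)
      assume no: "\<not> ?thesis"
      have "\<not> good (1 / real (Suc n))" for n
      proof
        assume "good (1 / real (Suc n))"
        then have "\<exists>\<delta>>0. good \<delta>" by (intro exI[of _ "1 / real (Suc n)"]) simp
        then show False using no by contradiction
      qed
      then have "\<forall>n. \<exists>u w. 0 \<le> u \<and> u \<le> t \<and> t \<le> w \<and> w \<le> T \<and> w - u < 1 / real (Suc n) \<and>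
          \<not> \<Psi> w - \<Psi> u \<le> (g + \<epsilon>) * (w - u)"
        unfolding good_def not_all not_imp by blast
      then obtain u w where uw': "\<forall>n. 0 \<le> u n \<and> u n \<le> t \<and> t \<le> w n \<and> w n \<le> T \<and> w n - u n < 1 / real (Suc n) \<and>
          \<not> \<Psi> (w n) - \<Psi> (u n) \<le> (g + \<epsilon>) * (w n - u n)"
        unfolding choice_iff by (elim exE)
      then have uw: "\<And>n. 0 \<le> u n" "\<And>n. u n \<le> t" "\<And>n. t \<le> w n" "\<And>n. w n \<le> T"
        "\<And>n. w n - u n < 1 / real (Suc n)" and big: "\<And>n. \<Psi> (w n) - \<Psi> (u n) > (g + \<epsilon>) * (w n - u n)"
        by (simp_all only: not_le)
      have ule: "u n \<le> w n" for n using uw(2,3)[of n] by simp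
      have ult: "u n < w n" for n
      proof -
        have "u n \<noteq> w n" using big[of n] by fastforce
        then show ?thesis using ule[of n] by simp
      qed
      have inv: "(\<lambda>n. 1 / real (Suc n)) \<longlonglongrightarrow> 0" using LIMSEQ_inverse_real_of_nat by (simp add: inverse_eq_divide)
      have "norm (w n - u n) \<le> 1 / real (Suc n)" for n
        using ule[of n] less_imp_le[OF uw(5), of n] by simp
      then have lim0: "(\<lambda>n. w n - u n) \<longlonglongrightarrow> 0"
        by (intro Lim_null_comparison[OF always_eventually inv] allI)
      have near: "f \<longlonglongrightarrow> t" if "\<And>n. u n \<le> f n" "\<And>n. f n \<le> w n" for f
      proof -
        have "norm (f n - t) \<le> w n - u n" for n
          using that(1)[of n] that(2)[of n] uw(2)[of n] uw(3)[of n] by (simp add: abs_le_iff)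
        then have "(\<lambda>n. f n - t) \<longlonglongrightarrow> 0"
          by (intro Lim_null_comparison[OF always_eventually lim0] allI)
        then show ?thesis by (rule LIM_zero_cancel)
      qed
      have limu: "u \<longlonglongrightarrow> t" and limw: "w \<longlonglongrightarrow> t" using near ule by blast+
      have "\<exists>s. \<forall>n. s n \<in> {u n..w n} \<and> M (w n) - M (u n) \<le> max 0 (cos (\<theta>c (s n))) * (w n - u n)"
        using M_step[OF uw(1) ule uw(4)] by (intro choice) blast
      then obtain s where s: "\<And>n. s n \<in> {u n..w n}" "\<And>n. M (w n) - M (u n) \<le> max 0 (cos (\<theta>c (s n))) * (w n - u n)"
        by blast
      have "\<exists>z. \<forall>n. z n \<in> {N' (u n)..N' (w n)} \<and> D (u n) (w n) * cos (\<beta> (z n)) =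
          P * (cos (\<beta> (z n)) + sin (\<beta> (z n)) * (\<Theta> (w n) - \<beta> (z n))) * (M (w n) - M (u n))"
        using foot[OF uw(1) ule uw(4)] by (intro choice) blast
      then obtain z where z: "\<And>n. z n \<in> {N' (u n)..N' (w n)}" "\<And>n. D (u n) (w n) * cos (\<beta> (z n)) =
          P * (cos (\<beta> (z n)) + sin (\<beta> (z n)) * (\<Theta> (w n) - \<beta> (z n))) * (M (w n) - M (u n))"
        by blast
      have zI: "z n \<in> {a..b}" for n using z(1)[of n] N'(1)[of "u n"] N'(2)[of "w n"] by auto
      have lims: "s \<longlonglongrightarrow> t" using near s(1) by auto
      have lim\<theta>: "(\<lambda>n. \<theta>c (f n)) \<longlonglongrightarrow> \<theta>c t" if "f \<longlonglongrightarrow> t" "\<And>n. f n \<in> {0..T}" for f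
        using continuous_on_tendsto_compose[OF cont\<theta> that(1) t(1)] that(2) by auto
      have sI: "s n \<in> {0..T}" for n using s(1)[of n] uw(1,4)[of n] by auto
      have lim\<theta>s: "(\<lambda>n. \<theta>c (s n)) \<longlonglongrightarrow> \<theta>c t" by (rule lim\<theta>[OF lims sI])
      have lim\<theta>w: "(\<lambda>n. \<theta>c (w n)) \<longlonglongrightarrow> \<theta>c t"
        by (rule lim\<theta>[OF limw]) (use order_trans[OF uw(1) ule] uw(4) in simp)
      \<comment> \<open>used for the intermediate points \<open>z\<close> and for the end points \<open>N' (u n)\<close>\<close>
      have limN: "f \<longlonglongrightarrow> N' t" if f: "\<And>n. N' (u n) \<le> f n" "\<And>n. f n \<le> N' (w n)" for f
      proof -
        have *: "norm (f n - N' t) \<le> (w n - u n) / c0" for n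
        proof -
          have t0: "0 \<le> t" "t \<le> T" using t(1) by simp_all
          have 1: "N' (u n) \<le> N' t" by (rule N'_mono[OF uw(1) uw(2) t0(2)])
          have 2: "N' t \<le> N' (w n)" by (rule N'_mono[OF t0(1) uw(3) uw(4)])
          have "\<bar>f n - N' t\<bar> \<le> N' (w n) - N' (u n)" using f(1)[of n] f(2)[of n] 1 2 by linarith
          also have "\<dots> \<le> (w n - u n) / c0"
          proof -
            have "c0 * (N' (w n) - N' (u n)) \<le> M (w n) - M (u n)" by (rule N'_lip[OF uw(1) ule uw(4)])
            also have "\<dots> \<le> w n - u n" by (rule M_lip(2)[OF uw(1) ule uw(4)])
            finally have "(N' (w n) - N' (u n)) * c0 \<le> w n - u n" by (simp only: mult.commute)
            then show ?thesis using c0(1) by (simp only: pos_le_divide_eq)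
          qed
          finally show ?thesis by (simp only: real_norm_def)
        qed
        have "(\<lambda>n. f n - N' t) \<longlonglongrightarrow> 0"
          by (rule Lim_null_comparison[OF always_eventually[OF allI[OF *]] tendsto_divide_zero[OF lim0]])
        then show ?thesis by (rule LIM_zero_cancel)
      qed
      have limz: "z \<longlonglongrightarrow> N' t" by (rule limN) (use z(1) in auto)
      have limNu: "(\<lambda>n. N' (u n)) \<longlonglongrightarrow> N' t"
        by (rule limN) (use N'_mono[OF uw(1) ule uw(4)] in auto)
      have limh: "(\<lambda>n. \<bar>h (N' (u n))\<bar>) \<longlonglongrightarrow> \<bar>h (N' t)\<bar>"
        using continuous_on_tendsto_compose[OF conth limNu N'I] N'I by (intro tendsto_rabs) auto
      have lim\<beta>: "(\<lambda>n. cos (\<beta> (z n))) \<longlonglongrightarrow> cos (\<beta> (N' t))"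
        using continuous_on_tendsto_compose[OF cont\<beta> limz N'I] zI by (intro tendsto_cos) auto
      have limq: "(\<lambda>n. \<bar>(\<theta>c (w n) - \<theta>c (u n)) / (w n - u n)\<bar>) \<longlonglongrightarrow> \<bar>v t\<bar>"
        by (intro tendsto_rabs tendsto_straddle[OF \<theta>c'[OF t] t(1)] uw ult lim0)
      define Q where "Q n = D (u n) (w n) / (w n - u n) + \<bar>h (N' (u n))\<bar> * \<bar>(\<theta>c (w n) - \<theta>c (u n)) / (w n - u n)\<bar>" for n
      have Q: "g + \<epsilon> \<le> Q n" for n
      proof -
        have pos: "w n - u n > 0" using ult[of n] by simp
        have 1: "(g + \<epsilon>) * (w n - u n) \<le> D (u n) (w n) + h (N' (u n)) * (\<Theta> (w n) - \<Theta> (u n))"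
          using less_imp_le[OF big[of n]] unfolding \<Psi>_split .
        have "h (N' (u n)) * (\<Theta> (w n) - \<Theta> (u n)) \<le> \<bar>h (N' (u n)) * (\<Theta> (w n) - \<Theta> (u n))\<bar>"
          by (rule abs_ge_self)
        also have "\<dots> \<le> \<bar>h (N' (u n))\<bar> * \<bar>\<theta>c (w n) - \<theta>c (u n)\<bar>"
          unfolding abs_mult by (rule mult_left_mono[OF \<Theta>_le abs_ge_zero])
        finally have "(g + \<epsilon>) * (w n - u n) \<le> D (u n) (w n) + \<bar>h (N' (u n))\<bar> * \<bar>\<theta>c (w n) - \<theta>c (u n)\<bar>"
          using 1 by linarith
        then have "g + \<epsilon> \<le> (D (u n) (w n) + \<bar>h (N' (u n))\<bar> * \<bar>\<theta>c (w n) - \<theta>c (u n)\<bar>) / (w n - u n)"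
          using pos by (simp only: pos_le_divide_eq)
        also have "\<dots> = Q n"
          unfolding Q_def abs_divide abs_of_pos[OF pos] add_divide_distrib by simp
        finally show ?thesis .
      qed
      have hN: "\<bar>h (N' t)\<bar> < 1" by (rule h1[OF N'I])
      show False
      proof (cases "cos (\<theta>c t) > 0")
        case True
        define E where "E n = P * cos (\<beta> (z n)) * max 0 (cos (\<theta>c (s n))) / \<bar>cos (\<theta>c (w n))\<bar>
            + \<bar>h (N' (u n))\<bar> * \<bar>(\<theta>c (w n) - \<theta>c (u n)) / (w n - u n)\<bar>" for n
        have limE: "E \<longlonglongrightarrow> P * cos (\<beta> (N' t)) * max 0 (cos (\<theta>c t)) / \<bar>cos (\<theta>c t)\<bar> + \<bar>h (N' t)\<bar> * \<bar>v t\<bar>"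
          unfolding E_def using True
          by (intro tendsto_intros lim\<beta> lim\<theta>s lim\<theta>w limh limq tendsto_max) auto
        have "eventually (\<lambda>n. cos (\<theta>c (w n)) > 0) sequentially"
          by (rule order_tendstoD(1)[OF tendsto_cos[OF lim\<theta>w] True])
        then have "eventually (\<lambda>n. g + \<epsilon> \<le> E n) sequentially"
        proof eventually_elim
          case (elim n)
          have pos: "w n - u n > 0" using ult[of n] by simp
          have c\<Theta>: "cos (\<Theta> (w n)) = cos (\<theta>c (w n))" using elim by (simp add: \<Theta>_def cos_arcsin_sin)
          have cz: "cos (\<beta> (z n)) > 0" by (rule cos\<beta>[OF zI])
          have dM: "0 \<le> M (w n) - M (u n)" by (rule M_lip(1)[OF uw(1) ule uw(4)])
          have "D (u n) (w n) * cos (\<theta>c (w n)) * cos (\<beta> (z n)) = cos (\<theta>c (w n)) * (D (u n) (w n) * cos (\<beta> (z n)))"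
            by (simp only: mult_ac)
          also have "\<dots> = P * (M (w n) - M (u n)) * (cos (\<Theta> (w n)) * (cos (\<beta> (z n)) + sin (\<beta> (z n)) * (\<Theta> (w n) - \<beta> (z n))))"
            unfolding c\<Theta> z(2) by (simp only: mult_ac)
          also have "\<dots> \<le> P * (M (w n) - M (u n)) * (cos (\<beta> (z n)))\<^sup>2"
            by (rule mult_left_mono[OF sec_above_tangent[OF \<Theta>_bd \<beta>[OF zI, THEN conjunct1] \<beta>[OF zI, THEN conjunct2]]])
              (use P dM in simp)
          finally have "D (u n) (w n) * cos (\<theta>c (w n)) * cos (\<beta> (z n)) \<le> P * (M (w n) - M (u n)) * cos (\<beta> (z n)) * cos (\<beta> (z n))"
            by (simp only: power2_eq_square mult.assoc)
          then have "D (u n) (w n) * cos (\<theta>c (w n)) \<le> P * (M (w n) - M (u n)) * cos (\<beta> (z n))"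
            using cz by (rule mult_right_le_imp_le)
          also have "\<dots> \<le> P * (max 0 (cos (\<theta>c (s n))) * (w n - u n)) * cos (\<beta> (z n))"
            by (rule mult_right_mono[OF mult_left_mono[OF s(2) less_imp_le[OF P]] less_imp_le[OF cz]])
          finally have "D (u n) (w n) * cos (\<theta>c (w n)) \<le> (P * cos (\<beta> (z n)) * max 0 (cos (\<theta>c (s n)))) * (w n - u n)"
            by (simp only: mult_ac)
          then have "D (u n) (w n) / (w n - u n) \<le> P * cos (\<beta> (z n)) * max 0 (cos (\<theta>c (s n))) / cos (\<theta>c (w n))"
            unfolding pos_le_divide_eq[OF elim] times_divide_eq_left pos_divide_le_eq[OF pos] .
          then show ?case using Q[of n] unfolding E_def Q_def abs_of_pos[OF elim] by linarith
        qed
        then have "g + \<epsilon> \<le> P * cos (\<beta> (N' t)) * max 0 (cos (\<theta>c t)) / \<bar>cos (\<theta>c t)\<bar> + \<bar>h (N' t)\<bar> * \<bar>v t\<bar>"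
          by (intro tendsto_lowerbound[OF limE]) auto
        also have "\<dots> = \<xi> * sqrt (1 - (h (N' t))\<^sup>2) + \<bar>h (N' t)\<bar> * \<bar>v t\<bar>"
          using True Ph[OF N'I] by simp
        also have "\<dots> \<le> g" unfolding g_def by (rule cauchy_schwarz_cost[OF \<xi> hN])
        finally show False using \<epsilon> by simp
      next
        case False
        define E where "E n = K * max 0 (cos (\<theta>c (s n)))
            + \<bar>h (N' (u n))\<bar> * \<bar>(\<theta>c (w n) - \<theta>c (u n)) / (w n - u n)\<bar>" for n
        have limE: "E \<longlonglongrightarrow> K * max 0 (cos (\<theta>c t)) + \<bar>h (N' t)\<bar> * \<bar>v t\<bar>"
          unfolding E_def by (intro tendsto_intros lim\<theta>s limh limq tendsto_max)
        have "g + \<epsilon> \<le> E n" for n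
        proof -
          have pos: "w n - u n > 0" using ult[of n] by simp
          have "D (u n) (w n) \<le> K * (M (w n) - M (u n))" using D_le[OF uw(1) ule uw(4), of n] by simp
          also have "\<dots> \<le> K * (max 0 (cos (\<theta>c (s n))) * (w n - u n))"
            using s(2)[of n] K by (intro mult_left_mono) auto
          finally have "D (u n) (w n) / (w n - u n) \<le> K * max 0 (cos (\<theta>c (s n)))"
            unfolding pos_divide_le_eq[OF pos] by (simp only: mult.assoc)
          then show ?thesis using Q[of n] unfolding E_def Q_def by linarith
        qed
        then have "g + \<epsilon> \<le> K * max 0 (cos (\<theta>c t)) + \<bar>h (N' t)\<bar> * \<bar>v t\<bar>"
          by (intro tendsto_lowerbound[OF limE]) auto
        also have "\<dots> = \<bar>h (N' t)\<bar> * \<bar>v t\<bar>" using False by simp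
        also have "\<dots> \<le> \<xi> * sqrt (1 - (h (N' t))\<^sup>2) + \<bar>h (N' t)\<bar> * \<bar>v t\<bar>"
          using \<xi> hN by (simp add: abs_square_le_1)
        also have "\<dots> \<le> g" unfolding g_def by (rule cauchy_schwarz_cost[OF \<xi> hN])
        finally show False using \<epsilon> by simp
      qed
    qed
    then show "\<exists>\<delta>>0. \<forall>u w. 0 \<le> u \<longrightarrow> u \<le> t \<longrightarrow> t \<le> w \<longrightarrow> w \<le> T \<longrightarrow> w - u < \<delta> \<longrightarrow>
        \<Psi> w - \<Psi> u \<le> (sqrt (\<xi>\<^sup>2 + (v t)\<^sup>2) + \<epsilon>) * (w - u)"
      unfolding good_def g_def .
  qed
  moreover have "N' 0 = a"
  proof -
    have "running_max xc 0 = xc 0" by (simp add: running_max_def)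
    then have "M 0 = X a" using ends Xab by (simp add: M_def)
    then have "c0 * (N' 0 - a) \<le> 0" using Xgrow[of a "N' 0"] N'[of 0] by simp
    then show ?thesis using c0(1) N'(1)[of 0] by (simp add: mult_le_0_iff)
  qed
  moreover have "N' T = b"
  proof -
    have "xc T \<le> running_max xc T" using running_max_attained[OF contxc T] T by auto
    then have "M T = X b" using ends Xab by (simp add: M_def)
    then have "c0 * (b - N' T) \<le> 0" using Xgrow[of "N' T" b] N'[of T] by simp
    then show ?thesis using c0(1) N'(2)[of T] by (simp add: mult_le_0_iff)
  qed
  ultimately show ?thesis by (simp add: \<Psi>_def \<Theta>_def)
qed

section \<open>Extremals are global minimizers\<close>

text \<open>The pair \<open>(p1, p2)\<close> is the momentum conjugate to the position and \<open>h\<close> the one conjugate to the angle.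
  The third equation says that the maximized Hamiltonian is zero, as it must be when the length is free, and
  \<open>\<bar>h t\<bar> < 1\<close> excludes cusps. On an open interval the curvature may still become infinite at the ends.\<close>

definition extremal_on :: "real \<Rightarrow> (real \<Rightarrow> M) \<Rightarrow> (real \<Rightarrow> real) \<Rightarrow> real \<Rightarrow> real \<Rightarrow> bool" where
  "extremal_on \<xi> q v a b \<longleftrightarrow> (\<exists>p1 p2 h.
     (\<forall>t\<in>{a<..<b}.
        (h has_real_derivative
          p1 * sin_circle (heading (q t)) - p2 * cos_circle (heading (q t))) (at t) \<and>
        \<bar>h t\<bar> < 1 \<and>
        p1 * cos_circle (heading (q t)) + p2 * sin_circle (heading (q t)) = \<xi> * sqrt (1 - (h t)\<^sup>2)) \<and>
     negligible {t \<in> {a<..<b}. v t \<noteq> \<xi> * h t / sqrt (1 - (h t)\<^sup>2)})"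

lemma continuous_on_sqrt_bound:
  fixes h :: "real \<Rightarrow> real"
  assumes "continuous_on S h" "\<And>t. t \<in> S \<Longrightarrow> \<bar>h t\<bar> < 1"
  shows "continuous_on S (\<lambda>t. \<xi> / sqrt (1 - (h t)\<^sup>2))" "continuous_on S (\<lambda>t. \<xi> * h t / sqrt (1 - (h t)\<^sup>2))"
proof -
  have "sqrt (1 - (h t)\<^sup>2) \<noteq> 0" if "t \<in> S" for t
    using assms(2)[OF that] abs_square_less_1[of "h t"] by simp
  then show "continuous_on S (\<lambda>t. \<xi> / sqrt (1 - (h t)\<^sup>2))" "continuous_on S (\<lambda>t. \<xi> * h t / sqrt (1 - (h t)\<^sup>2))"
    by (auto intro!: continuous_intros assms(1))
qed

lemma lagrangian_at_extremal:
  fixes \<xi> h :: real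
  assumes "\<xi> > 0" "\<bar>h\<bar> < 1"
  shows "sqrt (\<xi>\<^sup>2 + (\<xi> * h / sqrt (1 - h\<^sup>2))\<^sup>2) = \<xi> / sqrt (1 - h\<^sup>2)"
proof -
  have h: "1 - h\<^sup>2 > 0" using assms(2) abs_square_less_1[of h] by simp
  have "\<xi>\<^sup>2 + (\<xi> * h / sqrt (1 - h\<^sup>2))\<^sup>2 = \<xi>\<^sup>2 + \<xi>\<^sup>2 * h\<^sup>2 / (1 - h\<^sup>2)"
    using h by (simp add: power_divide power_mult_distrib)
  also have "\<dots> = \<xi>\<^sup>2 / (1 - h\<^sup>2)" using h by (simp add: field_simps)
  also have "sqrt \<dots> = \<xi> / sqrt (1 - h\<^sup>2)" using assms(1) by (simp add: real_sqrt_divide)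
  finally show ?thesis .
qed

text \<open>A derivative that agrees almost everywhere with a continuous function makes \<open>\<theta>\<close> continuously
  differentiable.\<close>

lemma derivative_of_ac_primitive:
  fixes \<theta> v k :: "real \<Rightarrow> real"
  assumes ac: "abs_continuous_on {0..l} \<theta>" and N: "negligible N"
    and der: "\<And>t. t \<in> {0..l} \<Longrightarrow> t \<notin> N \<Longrightarrow> (\<theta> has_real_derivative v t) (at t within {0..l})"
    and k: "continuous_on {c..d} k" and cd: "0 \<le> c" "d \<le> l" and N': "negligible N'"
    and eq: "\<And>t. t \<in> {c..d} \<Longrightarrow> t \<notin> N' \<Longrightarrow> v t = k t" and t: "c < t" "t < d"
  shows "(\<theta> has_real_derivative k t) (at t)"
proof -
  have inc: "\<theta> c + integral {c..s} k = \<theta> s" if s: "s \<in> {c..d}" for s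
  proof -
    have sub: "{c..s} \<subseteq> {0..l}" using s cd by auto
    have "\<theta> s - \<theta> c = integral {c..s} k"
    proof (rule ac_increment_eq_integral)
      show "c \<le> s" using s by simp
      show "abs_continuous_on {c..s} \<theta>" by (rule abs_continuous_on_subset[OF ac sub])
      show "k integrable_on {c..s}"
        by (rule integrable_continuous_interval[OF continuous_on_subset[OF k]]) (use s in auto)
      show "negligible (N \<union> N')" using N N' by simp
      fix r assume r: "r \<in> {c..s}" "r \<notin> N \<union> N'"
      have "r \<in> {c..d}" using r(1) s by simp
      then have "v r = k r" using eq r(2) by simp
      moreover have "(\<theta> has_real_derivative v r) (at r within {c..s})"
        by (rule DERIV_subset[OF der sub]) (use r sub in auto)
      ultimately show "(\<theta> has_real_derivative k r) (at r within {c..s})" by simp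
    qed
    then show ?thesis by simp
  qed
  have tI: "t \<in> {c..d}" using t by simp
  have "((\<lambda>s. \<theta> c + integral {c..s} k) has_real_derivative 0 + k t) (at t within {c..d})"
    by (intro DERIV_add DERIV_const integral_has_real_derivative[OF k tI])
  then have "(\<theta> has_real_derivative 0 + k t) (at t within {c..d})"
    by (rule has_field_derivative_transform_within[OF _ zero_less_one tI]) (rule inc)
  then show ?thesis using at_within_Icc_at[OF t] by simp
qed

text \<open>In coordinates rotated so that the momentum points along the first axis, the calibration inequality
  applies to the part of the extremal over \<open>[\<eta>, l - \<eta>]\<close>; at the end points themselves \<open>\<beta>\<close> may be
  \<open>\<plusminus> \<pi>/2\<close>. Since \<open>\<bar>h\<bar> < 1\<close> and \<open>\<beta>\<close> is continuous up to the ends, the correction terms vanish as \<open>\<eta>\<close>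
  tends to 0.\<close>

lemma extremal_imp_global_minimizer:
  assumes \<xi>: "\<xi> > 0" and adm: "admissible q_in q_fin l q v" and l: "l > 0"
    and ext: "extremal_on \<xi> q v 0 l"
  shows "global_minimizer \<xi> q_in q_fin l q v"
  unfolding global_minimizer_def
proof (intro conjI adm allI impI)
  fix l' q' v' assume adm': "admissible q_in q_fin l' q' v'"
  have v: "set_integrable lebesgue {0..l} v" and q_ends: "q 0 = q_in" "q l = q_fin"
    using adm unfolding admissible_def by auto
  have v': "set_integrable lebesgue {0..l'} v'" and q'_ends: "q' 0 = q_in" "q' l' = q_fin" and l': "0 \<le> l'"
    using adm' unfolding admissible_def by auto
  obtain x y \<theta> N where q: "\<And>t. q t = (x t, y t, circle_of (\<theta> t))"
    and ac: "abs_continuous_on {0..l} \<theta>" and cont\<theta>: "continuous_on {0..l} \<theta>" and N: "negligible N"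
    and \<theta>': "\<And>t. t \<in> {0..l} \<Longrightarrow> t \<notin> N \<Longrightarrow> (\<theta> has_real_derivative v t) (at t within {0..l})"
    and x': "\<And>t. t \<in> {0..l} \<Longrightarrow> (x has_real_derivative cos (\<theta> t)) (at t within {0..l})"
    and y': "\<And>t. t \<in> {0..l} \<Longrightarrow> (y has_real_derivative sin (\<theta> t)) (at t within {0..l})"
    using admissible_lift[OF adm] by metis
  obtain xc yc \<theta>c Nc where q': "\<And>t. q' t = (xc t, yc t, circle_of (\<theta>c t))"
    and acc: "abs_continuous_on {0..l'} \<theta>c" and Nc: "negligible Nc"
    and \<theta>c': "\<And>t. t \<in> {0..l'} \<Longrightarrow> t \<notin> Nc \<Longrightarrow> (\<theta>c has_real_derivative v' t) (at t within {0..l'})"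
    and xc': "\<And>t. t \<in> {0..l'} \<Longrightarrow> (xc has_real_derivative cos (\<theta>c t)) (at t within {0..l'})"
    and yc': "\<And>t. t \<in> {0..l'} \<Longrightarrow> (yc has_real_derivative sin (\<theta>c t)) (at t within {0..l'})"
    using admissible_lift[OF adm'] by metis
  have hd: "cos_circle (heading (q t)) = cos (\<theta> t)" "sin_circle (heading (q t)) = sin (\<theta> t)" for t
    by (simp_all add: q heading_def)
  obtain p1 p2 h where pmp: "\<forall>t\<in>{0<..<l}. (h has_real_derivative p1 * sin (\<theta> t) - p2 * cos (\<theta> t)) (at t) \<and>
      \<bar>h t\<bar> < 1 \<and> p1 * cos (\<theta> t) + p2 * sin (\<theta> t) = \<xi> * sqrt (1 - (h t)\<^sup>2)"
    and N': "negligible {t \<in> {0<..<l}. v t \<noteq> \<xi> * h t / sqrt (1 - (h t)\<^sup>2)}"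
    using ext unfolding extremal_on_def hd by blast
  define r where "r t = sqrt (1 - (h t)\<^sup>2)" for t
  define N2 where "N2 = {t \<in> {0<..<l}. v t \<noteq> \<xi> * h t / r t}"
  have N2: "negligible N2" using N' unfolding N2_def r_def .
  have h1: "\<bar>h t\<bar> < 1" if "t \<in> {0<..<l}" for t using pmp that by blast
  have r: "r t > 0" if "t \<in> {0<..<l}" for t
    using h1[OF that] abs_square_less_1[of "h t"] by (simp add: r_def)
  define P where "P = sqrt (p1\<^sup>2 + p2\<^sup>2)"
  have P: "P > 0"
  proof -
    have mid: "l / 2 \<in> {0<..<l}" using l by simp
    have "p1 * cos (\<theta> (l / 2)) + p2 * sin (\<theta> (l / 2)) = \<xi> * r (l / 2)"
      using pmp[THEN bspec, OF mid] unfolding r_def by (elim conjE)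
    moreover have "\<xi> * r (l / 2) > 0" using \<xi> r[OF mid] by (rule mult_pos_pos)
    ultimately have "p1 \<noteq> 0 \<or> p2 \<noteq> 0" by auto
    then show ?thesis by (simp add: P_def sum_power2_gt_zero_iff)
  qed
  have "(p1 / P)\<^sup>2 + (p2 / P)\<^sup>2 = 1"
  proof -
    have "P\<^sup>2 = p1\<^sup>2 + p2\<^sup>2" by (simp add: P_def)
    moreover have "(p1 / P)\<^sup>2 + (p2 / P)\<^sup>2 = (p1\<^sup>2 + p2\<^sup>2) / P\<^sup>2"
      by (simp only: power_divide add_divide_distrib)
    ultimately show ?thesis using P by (metis divide_self less_numeral_extra(3) power_not_zero)
  qed
  then obtain \<phi> where "p1 / P = cos \<phi>" "p2 / P = sin \<phi>" using sincos_total_2pi by metis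
  then have \<phi>: "p1 = P * cos \<phi>" "p2 = P * sin \<phi>" using P by (simp_all add: field_simps)
  have Pcos: "P * cos (\<theta> t - \<phi>) = \<xi> * r t" if "t \<in> {0<..<l}" for t
  proof -
    have "P * cos (\<theta> t - \<phi>) = p1 * cos (\<theta> t) + p2 * sin (\<theta> t)" by (simp add: \<phi> cos_diff algebra_simps)
    also have "\<dots> = \<xi> * r t" using pmp[THEN bspec, OF that] unfolding r_def by (elim conjE)
    finally show ?thesis .
  qed
  have cpos: "cos (\<theta> t - \<phi>) > 0" if "t \<in> {0<..<l}" for t
  proof -
    have "P * cos (\<theta> t - \<phi>) > 0" unfolding Pcos[OF that] using \<xi> r[OF that] by (rule mult_pos_pos)
    then show ?thesis using P by (simp add: zero_less_mult_iff)
  qed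
  define \<beta> where "\<beta> t = arcsin (sin (\<theta> t - \<phi>))" for t
  have cos\<beta>: "cos (\<beta> t) = cos (\<theta> t - \<phi>)" if "t \<in> {0<..<l}" for t
    using cpos[OF that] by (simp add: \<beta>_def cos_arcsin_sin)
  have sin\<beta>: "sin (\<beta> t) = sin (\<theta> t - \<phi>)" for t by (simp add: \<beta>_def)
  have \<beta>_bd: "- (pi / 2) < \<beta> t \<and> \<beta> t < pi / 2" if "t \<in> {0<..<l}" for t
  proof -
    have "cos (\<beta> t) \<noteq> 0" using cpos[OF that] cos\<beta>[OF that] by simp
    then have "\<beta> t \<noteq> pi / 2" "\<beta> t \<noteq> - (pi / 2)"
      by (metis cos_pi_half, metis cos_minus cos_pi_half)
    moreover have "- (pi / 2) \<le> \<beta> t" "\<beta> t \<le> pi / 2"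
      using arcsin_bounded[of "sin (\<theta> t - \<phi>)"] by (simp_all add: \<beta>_def)
    ultimately show ?thesis by linarith
  qed
  have cont\<beta>: "continuous_on {0..l} \<beta>"
    unfolding \<beta>_def by (intro continuous_intros cont\<theta>) auto
  have h': "(h has_real_derivative P * sin (\<beta> t)) (at t)" if "t \<in> {0<..<l}" for t
  proof -
    have "(h has_real_derivative p1 * sin (\<theta> t) - p2 * cos (\<theta> t)) (at t)"
      using pmp[THEN bspec, OF that] by (elim conjE)
    moreover have "p1 * sin (\<theta> t) - p2 * cos (\<theta> t) = P * sin (\<beta> t)"
      unfolding sin\<beta> by (simp add: \<phi> sin_diff algebra_simps)
    ultimately show ?thesis by simp
  qed
  have conth: "continuous_on {c..d} h" if "0 < c" "d < l" for c d
    by (rule DERIV_continuous_on, rule has_field_derivative_at_within, rule h') (use that in auto)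
  have \<theta>'': "(\<theta> has_real_derivative \<xi> * h t / r t) (at t)" if t: "t \<in> {0<..<l}" for t
  proof (rule derivative_of_ac_primitive[OF ac N \<theta>' _ _ _ N2])
    show "continuous_on {t / 2..(t + l) / 2} (\<lambda>t. \<xi> * h t / r t)"
      unfolding r_def by (rule continuous_on_sqrt_bound(2)[OF conth h1]) (use t in auto)
  qed (use t in \<open>auto simp: N2_def\<close>)
  have \<beta>': "(\<beta> has_real_derivative \<xi> * h t / r t) (at t)" if t: "t \<in> {0<..<l}" for t
  proof -
    have sq: "sqrt (1 - (sin (\<theta> t - \<phi>))\<^sup>2) = cos (\<theta> t - \<phi>)"
      using cpos[OF t] by (simp add: cos_squared_eq[symmetric])
    have "(sin (\<theta> t - \<phi>))\<^sup>2 < 1" using cpos[OF t] sin_cos_squared_add[of "\<theta> t - \<phi>"]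
      by (smt (verit) zero_less_power)
    then have "\<bar>sin (\<theta> t - \<phi>)\<bar> < 1" by (simp only: abs_square_less_1)
    then have "(arcsin has_real_derivative inverse (sqrt (1 - (sin (\<theta> t - \<phi>))\<^sup>2))) (at (sin (\<theta> t - \<phi>)))"
      by (intro DERIV_arcsin) auto
    moreover have "((\<lambda>t. sin (\<theta> t - \<phi>)) has_real_derivative cos (\<theta> t - \<phi>) * (\<xi> * h t / r t)) (at t)"
      using \<theta>''[OF t] by (auto intro!: derivative_eq_intros)
    ultimately have "(\<beta> has_real_derivative inverse (cos (\<theta> t - \<phi>)) * (cos (\<theta> t - \<phi>) * (\<xi> * h t / r t))) (at t)"
      unfolding sq \<beta>_def by (rule DERIV_chain2)
    then show ?thesis using cpos[OF t] by (simp add: field_simps)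
  qed
  define X where "X t = cos \<phi> * x t + sin \<phi> * y t" for t
  define Xc where "Xc t = cos \<phi> * xc t + sin \<phi> * yc t" for t
  have X': "(X has_real_derivative cos (\<theta> t - \<phi>)) (at t within {0..l})" if "t \<in> {0..l}" for t
    unfolding X_def using x'[OF that] y'[OF that]
    by (auto intro!: derivative_eq_intros simp: cos_diff mult.commute)
  have Xc': "(Xc has_real_derivative cos (\<theta>c t - \<phi>)) (at t within {0..l'})" if "t \<in> {0..l'}" for t
    unfolding Xc_def using xc'[OF that] yc'[OF that]
    by (auto intro!: derivative_eq_intros simp: cos_diff mult.commute)
  have X'at: "(X has_real_derivative cos (\<beta> t)) (at t)" if t: "t \<in> {0<..<l}" for t
    using X'[of t] t at_within_Icc_at[of 0 t l] cos\<beta>[OF t] by simp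
  have contX: "continuous_on {0..l} X" by (rule DERIV_continuous_on[OF X'])
  have Xmono: "X s \<le> X t" if st: "0 \<le> s" "s \<le> t" "t \<le> l" for s t
  proof (rule DERIV_nonneg_imp_increasing_open[OF st(2)])
    show "continuous_on {s..t} X" by (rule continuous_on_subset[OF contX]) (use st in auto)
    fix z assume "s < z" "z < t"
    then have z: "z \<in> {0<..<l}" using st by auto
    show "\<exists>y. (X has_real_derivative y) (at z) \<and> y \<ge> 0"
      using X'at[OF z] cpos[OF z] cos\<beta>[OF z] by (intro exI[of _ "cos (\<beta> z)"]) simp
  qed
  have e0: "xc 0 = x 0" "yc 0 = y 0" "circle_of (\<theta>c 0) = circle_of (\<theta> 0)"
    using q_ends(1)[folded q'_ends(1)] unfolding q q' by simp_all
  have el: "xc l' = x l" "yc l' = y l" "circle_of (\<theta>c l') = circle_of (\<theta> l)"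
    using q_ends(2)[folded q'_ends(2)] unfolding q q' by simp_all
  have same_angle: "arcsin (sin (b - \<phi>)) = arcsin (sin (a - \<phi>))" if "circle_of b = circle_of a" for a b
  proof -
    have "sin b = sin a" "cos b = cos a" using that by (metis sin_circle_of, metis cos_circle_of)
    then show ?thesis by (simp add: sin_diff)
  qed
  have acc': "abs_continuous_on {0..l'} (\<lambda>t. \<theta>c t - \<phi>)"
    by (rule abs_continuous_on_dominated[OF acc zero_less_one order_refl zero_le_one]) (simp add: dist_real_def)
  define F where "F s = integral {0..s} (\<lambda>s. sqrt (\<xi>\<^sup>2 + (v s)\<^sup>2))" for s
  define J' where "J' = integral {0..l'} (\<lambda>s. sqrt (\<xi>\<^sup>2 + (v' s)\<^sup>2))"
  have intF: "(\<lambda>s. sqrt (\<xi>\<^sup>2 + (v s)\<^sup>2)) integrable_on {0..l}"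
    by (rule set_lebesgue_integral_eq_integral(1)[OF set_integrable_cost[OF v]])
  have contF: "continuous_on {0..l} F"
    unfolding F_def by (rule indefinite_integral_continuous_1[OF intF])
  have main: "F (l - \<eta>) - F \<eta> \<le> J' + (\<bar>\<beta> l - \<beta> (l - \<eta>)\<bar> + \<bar>\<beta> 0 - \<beta> \<eta>\<bar>)" if \<eta>: "0 < \<eta>" "\<eta> < l / 2" for \<eta>
  proof -
    define C where "C t = integral {\<eta> / 2..t} (\<lambda>t. \<xi> / r t)" for t
    have inside: "t \<in> {0<..<l}" if "t \<in> {\<eta> / 2..l - \<eta> / 2}" for t using that \<eta> by auto
    have inside': "t \<in> {0<..<l}" if "t \<in> {\<eta>..l - \<eta>}" for t using that \<eta> by auto
    have contk: "continuous_on {\<eta> / 2..l - \<eta> / 2} (\<lambda>t. \<xi> / r t)"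
      unfolding r_def by (rule continuous_on_sqrt_bound(1)[OF conth h1[OF inside]]) (use \<eta> in auto)
    have C': "(C has_real_derivative \<xi> / r t) (at t)" if t: "t \<in> {\<eta>..l - \<eta>}" for t
    proof -
      have "(C has_real_derivative \<xi> / r t) (at t within {\<eta> / 2..l - \<eta> / 2})"
        unfolding C_def by (rule integral_has_real_derivative[OF contk]) (use t \<eta> in auto)
      then show ?thesis using at_within_Icc_at[of "\<eta> / 2" t "l - \<eta> / 2"] t \<eta> by simp
    qed
    have le: "(C (l - \<eta>) + h (l - \<eta>) * (arcsin (sin (\<theta>c l' - \<phi>)) - \<beta> (l - \<eta>)))
        - (C \<eta> + h \<eta> * (arcsin (sin (\<theta>c 0 - \<phi>)) - \<beta> \<eta>)) \<le> J'"
      unfolding J'_def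
    proof (rule calibration_inequality[OF \<xi> P _ \<beta>_bd[OF inside'] h1[OF inside'] _ X'at[OF inside'] h'[OF inside'] _ _ l' acc' Nc Xc'])
      show "\<eta> \<le> l - \<eta>" using \<eta> by simp
      show "P * cos (\<beta> \<tau>) = \<xi> * sqrt (1 - (h \<tau>)\<^sup>2)" if "\<tau> \<in> {\<eta>..l - \<eta>}" for \<tau>
        using Pcos[OF inside'[OF that]] cos\<beta>[OF inside'[OF that]] by (simp add: r_def)
      show "(\<beta> has_real_derivative \<xi> * h \<tau> / sqrt (1 - (h \<tau>)\<^sup>2)) (at \<tau>)" if "\<tau> \<in> {\<eta>..l - \<eta>}" for \<tau>
        using \<beta>'[OF inside'[OF that]] unfolding r_def .
      show "(C has_real_derivative \<xi> / sqrt (1 - (h \<tau>)\<^sup>2)) (at \<tau>)" if "\<tau> \<in> {\<eta>..l - \<eta>}" for \<tau>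
        using C'[OF that] unfolding r_def .
      show "((\<lambda>t. \<theta>c t - \<phi>) has_real_derivative v' t) (at t within {0..l'})" if "t \<in> {0..l'}" "t \<notin> Nc" for t
        using \<theta>c'[OF that] by (auto intro!: derivative_eq_intros)
      show "set_integrable lebesgue {0..l'} v'" by (rule v')
      have "Xc 0 = X 0" by (simp add: Xc_def X_def e0)
      then show "Xc 0 \<le> X \<eta>" using Xmono[of 0 \<eta>] \<eta> by simp
      have "Xc l' = X l" by (simp add: Xc_def X_def el)
      then show "X (l - \<eta>) \<le> Xc l'" using Xmono[of "l - \<eta>" l] \<eta> by simp
    qed
    have "F (l - \<eta>) - F \<eta> = integral {\<eta>..l - \<eta>} (\<lambda>s. sqrt (\<xi>\<^sup>2 + (v s)\<^sup>2))"
    proof -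
      have "(\<lambda>s. sqrt (\<xi>\<^sup>2 + (v s)\<^sup>2)) integrable_on {0..l - \<eta>}"
        by (rule integrable_on_subinterval[OF intF]) (use \<eta> in auto)
      from Henstock_Kurzweil_Integration.integral_combine[OF _ _ this, of \<eta>] show ?thesis unfolding F_def using \<eta> by simp
    qed
    also have "\<dots> = integral {\<eta>..l - \<eta>} (\<lambda>t. \<xi> / r t)"
    proof (rule integral_spike[OF N2])
      fix t assume t: "t \<in> {\<eta>..l - \<eta>} - N2"
      then have tI: "t \<in> {0<..<l}" using inside' by blast
      then have "v t = \<xi> * h t / r t" using t by (simp add: N2_def)
      then show "\<xi> / r t = sqrt (\<xi>\<^sup>2 + (v t)\<^sup>2)"
        using lagrangian_at_extremal[OF \<xi> h1[OF tI]] by (simp add: r_def)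
    qed
    also have "\<dots> = C (l - \<eta>) - C \<eta>"
    proof -
      have "(\<lambda>t. \<xi> / r t) integrable_on {\<eta> / 2..l - \<eta>}"
        by (rule integrable_continuous_interval[OF continuous_on_subset[OF contk]]) (use \<eta> in auto)
      from Henstock_Kurzweil_Integration.integral_combine[OF _ _ this, of \<eta>] show ?thesis unfolding C_def using \<eta> by simp
    qed
    finally have F: "F (l - \<eta>) - F \<eta> = C (l - \<eta>) - C \<eta>" .
    have ends: "arcsin (sin (\<theta>c l' - \<phi>)) = \<beta> l" "arcsin (sin (\<theta>c 0 - \<phi>)) = \<beta> 0"
      unfolding \<beta>_def by (rule same_angle[OF el(3)], rule same_angle[OF e0(3)])
    have b: "\<bar>h (l - \<eta>) * (\<beta> l - \<beta> (l - \<eta>))\<bar> \<le> 1 * \<bar>\<beta> l - \<beta> (l - \<eta>)\<bar>"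
      unfolding abs_mult using h1[of "l - \<eta>"] \<eta> by (intro mult_right_mono) auto
    have a: "\<bar>h \<eta> * (\<beta> 0 - \<beta> \<eta>)\<bar> \<le> 1 * \<bar>\<beta> 0 - \<beta> \<eta>\<bar>"
      unfolding abs_mult using h1[of \<eta>] \<eta> by (intro mult_right_mono) auto
    show ?thesis using le abs_le_D1[OF a] abs_le_D2[OF b] unfolding F ends mult_1 by linarith
  qed
  define \<eta> where "\<eta> n = l / real (n + 3)" for n
  have \<eta>: "0 < \<eta> n" "\<eta> n < l / 2" for n
    unfolding \<eta>_def using l by simp (rule divide_strict_left_mono, use l in auto)
  have lim\<eta>: "\<eta> \<longlonglongrightarrow> 0" unfolding \<eta>_def
    by (rule LIMSEQ_ignore_initial_segment[OF lim_const_over_n])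
  then have lim\<eta>l: "(\<lambda>n. l - \<eta> n) \<longlonglongrightarrow> l - 0" by (intro tendsto_intros)
  have \<eta>I: "\<eta> n \<in> {0..l}" "l - \<eta> n \<in> {0..l}" for n using \<eta>[of n] l by auto
  have lim: "(\<lambda>n. f (\<eta> n)) \<longlonglongrightarrow> f 0" "(\<lambda>n. f (l - \<eta> n)) \<longlonglongrightarrow> f l"
    if "continuous_on {0..l} f" for f :: "real \<Rightarrow> real"
    using continuous_on_tendsto_compose[OF that lim\<eta>] continuous_on_tendsto_compose[OF that lim\<eta>l] \<eta>I l
    by (simp_all add: always_eventually)
  have "(\<lambda>n. F (l - \<eta> n) - F (\<eta> n)) \<longlonglongrightarrow> F l - F 0"
    by (intro tendsto_intros lim contF)
  moreover have "(\<lambda>n. J' + (\<bar>\<beta> l - \<beta> (l - \<eta> n)\<bar> + \<bar>\<beta> 0 - \<beta> (\<eta> n)\<bar>)) \<longlonglongrightarrow> J' + (\<bar>\<beta> l - \<beta> l\<bar> + \<bar>\<beta> 0 - \<beta> 0\<bar>)"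
    by (intro tendsto_intros lim cont\<beta>)
  ultimately have "F l - F 0 \<le> J' + (\<bar>\<beta> l - \<beta> l\<bar> + \<bar>\<beta> 0 - \<beta> 0\<bar>)"
    by (rule LIMSEQ_le) (use main[OF \<eta>] in blast)
  then have "F l \<le> J'" by (simp add: F_def)
  then show "cost \<xi> l v \<le> cost \<xi> l' v'"
    unfolding cost_eq_integral[OF v] cost_eq_integral[OF v'] F_def J'_def .
qed

section \<open>Approximation in \<open>L\<^sup>1\<close>\<close>

lemma continuous_approximation_AE:
  fixes f :: "real \<Rightarrow> real"
  assumes f: "f \<in> borel_measurable lebesgue" and B: "\<And>x. \<bar>f x\<bar> \<le> B"
  obtains g :: "nat \<Rightarrow> real \<Rightarrow> real" where "\<And>n. continuous_on UNIV (g n)" "\<And>n x. \<bar>g n x\<bar> \<le> B"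
    "AE x in lebesgue. (\<lambda>n. g n x) \<longlonglongrightarrow> f x"
proof -
  have "f measurable_on UNIV" by (rule lebesgue_measurable_imp_measurable_on_real[OF f]) simp
  then obtain N g0 where N: "negligible N" and g0: "\<And>n. continuous_on UNIV (g0 n :: real \<Rightarrow> real)"
    and lim: "\<And>x. x \<notin> N \<Longrightarrow> (\<lambda>n. g0 n x) \<longlonglongrightarrow> f x"
    unfolding measurable_on_def by auto
  have B0: "B \<ge> 0" using B[of 0] by linarith
  show thesis
  proof (rule that[of "\<lambda>n x. max (- B) (min B (g0 n x))"])
    show "continuous_on UNIV (\<lambda>x. max (- B) (min B (g0 n x)))" for n
      by (intro continuous_intros g0)
    show "\<bar>max (- B) (min B (g0 n x))\<bar> \<le> B" for n x using B0 by (simp add: abs_le_iff max_def min_def)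
    show "AE x in lebesgue. (\<lambda>n. max (- B) (min B (g0 n x))) \<longlonglongrightarrow> f x"
    proof (rule AE_I')
      show "N \<in> null_sets lebesgue" using N by (simp add: negligible_iff_null_sets)
      show "{x \<in> space lebesgue. \<not> (\<lambda>n. max (- B) (min B (g0 n x))) \<longlonglongrightarrow> f x} \<subseteq> N"
      proof (rule subsetI, rule ccontr)
        fix x assume x: "x \<in> {x \<in> space lebesgue. \<not> (\<lambda>n. max (- B) (min B (g0 n x))) \<longlonglongrightarrow> f x}" "x \<notin> N"
        have "(\<lambda>n. max (- B) (min B (g0 n x))) \<longlonglongrightarrow> max (- B) (min B (f x))"
          by (intro tendsto_max tendsto_min tendsto_const lim x(2))
        moreover have "max (- B) (min B (f x)) = f x" using B[of x] by (simp add: abs_le_iff max_def min_def)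
        ultimately show False using x(1) by simp
      qed
    qed
  qed
qed

lemma negligible_of_AE:
  assumes "AE t in lebesgue. \<not> P t"
  shows "negligible {t. P t}"
proof -
  obtain N where N: "N \<in> null_sets lebesgue" "{t \<in> space lebesgue. \<not> \<not> P t} \<subseteq> N"
    using assms unfolding eventually_ae_filter by (elim bexE)
  then have "negligible N" by (simp add: negligible_iff_null_sets)
  then show ?thesis by (rule negligible_subset) (use N(2) in simp)
qed

text \<open>Truncation makes the function bounded; a bounded measurable function is an almost everywhere limit of
  uniformly bounded continuous ones. Both steps converge in the mean by dominated convergence.\<close>

lemma L1_dense_continuous:
  fixes f :: "real \<Rightarrow> real"
  assumes f: "integrable lebesgue f" and supp: "\<And>t. t \<notin> {0..l} \<Longrightarrow> f t = 0" and e: "e > 0"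
  obtains g B where "continuous_on UNIV g" "\<And>x. \<bar>g x\<bar> \<le> B"
    "(LINT t|lebesgue. \<bar>f t - indicator {0..l} t * g t\<bar>) < e"
proof -
  have [measurable]: "f \<in> borel_measurable lebesgue" using f by auto
  define fk where "fk k t = max (- real k) (min (real k) (f t))" for k t
  have fkm [measurable]: "fk k \<in> borel_measurable lebesgue" for k unfolding fk_def by measurable
  have fk_bd: "\<bar>fk k t\<bar> \<le> real k" for k t unfolding fk_def by linarith
  have fk_le: "\<bar>fk k t\<bar> \<le> \<bar>f t\<bar>" for k t
    unfolding fk_def by (cases "f t \<ge> 0") linarith+
  have "(\<lambda>k. LINT t|lebesgue. \<bar>f t - fk k t\<bar>) \<longlonglongrightarrow> (LINT t|(lebesgue :: real measure). 0)"
  proof (rule integral_dominated_convergence)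
    show "integrable lebesgue (\<lambda>t. 2 * \<bar>f t\<bar>)" using f by (intro integrable_mult_right integrable_abs)
    show "AE t in lebesgue. (\<lambda>k. \<bar>f t - fk k t\<bar>) \<longlonglongrightarrow> 0"
    proof (rule AE_I2)
      fix t
      obtain k0 :: nat where "\<bar>f t\<bar> \<le> real k0" using real_arch_simple by blast
      then have "\<bar>f t - fk k t\<bar> = 0" if "k \<ge> k0" for k
        using that unfolding fk_def by linarith
      then show "(\<lambda>k. \<bar>f t - fk k t\<bar>) \<longlonglongrightarrow> 0"
        by (intro tendsto_eventually eventually_sequentiallyI[of k0])
    qed
    show "AE t in lebesgue. norm \<bar>f t - fk k t\<bar> \<le> 2 * \<bar>f t\<bar>" for k
    proof (rule AE_I2)
      fix t show "norm \<bar>f t - fk k t\<bar> \<le> 2 * \<bar>f t\<bar>"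
        using fk_le[of k t] abs_triangle_ineq4[of "f t" "fk k t"] by simp
    qed
  qed measurable
  then have "(\<lambda>k. LINT t|lebesgue. \<bar>f t - fk k t\<bar>) \<longlonglongrightarrow> 0" by simp
  from order_tendstoD(2)[OF this, of "e / 2"] e obtain k where k: "(LINT t|lebesgue. \<bar>f t - fk k t\<bar>) < e / 2"
    by (auto simp: eventually_sequentially)
  obtain g where g: "\<And>n. continuous_on UNIV (g n)" "\<And>n x. \<bar>g n x\<bar> \<le> real k"
    "AE x in lebesgue. (\<lambda>n. g n x) \<longlonglongrightarrow> fk k x"
    using continuous_approximation_AE[OF fkm fk_bd] by metis
  have gm [measurable]: "g n \<in> borel_measurable borel" for n by (rule borel_measurable_continuous_onI[OF g(1)])
  have hm [measurable]: "(\<lambda>t. indicator {0..l} t * g n t) \<in> borel_measurable lebesgue" for n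
    by (rule measurable_completion) measurable
  have fk0: "fk k t = 0" if "t \<notin> {0..l}" for t using supp[OF that] by (simp add: fk_def)
  have ind: "integrable lebesgue (\<lambda>t. c * indicator {0..l} t :: real)" for c
    by (intro integrable_mult_right integrable_real_indicator) (auto simp: emeasure_lborel_Icc_eq)
  have "(\<lambda>n. LINT t|lebesgue. \<bar>fk k t - indicator {0..l} t * g n t\<bar>) \<longlonglongrightarrow> (LINT t|(lebesgue :: real measure). 0)"
  proof (rule integral_dominated_convergence[OF _ _ ind])
    show "AE t in lebesgue. (\<lambda>n. \<bar>fk k t - indicator {0..l} t * g n t\<bar>) \<longlonglongrightarrow> 0"
      using g(3)
    proof eventually_elim
      case (elim t)
      have "(\<lambda>n. \<bar>fk k t - indicator {0..l} t * g n t\<bar>) \<longlonglongrightarrow> \<bar>fk k t - indicator {0..l} t * fk k t\<bar>"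
        by (intro tendsto_intros elim)
      moreover have "fk k t - indicator {0..l} t * fk k t = 0" by (cases "t \<in> {0..l}") (simp_all add: fk0 del: atLeastAtMost_iff)
      ultimately show ?case by simp
    qed
    show "AE t in lebesgue. norm \<bar>fk k t - indicator {0..l} t * g n t\<bar> \<le> (2 * real k) * indicator {0..l} t" for n
    proof (rule AE_I2)
      fix t show "norm \<bar>fk k t - indicator {0..l} t * g n t\<bar> \<le> (2 * real k) * indicator {0..l} t"
      proof (cases "t \<in> {0..l}")
        case True
        have "\<bar>fk k t - g n t\<bar> \<le> real k + real k"
          using fk_bd[of k t] g(2)[of n t] by (intro order_trans[OF abs_triangle_ineq4] add_mono)
        then show ?thesis using True by (simp del: atLeastAtMost_iff)
      qed (simp add: fk0 del: atLeastAtMost_iff)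
    qed
  qed measurable
  then have "(\<lambda>n. LINT t|lebesgue. \<bar>fk k t - indicator {0..l} t * g n t\<bar>) \<longlonglongrightarrow> 0" by simp
  from order_tendstoD(2)[OF this, of "e / 2"] e obtain n
    where n: "(LINT t|lebesgue. \<bar>fk k t - indicator {0..l} t * g n t\<bar>) < e / 2"
    by (auto simp: eventually_sequentially)
  have hint: "integrable lebesgue (\<lambda>t. indicator {0..l} t * g n t)"
  proof (rule Bochner_Integration.integrable_bound[OF ind[of "real k"] hm], rule AE_I2)
    fix t show "norm (indicator {0..l} t * g n t) \<le> norm (real k * indicator {0..l} t)"
      using g(2)[of n t] by (simp add: indicator_def)
  qed
  have fkint: "integrable lebesgue (fk k)"
    by (rule Bochner_Integration.integrable_bound[OF f fkm]) (simp add: fk_le)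
  have "(LINT t|lebesgue. \<bar>f t - indicator {0..l} t * g n t\<bar>)
      \<le> (LINT t|lebesgue. \<bar>f t - fk k t\<bar> + \<bar>fk k t - indicator {0..l} t * g n t\<bar>)"
    by (rule integral_mono) (auto intro!: Bochner_Integration.integrable_add integrable_abs Bochner_Integration.integrable_diff f fkint hint)
  also have "\<dots> = (LINT t|lebesgue. \<bar>f t - fk k t\<bar>) + (LINT t|lebesgue. \<bar>fk k t - indicator {0..l} t * g n t\<bar>)"
    by (rule Bochner_Integration.integral_add) (auto intro!: integrable_abs Bochner_Integration.integrable_diff f fkint hint)
  also have "\<dots> < e" using k n by simp
  finally show thesis by (rule that[OF g(1,2)])
qed

lemma dilation_L1:
  fixes f :: "real \<Rightarrow> real"
  assumes f: "integrable lebesgue f" and c: "c > 0"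
  shows "integrable lebesgue (\<lambda>t. f (t / c))" "(LINT t|lebesgue. f (t / c)) = c * (LINT t|lebesgue. f t)"
proof -
  have e: "(\<lambda>t. f (t / c)) = (\<lambda>t. f (0 + (1 / c) * t))" by simp
  show "integrable lebesgue (\<lambda>t. f (t / c))"
    unfolding e using lebesgue_integrable_real_affine_iff[of "1 / c" f 0] c f by simp
  have "(LINT t|lebesgue. f t) = \<bar>1 / c\<bar> *\<^sub>R (LINT t|lebesgue. f (0 + (1 / c) * t))"
    by (rule lebesgue_integral_real_affine) (use c in simp)
  then show "(LINT t|lebesgue. f (t / c)) = c * (LINT t|lebesgue. f t)"
    unfolding e using c by simp
qed

lemma dilation_continuous_L1_continuous:
  fixes g :: "real \<Rightarrow> real" and l :: real
  assumes g: "continuous_on UNIV g" and B: "\<And>x. \<bar>g x\<bar> \<le> B" and l: "l \<ge> 0"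
    and cn: "cn \<longlonglongrightarrow> 1" "\<And>n. cn n \<in> {1/2..2}"
  shows "(\<lambda>n. LINT t|lebesgue. \<bar>indicator {0..l} (t / cn n) * g (t / cn n) - indicator {0..l} t * g t\<bar>) \<longlonglongrightarrow> 0"
proof -
  have B0: "B \<ge> 0" using B[of 0] by linarith
  have gm [measurable]: "g \<in> borel_measurable borel" by (rule borel_measurable_continuous_onI[OF g])
  have "(\<lambda>n. LINT t|lebesgue. \<bar>indicator {0..l} (t / cn n) * g (t / cn n) - indicator {0..l} t * g t\<bar>) \<longlonglongrightarrow> (LINT t|(lebesgue :: real measure). 0)"
  proof (rule integral_dominated_convergence)
    show "integrable lebesgue (\<lambda>t. (2 * B) * indicator {0..2 * l} t)"
      by (intro integrable_mult_right integrable_real_indicator) (auto simp: emeasure_lborel_Icc_eq)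
    show "(\<lambda>t. \<bar>indicator {0..l} (t / cn n) * g (t / cn n) - indicator {0..l} t * g t\<bar>) \<in> borel_measurable lebesgue" for n
      by (rule measurable_completion) measurable
    have "{0, l} \<in> null_sets lebesgue" by (simp add: negligible_iff_null_sets[symmetric])
    then show "AE t in lebesgue. (\<lambda>n. \<bar>indicator {0..l} (t / cn n) * g (t / cn n) - indicator {0..l} t * g t\<bar>) \<longlonglongrightarrow> 0"
    proof (rule AE_I')
      show "{t \<in> space lebesgue. \<not> (\<lambda>n. \<bar>indicator {0..l} (t / cn n) * g (t / cn n) - indicator {0..l} t * g t\<bar>) \<longlonglongrightarrow> 0} \<subseteq> {0, l}"
      proof (rule subsetI, rule ccontr)
        fix t assume t: "t \<in> {t \<in> space lebesgue. \<not> (\<lambda>n. \<bar>indicator {0..l} (t / cn n) * g (t / cn n) - indicator {0..l} t * g t\<bar>) \<longlonglongrightarrow> 0}"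
          and nt: "t \<notin> {0, l}"
        have "(\<lambda>n. t / cn n) \<longlonglongrightarrow> t / 1" by (intro tendsto_intros cn(1)) simp
        then have lim: "(\<lambda>n. t / cn n) \<longlonglongrightarrow> t" by simp
        have "isCont g t" using g by (simp add: continuous_on_eq_continuous_at)
        then have limg: "(\<lambda>n. g (t / cn n)) \<longlonglongrightarrow> g t" using lim by (rule isCont_tendsto_compose)
        have "eventually (\<lambda>n. indicator {0..l} (t / cn n) = (indicator {0..l} t :: real)) sequentially"
        proof -
          consider "t < 0" | "0 < t" "t < l" | "l < t" using nt by fastforce
          then show ?thesis
          proof cases
            case 1
            from order_tendstoD(2)[OF lim 1] show ?thesis by eventually_elim (use 1 in auto)
          next
            case 2
            from order_tendstoD(2)[OF lim 2(2)] order_tendstoD(1)[OF lim 2(1)] show ?thesis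
              by eventually_elim (use 2 in auto)
          next
            case 3
            from order_tendstoD(1)[OF lim 3] show ?thesis by eventually_elim (use 3 in auto)
          qed
        qed
        then have limi: "(\<lambda>n. indicator {0..l} (t / cn n) :: real) \<longlonglongrightarrow> indicator {0..l} t"
          by (rule tendsto_eventually)
        have "(\<lambda>n. \<bar>indicator {0..l} (t / cn n) * g (t / cn n) - indicator {0..l} t * g t\<bar>) \<longlonglongrightarrow>
          \<bar>indicator {0..l} t * g t - indicator {0..l} t * g t\<bar>"
          by (intro tendsto_intros limi limg)
        then show False using t by simp
      qed
    qed
    show "AE t in lebesgue. norm \<bar>indicator {0..l} (t / cn n) * g (t / cn n) - indicator {0..l} t * g t\<bar> \<le> (2 * B) * indicator {0..2 * l} t" for n
    proof (rule AE_I2)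
      fix t
      have c: "1 / 2 \<le> cn n" "cn n \<le> 2" using cn(2)[of n] by auto
      show "norm \<bar>indicator {0..l} (t / cn n) * g (t / cn n) - indicator {0..l} t * g t\<bar> \<le> (2 * B) * indicator {0..2 * l} t"
      proof (cases "t \<in> {0..2 * l}")
        case True
        have "\<bar>indicator {0..l} (t / cn n) * g (t / cn n)\<bar> \<le> B" "\<bar>indicator {0..l} t * g t\<bar> \<le> B"
          using B[of t] B[of "t / cn n"] B0 by (auto simp: indicator_def)
        then have "\<bar>indicator {0..l} (t / cn n) * g (t / cn n) - indicator {0..l} t * g t\<bar> \<le> B + B"
          by (intro order_trans[OF abs_triangle_ineq4] add_mono)
        then show ?thesis using True by simp
      next
        case False
        then have out: "t < 0 \<or> 2 * l < t" by auto
        have "t / cn n \<notin> {0..l}"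
        proof (cases "t < 0")
          case True then show ?thesis using c by (simp add: divide_neg_pos not_le)
        next
          case False
          then have "2 * l < t" using out by simp
          moreover have "l * cn n \<le> l * 2" using c l by (intro mult_left_mono) auto
          ultimately have "l < t / cn n" using c by (simp add: pos_less_divide_eq)
          then show ?thesis by simp
        qed
        moreover have "t \<notin> {0..l}" using out l by auto
        ultimately show ?thesis using False by simp
      qed
    qed
  qed simp
  then show ?thesis by simp
qed

text \<open>Dilations act continuously in the mean: this is clear for continuous functions cut off at the ends of an
  interval, and these are dense. A homothety of a planar curve reparametrizes its velocity by such a
  dilation, and the velocity is merely integrable.\<close>

lemma dilation_continuous_L1:
  fixes f :: "real \<Rightarrow> real"
  assumes f: "integrable lebesgue f" and supp: "\<And>t. t \<notin> {0..l} \<Longrightarrow> f t = 0" and l: "l \<ge> 0"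
  shows "((\<lambda>c. LINT t|lebesgue. \<bar>f (t / c) - f t\<bar>) \<longlongrightarrow> 0) (at 1)"
  unfolding tendsto_at_iff_sequentially
proof (intro allI impI)
  fix X :: "nat \<Rightarrow> real" assume X: "\<forall>i. X i \<in> UNIV - {1}" "X \<longlonglongrightarrow> 1"
  have "(\<lambda>n. LINT t|lebesgue. \<bar>f (t / X n) - f t\<bar>) \<longlonglongrightarrow> 0"
  proof (rule LIMSEQ_I)
    fix r :: real assume r: "r > 0"
    then have r8: "r / 8 > 0" by simp
    obtain g B where g: "continuous_on UNIV g" "\<And>x. \<bar>g x\<bar> \<le> B"
      and fg: "(LINT t|lebesgue. \<bar>f t - indicator {0..l} t * g t\<bar>) < r / 8"
    proof (rule L1_dense_continuous[OF f _ r8, of l])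
      show "f t = 0" if "t \<notin> {0..l}" for t by (rule supp[OF that])
    qed (rule that)
    define h where "h t = indicator {0..l} t * g t" for t
    have gm [measurable]: "g \<in> borel_measurable borel" by (rule borel_measurable_continuous_onI[OF g(1)])
    have hint: "integrable lebesgue h"
    proof (rule Bochner_Integration.integrable_bound[of _ "\<lambda>t. B * indicator {0..l} t"])
      show "integrable lebesgue (\<lambda>t. B * indicator {0..l} t :: real)"
        by (intro integrable_mult_right integrable_real_indicator) (auto simp: emeasure_lborel_Icc_eq)
      show "h \<in> borel_measurable lebesgue" unfolding h_def by (rule measurable_completion) measurable
      show "AE t in lebesgue. norm (h t) \<le> norm (B * indicator {0..l} t)"
      proof (rule AE_I2)
        fix t show "norm (h t) \<le> norm (B * indicator {0..l} t)" using g(2)[of t] by (simp add: h_def indicator_def)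
      qed
    qed
    define cn where "cn n = max (1/2) (min 2 (X n))" for n
    have "cn \<longlonglongrightarrow> max (1/2) (min 2 1)" unfolding cn_def by (intro tendsto_max tendsto_min tendsto_const X(2))
    then have cn: "cn \<longlonglongrightarrow> 1" by simp
    have cnI: "cn n \<in> {1/2..2}" for n by (auto simp: cn_def)
    have "(\<lambda>n. LINT t|lebesgue. \<bar>h (t / cn n) - h t\<bar>) \<longlonglongrightarrow> 0"
      unfolding h_def by (rule dilation_continuous_L1_continuous[OF g l cn cnI])
    from order_tendstoD(2)[OF this, of "r / 8"] have "eventually (\<lambda>n. (LINT t|lebesgue. \<bar>h (t / cn n) - h t\<bar>) < r / 8) sequentially"
      using r by simp
    moreover have "eventually (\<lambda>n. X n < 2) sequentially" "eventually (\<lambda>n. X n > 1/2) sequentially"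
      by (rule order_tendstoD[OF X(2)], simp)+
    ultimately have "eventually (\<lambda>n. norm ((LINT t|lebesgue. \<bar>f (t / X n) - f t\<bar>) - 0) < r) sequentially"
    proof eventually_elim
      case (elim n)
      have c: "X n > 0" "X n \<le> 2" "cn n = X n" using elim by (auto simp: cn_def)
      have d: "integrable lebesgue (\<lambda>t. \<bar>f t - h t\<bar>)"
        by (intro integrable_abs Bochner_Integration.integrable_diff f hint)
      have d1: "integrable lebesgue (\<lambda>t. \<bar>f (t / X n) - h (t / X n)\<bar>)"
        "(LINT t|lebesgue. \<bar>f (t / X n) - h (t / X n)\<bar>) = X n * (LINT t|lebesgue. \<bar>f t - h t\<bar>)"
        using dilation_L1[OF d c(1)] by auto
      have d2: "integrable lebesgue (\<lambda>t. \<bar>h (t / X n) - h t\<bar>)"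
        by (intro integrable_abs Bochner_Integration.integrable_diff dilation_L1(1)[OF hint c(1)] hint)
      have d3: "integrable lebesgue (\<lambda>t. \<bar>f (t / X n) - f t\<bar>)"
        by (intro integrable_abs Bochner_Integration.integrable_diff dilation_L1(1)[OF f c(1)] f)
      have "(LINT t|lebesgue. \<bar>f (t / X n) - f t\<bar>) \<le>
          (LINT t|lebesgue. \<bar>f (t / X n) - h (t / X n)\<bar> + \<bar>h (t / X n) - h t\<bar> + \<bar>f t - h t\<bar>)"
        by (rule integral_mono[OF d3]) (auto intro!: Bochner_Integration.integrable_add d d1(1) d2)
      also have "\<dots> = (LINT t|lebesgue. \<bar>f (t / X n) - h (t / X n)\<bar>) + (LINT t|lebesgue. \<bar>h (t / X n) - h t\<bar>)
          + (LINT t|lebesgue. \<bar>f t - h t\<bar>)"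
        unfolding Bochner_Integration.integral_add[OF Bochner_Integration.integrable_add[OF d1(1) d2] d]
          Bochner_Integration.integral_add[OF d1(1) d2] by (rule refl)
      also have "\<dots> \<le> 2 * (r / 8) + r / 8 + r / 8"
      proof -
        have nn: "0 \<le> (LINT t|lebesgue. \<bar>f t - h t\<bar>)" by (rule integral_nonneg_AE) simp
        have fh: "(LINT t|lebesgue. \<bar>f t - h t\<bar>) \<le> r / 8" using fg unfolding h_def by (rule less_imp_le)
        have hh: "(LINT t|lebesgue. \<bar>h (t / X n) - h t\<bar>) \<le> r / 8"
          using elim(1) unfolding c(3) by (rule less_imp_le)
        have "X n * (LINT t|lebesgue. \<bar>f t - h t\<bar>) \<le> 2 * (r / 8)"
          by (rule mult_mono[OF c(2) fh _ nn]) simp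
        then show ?thesis using d1(2) fh hh by linarith
      qed
      finally have "(LINT t|lebesgue. \<bar>f (t / X n) - f t\<bar>) < r" using r by linarith
      moreover have "0 \<le> (LINT t|lebesgue. \<bar>f (t / X n) - f t\<bar>)" by (rule integral_nonneg_AE) simp
      ultimately show ?case unfolding real_norm_def by linarith
    qed
    then show "\<exists>no. \<forall>n\<ge>no. norm ((LINT t|lebesgue. \<bar>f (t / X n) - f t\<bar>) - 0) < r"
      by (simp only: eventually_sequentially)
  qed
  then show "((\<lambda>c. LINT t|lebesgue. \<bar>f (t / c) - f t\<bar>) \<circ> X) \<longlonglongrightarrow> 0" by (simp add: o_def)
qed

text \<open>Testing with continuous approximations of \<open>k - m\<close>, where \<open>m\<close> is the mean value of \<open>k\<close>, yields
  \<open>\<integral> (k - m)\<^sup>2 = 0\<close>.\<close>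

lemma du_bois_reymond:
  fixes k :: "real \<Rightarrow> real"
  assumes k: "k \<in> borel_measurable (lebesgue_on {0..l})" and B: "\<And>t. t \<in> {0..l} \<Longrightarrow> \<bar>k t\<bar> \<le> B" and l: "l > 0"
    and ortho: "\<And>\<psi>. continuous_on UNIV \<psi> \<Longrightarrow> integral {0..l} \<psi> = 0 \<Longrightarrow> integral {0..l} (\<lambda>t. k t * \<psi> t) = 0"
  shows "\<exists>m. negligible {t \<in> {0..l}. k t \<noteq> m}"
proof -
  let ?M = "lebesgue_on {0..l}"
  interpret finite_measure ?M by (rule finite_measure_lebesgue_on) simp
  have B0: "B \<ge> 0" using B[of 0] l by force
  define K where "K t = (if t \<in> {0..l} then k t else 0)" for t
  have Km: "K \<in> borel_measurable lebesgue" unfolding K_def by (rule borel_measurable_if_I[OF k]) simp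
  have K_bd: "\<bar>K t\<bar> \<le> B" for t
    unfolding K_def by (cases "t \<in> {0..l}") (simp_all add: B B0 del: atLeastAtMost_iff)
  obtain g where g: "\<And>n. continuous_on UNIV (g n)" "\<And>n x. \<bar>g n x\<bar> \<le> B"
    and lim: "AE x in lebesgue. (\<lambda>n. g n x) \<longlonglongrightarrow> K x"
    by (rule continuous_approximation_AE[OF Km K_bd]) blast
  have limk: "AE x in ?M. (\<lambda>n. g n x) \<longlonglongrightarrow> k x"
  proof -
    have "AE x in lebesgue. x \<in> {0..l} \<longrightarrow> (\<lambda>n. g n x) \<longlonglongrightarrow> k x"
      using lim by eventually_elim (auto simp: K_def)
    then show ?thesis by (subst AE_restrict_space_iff) auto
  qed
  have k_bd: "AE x in ?M. norm (k x) \<le> B"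
    by (rule AE_I2) (simp add: B)
  have int_k: "integrable ?M k" by (rule integrable_const_bound[OF k_bd k])
  have gm: "g n \<in> borel_measurable ?M" for n
    by (intro measurable_restrict_space1 measurable_completion) (simp add: borel_measurable_continuous_onI[OF g(1)])
  have kg_bd: "norm (k x * g n x) \<le> B * B" if "x \<in> {0..l}" for x n
    unfolding real_norm_def abs_mult by (intro mult_mono B that g(2) B0) auto
  have int_g: "integrable ?M (g n)" for n
    by (rule integrable_const_bound[of _ B]) (simp_all add: g(2) gm)
  have kg_AE: "AE x in ?M. norm (k x * g n x) \<le> B * B" for n
    by (rule AE_I2) (rule kg_bd, simp)
  have int_kg: "integrable ?M (\<lambda>t. k t * g n t)" for n
    by (rule integrable_const_bound[OF kg_AE borel_measurable_times[OF k gm]])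
  define m where "m = (LINT t|?M. k t) / l"
  have one: "Sigma_Algebra.measure ?M {0..l} = l"
    using l by (subst measure_restrict_space) auto
  have step: "(LINT t|?M. k t * g n t) = m * (LINT t|?M. g n t)" for n
  proof -
    define a where "a = (LINT t|?M. g n t) / l"
    have la: "l * a = (LINT t|?M. g n t)" "(LINT t|?M. k t) = m * l" using l by (simp_all add: a_def m_def)
    have "integral {0..l} (\<lambda>t. g n t - a) = (LINT t|?M. g n t - a)"
      by (rule lebesgue_integral_eq_integral[symmetric]) (auto intro!: Bochner_Integration.integrable_diff int_g)
    also have "\<dots> = 0"
      by (subst Bochner_Integration.integral_diff[OF int_g]) (simp_all add: one la)
    finally have "integral {0..l} (\<lambda>t. k t * (g n t - a)) = 0"
      by (intro ortho continuous_intros g(1))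
    moreover have "integrable ?M (\<lambda>t. k t * g n t - a * k t)"
      by (intro Bochner_Integration.integrable_diff int_kg integrable_mult_right int_k)
    then have "(LINT t|?M. k t * g n t - a * k t) = integral {0..l} (\<lambda>t. k t * g n t - a * k t)"
      by (rule lebesgue_integral_eq_integral) simp
    ultimately have "(LINT t|?M. k t * g n t - a * k t) = 0" by (simp add: right_diff_distrib mult.commute)
    then have "(LINT t|?M. k t * g n t) = a * (LINT t|?M. k t)"
      by (subst (asm) Bochner_Integration.integral_diff[OF int_kg integrable_mult_right[OF int_k]]) simp
    also have "\<dots> = m * (l * a)" unfolding la(2) by simp
    finally show ?thesis unfolding la(1) .
  qed
  have "(\<lambda>n. LINT t|?M. k t * g n t) \<longlonglongrightarrow> (LINT t|?M. k t * k t)"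
  proof (rule integral_dominated_convergence[of _ _ _ "\<lambda>_. B * B"])
    show "AE x in ?M. (\<lambda>n. k x * g n x) \<longlonglongrightarrow> k x * k x"
      using limk by eventually_elim (intro tendsto_intros)
    show "AE x in ?M. norm (k x * g n x) \<le> B * B" for n
      by (rule kg_AE)
  qed (auto intro!: borel_measurable_times k gm)
  moreover have "(\<lambda>n. LINT t|?M. g n t) \<longlonglongrightarrow> (LINT t|?M. k t)"
  proof (rule integral_dominated_convergence[of _ _ _ "\<lambda>_. B"])
    show "AE x in ?M. norm (g n x) \<le> B" for n by (simp add: g(2))
  qed (auto intro!: k gm limk)
  then have "(\<lambda>n. m * (LINT t|?M. g n t)) \<longlonglongrightarrow> m * (LINT t|?M. k t)" by (intro tendsto_intros)
  ultimately have kk: "(LINT t|?M. k t * k t) = m * (LINT t|?M. k t)"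
    unfolding step by (rule LIMSEQ_unique)
  have kk_bd: "norm (k x * k x) \<le> B * B" if "x \<in> {0..l}" for x
    unfolding real_norm_def abs_mult by (intro mult_mono B that B0) auto
  have "AE x in ?M. norm (k x * k x) \<le> B * B"
    by (rule AE_I2) (rule kk_bd, simp)
  then have int_kk: "integrable ?M (\<lambda>t. k t * k t)"
    by (rule integrable_const_bound) (rule borel_measurable_times[OF k k])
  have int_sq: "integrable ?M (\<lambda>t. k t * k t - 2 * m * k t + m * m)"
    by (intro Bochner_Integration.integrable_add Bochner_Integration.integrable_diff int_kk integrable_mult_right int_k) simp
  have "(LINT t|?M. k t * k t - 2 * m * k t + m * m) = m * (LINT t|?M. k t) - 2 * m * (LINT t|?M. k t) + l * (m * m)"
    by (simp add: Bochner_Integration.integral_add Bochner_Integration.integral_diff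
        Bochner_Integration.integrable_diff int_kk int_k kk one)
  also have "\<dots> = 0" using l by (simp add: m_def)
  finally have "AE t in ?M. k t * k t - 2 * m * k t + m * m = 0"
  proof (subst (asm) integral_nonneg_eq_0_iff_AE[OF int_sq])
    show "AE t in ?M. 0 \<le> k t * k t - 2 * m * k t + m * m"
    proof (rule AE_I2)
      fix t have "0 \<le> (k t - m)\<^sup>2" by simp
      then show "0 \<le> k t * k t - 2 * m * k t + m * m" by (simp add: power2_eq_square algebra_simps)
    qed
  qed
  then have "AE t in lebesgue. t \<in> {0..l} \<longrightarrow> k t * k t - 2 * m * k t + m * m = 0"
    by (subst (asm) AE_restrict_space_iff) auto
  then have "AE t in lebesgue. \<not> (t \<in> {0..l} \<and> k t \<noteq> m)"
  proof eventually_elim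
    case (elim t)
    have "k t * k t - 2 * m * k t + m * m = (k t - m)\<^sup>2" by (simp add: power2_eq_square algebra_simps)
    then show ?case using elim by auto
  qed
  then have "negligible {t. t \<in> {0..l} \<and> k t \<noteq> m}"
    by (rule negligible_of_AE)
  then show ?thesis by (rule exI)
qed

section \<open>Variations of a curve\<close>

lemma velocity_extend:
  assumes q: "\<And>s. q s = (x s, y s, circle_of (\<theta> s))" and t: "0 < t" "t < l"
    and x: "(x has_real_derivative a) (at t within {0..l})" and y: "(y has_real_derivative b) (at t within {0..l})"
    and \<theta>: "(\<theta> has_real_derivative c) (at t within {0..l})"
  shows "velocity (extend (l, q)) t = (a, b, c)"
proof (rule velocity_lift)
  have tr: "((\<lambda>s. f (min l s)) has_real_derivative d) (at t)"
    if "(f has_real_derivative d) (at t within {0..l})" for f d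
  proof (rule has_field_derivative_transform_within_open[of f d t "{..<l}"])
    show "(f has_real_derivative d) (at t)" using that at_within_Icc_at[OF t] by simp
  qed (use t in auto)
  show "((\<lambda>s. x (min l s)) has_real_derivative a) (at t)" by (rule tr[OF x])
  show "((\<lambda>s. y (min l s)) has_real_derivative b) (at t)" by (rule tr[OF y])
  show "((\<lambda>s. \<theta> (min l s)) has_real_derivative c) (at t)" by (rule tr[OF \<theta>])
  show "extend (l, q) s = (x (min l s), y (min l s), circle_of (\<theta> (min l s)))" for s
    by (simp add: extend_def q)
qed

lemma velocity_extend_beyond:
  assumes q: "\<And>s. q s = (x s, y s, circle_of (\<theta> s))" and t: "l < t"
  shows "velocity (extend (l, q)) t = (0, 0, 0)"
proof (rule velocity_lift)
  have tr: "((\<lambda>s. f (min l s)) has_real_derivative 0) (at t)" for f :: "real \<Rightarrow> real"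
    by (rule has_field_derivative_transform_within_open[of "\<lambda>_. f l" 0 t "{l<..}"]) (use t in auto)
  show "((\<lambda>s. x (min l s)) has_real_derivative 0) (at t)" by (rule tr)
  show "((\<lambda>s. y (min l s)) has_real_derivative 0) (at t)" by (rule tr)
  show "((\<lambda>s. \<theta> (min l s)) has_real_derivative 0) (at t)" by (rule tr)
  show "extend (l, q) s = (x (min l s), y (min l s), circle_of (\<theta> (min l s)))" for s
    by (simp add: extend_def q)
qed

lemma norm_triple_le: "norm (a, b, d) \<le> \<bar>a\<bar> + (\<bar>b\<bar> + \<bar>d\<bar>)" for a b d :: real
  using norm_Pair_le[of a "(b, d)"] norm_Pair_le[of b d] unfolding real_norm_def by linarith

lemma has_integral_dilation:
  fixes f :: "real \<Rightarrow> real"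
  assumes f: "(f has_integral I) {0..l}" and c: "c > 0" and l: "l \<ge> 0"
  shows "((\<lambda>s. f (s / c)) has_integral c * I) {0..c * l}"
proof -
  have "((\<lambda>s. f ((1 / c) *\<^sub>R s + 0)) has_integral (1 / \<bar>1 / c\<bar> ^ DIM(real)) *\<^sub>R I)
      ((\<lambda>s. (1 / (1 / c)) *\<^sub>R s + - ((1 / (1 / c)) *\<^sub>R 0)) ` cbox 0 l)"
    by (rule has_integral_affinity) (use f c in auto)
  moreover have "(\<lambda>s. (1 / (1 / c)) *\<^sub>R s + - ((1 / (1 / c)) *\<^sub>R 0)) ` cbox 0 l = {0..c * l}"
    using c l by (simp add: image_mult_atLeastAtMost)
  ultimately show ?thesis using c by simp
qed

lemma integral_dilation:
  fixes f :: "real \<Rightarrow> real"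
  assumes f: "f integrable_on {0..l}" and c: "c > 0" and l: "l \<ge> 0"
  shows "integral {0..c * l} (\<lambda>s. f (s / c)) = c * integral {0..l} f"
  by (rule integral_unique[OF has_integral_dilation[OF integrable_integral[OF f] c l]])

lemma set_integrable_dilation:
  fixes f :: "real \<Rightarrow> real"
  assumes f: "set_integrable lebesgue {0..l} f" and c: "c > 0" and l: "l \<ge> 0"
  shows "set_integrable lebesgue {0..c * l} (\<lambda>s. f (s / c))"
proof -
  have i: "integrable lebesgue (\<lambda>t. indicator {0..l} t *\<^sub>R f t)" using f unfolding set_integrable_def .
  have "indicator {0..l} (t / c) = (indicator {0..c * l} t :: real)" for t
    using c by (simp add: indicator_def pos_divide_le_eq mult.commute zero_le_divide_iff)
  then show ?thesis using dilation_L1(1)[OF i c] unfolding set_integrable_def by simp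
qed

lemma negligible_dilation:
  fixes N :: "real set"
  assumes "negligible N"
  shows "negligible ((\<lambda>t. c * t) ` N)"
  by (rule negligible_differentiable_image_negligible[OF _ assms]) (auto intro!: derivative_intros)

lemma DERIV_dilation:
  assumes "(f has_real_derivative D) (at (s / c) within {0..l})" and c: "c > 0" and s: "s \<in> {0..c * l}"
  shows "((\<lambda>s. f (s / c)) has_real_derivative D / c) (at s within {0..c * l})"
proof -
  have im: "(\<lambda>s. s / c) ` {0..c * l} \<subseteq> {0..l}"
    using c by (auto simp: pos_divide_le_eq mult.commute)
  have "(f has_real_derivative D) (at (s / c) within (\<lambda>s. s / c) ` {0..c * l})"
    by (rule DERIV_subset[OF assms(1) im])
  moreover have "((\<lambda>s. s / c) has_real_derivative 1 / c) (at s within {0..c * l})"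
    by (rule DERIV_cdivide[OF DERIV_ident])
  ultimately have "(f \<circ> (\<lambda>s. s / c) has_real_derivative D * (1 / c)) (at s within {0..c * l})"
    by (rule DERIV_image_chain)
  then show ?thesis by (simp add: o_def)
qed

text \<open>The argument \<open>\<Theta>\<close> is the tangent angle of the curve before the homothety of ratio \<open>c\<close>, which turns arclength \<open>s\<close> into \<open>c s\<close>.\<close>

definition varied_curve :: "real \<Rightarrow> (real \<Rightarrow> real) \<Rightarrow> real \<Rightarrow> real \<Rightarrow> real \<Rightarrow> M" where
  "varied_curve c \<Theta> x0 y0 s =
     (x0 + integral {0..s} (\<lambda>r. cos (\<Theta> (r / c))), y0 + integral {0..s} (\<lambda>r. sin (\<Theta> (r / c))),
      circle_of (\<Theta> (s / c)))"

definition varied_angle :: "(real \<Rightarrow> real) \<Rightarrow> (real \<Rightarrow> real) \<Rightarrow> real \<Rightarrow> real" where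
  "varied_angle \<theta> \<psi> t = \<theta> t + integral {0..t} \<psi>"

context
  fixes l :: real and \<theta> v \<psi> :: "real \<Rightarrow> real" and N :: "real set"
  assumes l: "l > 0" and ac: "abs_continuous_on {0..l} \<theta>" and N: "negligible N"
    and \<theta>': "\<And>t. t \<in> {0..l} \<Longrightarrow> t \<notin> N \<Longrightarrow> (\<theta> has_real_derivative v t) (at t within {0..l})"
    and v: "set_integrable lebesgue {0..l} v"
    and \<psi>: "continuous_on UNIV \<psi>" and \<psi>0: "integral {0..l} \<psi> = 0"
begin

lemma varied_angle_ends: "(varied_angle \<theta> \<psi>) 0 = \<theta> 0" "(varied_angle \<theta> \<psi>) l = \<theta> l"
  using \<psi>0 by (simp_all add: varied_angle_def)

lemma DERIV_variation: "t \<in> {0..l} \<Longrightarrow> ((\<lambda>t. integral {0..t} \<psi>) has_real_derivative \<psi> t) (at t within {0..l})"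
  by (rule integral_has_real_derivative[OF continuous_on_subset[OF \<psi>]]) auto

lemma abs_continuous_varied_angle: "abs_continuous_on {0..l} (varied_angle \<theta> \<psi>)"
proof -
  have "compact (\<psi> ` {0..l})" by (rule compact_continuous_image[OF continuous_on_subset[OF \<psi>]]) auto
  then obtain B where B: "B > 0" "\<And>t. t \<in> {0..l} \<Longrightarrow> \<bar>\<psi> t\<bar> \<le> B"
    using compact_imp_bounded[THEN bounded_pos[THEN iffD1]] by force
  show ?thesis
  proof (rule abs_continuous_on_dominated[OF ac zero_less_one less_imp_le[OF B(1)] zero_le_one])
    fix s t assume st: "s \<in> {0..l}" "t \<in> {0..l}" "s \<le> t"
    have "\<bar>integral {0..s} \<psi> - integral {0..t} \<psi>\<bar> \<le> B * \<bar>s - t\<bar>"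
      by (rule lipschitz_of_bounded_derivative[OF DERIV_variation B(2) st(1,2)])
    moreover have "\<bar>s - t\<bar> = t - s" using st(3) by simp
    ultimately have "\<bar>integral {0..s} \<psi> - integral {0..t} \<psi>\<bar> \<le> B * (t - s)" by simp
    then show "dist ((varied_angle \<theta> \<psi>) s) ((varied_angle \<theta> \<psi>) t) \<le> B * (t - s) + 1 * dist (\<theta> s) (\<theta> t)"
      unfolding dist_real_def varied_angle_def mult_1 by linarith
  qed
qed

lemma continuous_varied_angle: "continuous_on {0..l} (varied_angle \<theta> \<psi>)"
  by (rule abs_continuous_on_imp_continuous_on[OF abs_continuous_varied_angle])

lemma DERIV_varied_angle:
  "t \<in> {0..l} \<Longrightarrow> t \<notin> N \<Longrightarrow> ((varied_angle \<theta> \<psi>) has_real_derivative v t + \<psi> t) (at t within {0..l})"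
  unfolding varied_angle_def by (rule DERIV_add[OF \<theta>' DERIV_variation])

lemma set_integrable_varied_control: "set_integrable lebesgue {0..l} (\<lambda>t. v t + \<psi> t)"
  by (rule set_integral_add(1)[OF v]) (rule absolutely_integrable_continuous_real[OF continuous_on_subset[OF \<psi>]], simp)

lemma continuous_varied_angle_dilated:
  assumes "c > 0" "continuous_on UNIV f"
  shows "continuous_on {0..c * l} (\<lambda>s. f ((varied_angle \<theta> \<psi>) (s / c)))"
proof -
  have "continuous_on {0..c * l} (\<lambda>s. (varied_angle \<theta> \<psi>) (s / c))"
    by (rule continuous_on_compose2[OF continuous_varied_angle])
      (use assms in \<open>auto intro!: continuous_intros simp: pos_divide_le_eq mult.commute\<close>)
  then show ?thesis by (rule continuous_on_compose2[OF assms(2)]) auto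
qed

lemma varied_curve_DERIV:
  assumes c: "c > 0" and s: "s \<in> {0..c * l}" and f: "continuous_on UNIV f"
  shows "((\<lambda>s. x0 + integral {0..s} (\<lambda>r. f ((varied_angle \<theta> \<psi>) (r / c)))) has_real_derivative f ((varied_angle \<theta> \<psi>) (s / c)))
    (at s within {0..c * l})"
proof -
  have "((\<lambda>s. x0 + integral {0..s} (\<lambda>r. f ((varied_angle \<theta> \<psi>) (r / c)))) has_real_derivative 0 + f ((varied_angle \<theta> \<psi>) (s / c)))
    (at s within {0..c * l})"
    by (intro DERIV_add DERIV_const integral_has_real_derivative[OF continuous_varied_angle_dilated[OF c f] s])
  then show ?thesis by simp
qed

lemma varied_curve_DERIV_angle:
  assumes c: "c > 0" and s: "s \<in> {0..c * l}" "s \<notin> (\<lambda>t. c * t) ` N"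
  shows "((\<lambda>s. (varied_angle \<theta> \<psi>) (s / c)) has_real_derivative (v (s / c) + \<psi> (s / c)) / c) (at s within {0..c * l})"
proof (rule DERIV_dilation[OF DERIV_varied_angle c s(1)])
  show "s / c \<in> {0..l}" using c s by (auto simp: pos_divide_le_eq mult.commute)
  show "s / c \<notin> N"
  proof
    assume "s / c \<in> N"
    then have "c * (s / c) \<in> (\<lambda>t. c * t) ` N" by (rule imageI)
    then show False using s(2) c by simp
  qed
qed

lemma varied_curve_admissible:
  assumes c: "c > 0"
  shows "admissible (x0, y0, circle_of (\<theta> 0))
      (x0 + c * integral {0..l} (\<lambda>t. cos ((varied_angle \<theta> \<psi>) t)), y0 + c * integral {0..l} (\<lambda>t. sin ((varied_angle \<theta> \<psi>) t)), circle_of (\<theta> l))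
      (c * l) (varied_curve c (varied_angle \<theta> \<psi>) x0 y0) (\<lambda>s. (v (s / c) + \<psi> (s / c)) / c)"
proof -
  let ?q = "varied_curve c (varied_angle \<theta> \<psi>) x0 y0"
  have int: "(\<lambda>t. cos ((varied_angle \<theta> \<psi>) t)) integrable_on {0..l}" "(\<lambda>t. sin ((varied_angle \<theta> \<psi>) t)) integrable_on {0..l}"
    by (intro integrable_continuous_interval continuous_intros continuous_varied_angle)+
  have "admissible (?q 0) (?q (c * l)) (c * l) ?q (\<lambda>s. (v (s / c) + \<psi> (s / c)) / c)"
  proof (rule admissible_of_lift[OF _ _ _ negligible_dilation[OF N, of c] varied_curve_DERIV_angle[OF c]
        varied_curve_DERIV[OF c, of _ cos x0] varied_curve_DERIV[OF c, of _ sin y0]])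
    show "abs_continuous_on {0..c * l} (\<lambda>s. (varied_angle \<theta> \<psi>) (s / c))"
      using abs_continuous_on_dilation[OF abs_continuous_varied_angle c] by simp
    show "set_integrable lebesgue {0..c * l} (\<lambda>s. (v (s / c) + \<psi> (s / c)) / c)"
      using set_integrable_dilation[OF set_integrable_varied_control c] l by (intro set_integrable_divide) simp
  qed (use c l in \<open>auto intro!: continuous_intros simp: varied_curve_def\<close>)
  moreover have "?q 0 = (x0, y0, circle_of (\<theta> 0))" by (simp add: varied_curve_def varied_angle_ends)
  moreover have "?q (c * l) = (x0 + c * integral {0..l} (\<lambda>t. cos ((varied_angle \<theta> \<psi>) t)), y0 + c * integral {0..l} (\<lambda>t. sin ((varied_angle \<theta> \<psi>) t)), circle_of (\<theta> l))"
    using integral_dilation[OF int(1) c] integral_dilation[OF int(2) c] l c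
    by (simp add: varied_curve_def varied_angle_ends)
  ultimately show ?thesis by simp
qed

lemma varied_curve_cost:
  assumes c: "c > 0"
  shows "cost \<xi> (c * l) (\<lambda>s. (v (s / c) + \<psi> (s / c)) / c)
    = integral {0..l} (\<lambda>t. sqrt ((\<xi> * c)\<^sup>2 + (v t + \<psi> t)\<^sup>2))"
proof -
  have si: "set_integrable lebesgue {0..l} (\<lambda>t. (v t + \<psi> t) / c)"
    by (intro set_integrable_divide set_integrable_varied_control)
  have "cost \<xi> (c * l) (\<lambda>s. (v (s / c) + \<psi> (s / c)) / c)
      = integral {0..c * l} (\<lambda>s. sqrt (\<xi>\<^sup>2 + ((v (s / c) + \<psi> (s / c)) / c)\<^sup>2))"
    using set_integrable_dilation[OF si c] l by (intro cost_eq_integral) simp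
  also have "\<dots> = c * integral {0..l} (\<lambda>t. sqrt (\<xi>\<^sup>2 + ((v t + \<psi> t) / c)\<^sup>2))"
    using integral_dilation[OF set_lebesgue_integral_eq_integral(1)[OF set_integrable_cost[OF si, of \<xi>]] c] l by simp
  also have "\<dots> = integral {0..l} (\<lambda>t. c * sqrt (\<xi>\<^sup>2 + ((v t + \<psi> t) / c)\<^sup>2))"
    by (rule integral_mult_right[symmetric])
  also have "(\<lambda>t. c * sqrt (\<xi>\<^sup>2 + ((v t + \<psi> t) / c)\<^sup>2)) = (\<lambda>t. sqrt ((\<xi> * c)\<^sup>2 + (v t + \<psi> t)\<^sup>2))"
  proof
    fix t
    have "c * sqrt (\<xi>\<^sup>2 + ((v t + \<psi> t) / c)\<^sup>2) = sqrt (c\<^sup>2 * (\<xi>\<^sup>2 + ((v t + \<psi> t) / c)\<^sup>2))"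
      using c by (simp add: real_sqrt_mult)
    also have "c\<^sup>2 * (\<xi>\<^sup>2 + ((v t + \<psi> t) / c)\<^sup>2) = (\<xi> * c)\<^sup>2 + (v t + \<psi> t)\<^sup>2"
      using c by (simp add: power_divide power_mult_distrib distrib_left mult.commute)
    finally show "c * sqrt (\<xi>\<^sup>2 + ((v t + \<psi> t) / c)\<^sup>2) = sqrt ((\<xi> * c)\<^sup>2 + (v t + \<psi> t)\<^sup>2)" .
  qed
  finally show ?thesis .
qed

lemma varied_angle_close:
  assumes \<eta>: "\<And>t. t \<in> {0..l} \<Longrightarrow> \<bar>\<psi> t\<bar> \<le> \<eta>" and r: "r \<in> {0..l}"
  shows "\<bar>(varied_angle \<theta> \<psi>) r - \<theta> r\<bar> \<le> \<eta> * l"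
proof -
  have "\<bar>integral {0..r} \<psi> - integral {0..0} \<psi>\<bar> \<le> \<eta> * \<bar>r - 0\<bar>"
    by (rule lipschitz_of_bounded_derivative[OF DERIV_variation \<eta> r]) (use l in auto)
  also have "\<dots> \<le> \<eta> * l"
    using r order_trans[OF abs_ge_zero \<eta>[OF r]] by (intro mult_left_mono) auto
  finally show ?thesis by (simp add: varied_angle_def)
qed

text \<open>Where both velocities are known, their difference is bounded by the errors of dilating the original
  velocity, plus terms proportional to the size \<open>\<eta>\<close> of the angular perturbation and to \<open>\<bar>c - 1\<bar>\<close>.
  Outside the two domains the extended curves are constant and have velocity zero.\<close>

lemma varied_curve_W11_dist:
  assumes c: "c > 0" and \<eta>: "\<And>t. t \<in> {0..l} \<Longrightarrow> \<bar>\<psi> t\<bar> \<le> \<eta>"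
    and q: "\<And>s. q s = (x s, y s, circle_of (\<theta> s))"
    and x': "\<And>t. t \<in> {0..l} \<Longrightarrow> (x has_real_derivative cos (\<theta> t)) (at t within {0..l})"
    and y': "\<And>t. t \<in> {0..l} \<Longrightarrow> (y has_real_derivative sin (\<theta> t)) (at t within {0..l})"
    and cosf: "cosf = (\<lambda>t. indicator {0..l} t * cos (\<theta> t))" and cosi: "integrable lebesgue cosf"
    and sinf: "sinf = (\<lambda>t. indicator {0..l} t * sin (\<theta> t))" and sini: "integrable lebesgue sinf"
    and vf: "vf = (\<lambda>t. indicator {0..l} t * v t)" and vi: "integrable lebesgue vf"
  shows "W11_dist (l, q) (c * l, varied_curve c (varied_angle \<theta> \<psi>) (x 0) (y 0)) \<le>
    (LINT t|lebesgue. \<bar>cosf (t / c) - cosf t\<bar>) + (LINT t|lebesgue. \<bar>sinf (t / c) - sinf t\<bar>)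
    + (LINT t|lebesgue. \<bar>vf (t / c) - vf t\<bar>) + (2 * \<eta> * l) * (c * l)
    + \<bar>c - 1\<bar> * (LINT t|lebesgue. \<bar>vf t\<bar>) + \<eta> * l"
proof -
  define q1 where "q1 = varied_curve c (varied_angle \<theta> \<psi>) (x 0) (y 0)"
  define L where "L = max l (c * l)"
  define I where "I t = (indicator {0..l} t :: real)" for t
  define G where "G t = \<bar>cosf (t / c) - cosf t\<bar> + \<bar>sinf (t / c) - sinf t\<bar> + \<bar>vf (t / c) - vf t\<bar>
      + (2 * \<eta> * l) * I (t / c) + \<bar>1 - 1 / c\<bar> * \<bar>vf (t / c)\<bar> + (\<eta> / c) * I (t / c)" for t
  define g where "g t = indicator {0..L} t *\<^sub>R norm (velocity (extend (l, q)) t - velocity (extend (c * l, q1)) t)" for t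
  have \<eta>0: "\<eta> \<ge> 0" using order_trans[OF abs_ge_zero \<eta>[of 0]] l by simp
  have I_int: "integrable lebesgue I" "(LINT t|lebesgue. I t) = l"
  proof -
    show "integrable lebesgue I" unfolding I_def
      by (rule integrable_real_indicator) (auto simp: emeasure_lborel_Icc_eq)
    have "(LINT t|lebesgue. I t) = Sigma_Algebra.measure lebesgue {0..l}" unfolding I_def by simp
    then show "(LINT t|lebesgue. I t) = l" using l by simp
  qed
  have Ic: "integrable lebesgue (\<lambda>t. I (t / c))" "(LINT t|lebesgue. I (t / c)) = c * l"
    using dilation_L1[OF I_int(1) c] I_int(2) by auto
  have vc: "integrable lebesgue (\<lambda>t. \<bar>vf (t / c)\<bar>)" "(LINT t|lebesgue. \<bar>vf (t / c)\<bar>) = c * (LINT t|lebesgue. \<bar>vf t\<bar>)"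
    using dilation_L1[OF integrable_abs[OF vi] c] by auto
  have D: "integrable lebesgue (\<lambda>t. \<bar>f (t / c) - f t\<bar>)" if "integrable lebesgue f" for f :: "real \<Rightarrow> real"
    by (intro integrable_abs Bochner_Integration.integrable_diff dilation_L1(1)[OF that c] that)
  note ints = D[OF cosi] D[OF sini] D[OF vi] integrable_mult_right[OF Ic(1), of "2 * \<eta> * l"]
    integrable_mult_right[OF vc(1), of "\<bar>1 - 1 / c\<bar>"] integrable_mult_right[OF Ic(1), of "\<eta> / c"]
  note add = Bochner_Integration.integrable_add
  have G1: "integrable lebesgue G"
    unfolding G_def by (intro add ints)
  have G2: "(LINT t|lebesgue. G t) = (LINT t|lebesgue. \<bar>cosf (t / c) - cosf t\<bar>) + (LINT t|lebesgue. \<bar>sinf (t / c) - sinf t\<bar>)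
    + (LINT t|lebesgue. \<bar>vf (t / c) - vf t\<bar>) + (2 * \<eta> * l) * (c * l)
    + \<bar>1 - 1 / c\<bar> * (c * (LINT t|lebesgue. \<bar>vf t\<bar>)) + (\<eta> / c) * (c * l)"
    unfolding G_def
      Bochner_Integration.integral_add[OF add[OF add[OF add[OF add[OF ints(1,2)] ints(3)] ints(4)] ints(5)] ints(6)]
      Bochner_Integration.integral_add[OF add[OF add[OF add[OF ints(1,2)] ints(3)] ints(4)] ints(5)]
      Bochner_Integration.integral_add[OF add[OF add[OF ints(1,2)] ints(3)] ints(4)]
      Bochner_Integration.integral_add[OF add[OF ints(1,2)] ints(3)]
      Bochner_Integration.integral_add[OF ints(1,2)]
    by (simp only: integral_mult_right_zero Ic(2) vc(2))
  have c1: "\<bar>1 - 1 / c\<bar> * (c * z) = \<bar>c - 1\<bar> * z" for z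
  proof -
    have "\<bar>1 - 1 / c\<bar> * c = \<bar>(1 - 1 / c) * c\<bar>" using c by (simp add: abs_mult)
    also have "(1 - 1 / c) * c = c - 1" using c by (simp add: field_simps)
    finally show ?thesis by (simp only: mult.assoc[symmetric])
  qed
  have G0: "G t \<ge> 0" for t
    unfolding G_def I_def using \<eta>0 l c by (intro add_nonneg_nonneg mult_nonneg_nonneg) auto
  have bound: "g t \<le> G t" if t: "t \<notin> {0, l, c * l} \<union> N \<union> (\<lambda>t. c * t) ` N" for t
  proof (cases "t \<in> {0..L}")
    case True
    then have t0: "0 < t" using t by auto
    define r where "r = t / c"
    have r0: "r > 0" using t0 c by (simp add: r_def)
    have v1: "velocity (extend (l, q)) t = (cosf t, sinf t, vf t)"
    proof (cases "t < l")
      case True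
      then have tI: "t \<in> {0..l}" "t \<notin> N" using t0 t by auto
      show ?thesis using velocity_extend[OF q t0 True x'[OF tI(1)] y'[OF tI(1)] \<theta>'[OF tI]] tI
        by (simp add: cosf sinf vf)
    next
      case False
      then have "l < t" using t by auto
      then show ?thesis using velocity_extend_beyond[OF q, of l t] by (simp add: cosf sinf vf)
    qed
    have v2: "velocity (extend (c * l, q1)) t =
        (I r * cos ((varied_angle \<theta> \<psi>) r), I r * sin ((varied_angle \<theta> \<psi>) r), I r * (v r + \<psi> r) / c)"
    proof (cases "t < c * l")
      case True
      then have tI: "t \<in> {0..c * l}" "t \<notin> (\<lambda>t. c * t) ` N" using t0 t by auto
      have "I r = 1" using r0 True c by (simp add: I_def r_def pos_divide_le_eq mult.commute)
      then show ?thesis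
        using velocity_extend[of q1, OF _ t0 True varied_curve_DERIV[OF c tI(1), of cos "x 0"]
          varied_curve_DERIV[OF c tI(1), of sin "y 0"] varied_curve_DERIV_angle[OF c tI]]
          continuous_on_cos[OF continuous_on_id, of UNIV] continuous_on_sin[OF continuous_on_id, of UNIV]
        by (simp add: q1_def varied_curve_def r_def)
    next
      case False
      then have "c * l < t" using t by auto
      moreover from this have "I r = 0" using c by (simp add: I_def r_def pos_divide_le_eq mult.commute)
      ultimately show ?thesis
        using velocity_extend_beyond[of q1 _ _ "\<lambda>s. (varied_angle \<theta> \<psi>) (s / c)" "c * l" t]
        by (auto simp: q1_def varied_curve_def)
    qed
    have close: "\<bar>I r * cos ((varied_angle \<theta> \<psi>) r) - I r * cos (\<theta> r)\<bar> \<le> (\<eta> * l) * I r"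
      "\<bar>I r * sin ((varied_angle \<theta> \<psi>) r) - I r * sin (\<theta> r)\<bar> \<le> (\<eta> * l) * I r"
      "\<bar>I r * \<psi> r / c\<bar> \<le> (\<eta> / c) * I r"
    proof -
      show "\<bar>I r * cos ((varied_angle \<theta> \<psi>) r) - I r * cos (\<theta> r)\<bar> \<le> (\<eta> * l) * I r"
        using order_trans[OF abs_cos_diff_le varied_angle_close[OF \<eta>, of r]] by (simp add: I_def indicator_def)
      show "\<bar>I r * sin ((varied_angle \<theta> \<psi>) r) - I r * sin (\<theta> r)\<bar> \<le> (\<eta> * l) * I r"
        using order_trans[OF abs_sin_diff_le varied_angle_close[OF \<eta>, of r]] by (simp add: I_def indicator_def)
      show "\<bar>I r * \<psi> r / c\<bar> \<le> (\<eta> / c) * I r"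
        using \<eta>[of r] c by (simp add: I_def indicator_def abs_divide divide_right_mono)
    qed
    have f: "cosf r = I r * cos (\<theta> r)" "sinf r = I r * sin (\<theta> r)" "vf r = I r * v r"
      by (simp_all add: cosf sinf vf I_def)
    have "g t = norm (cosf t - I r * cos ((varied_angle \<theta> \<psi>) r), sinf t - I r * sin ((varied_angle \<theta> \<psi>) r), vf t - I r * (v r + \<psi> r) / c)"
      unfolding g_def v1 v2 using True by simp
    also have "\<dots> \<le> \<bar>cosf t - I r * cos ((varied_angle \<theta> \<psi>) r)\<bar> + (\<bar>sinf t - I r * sin ((varied_angle \<theta> \<psi>) r)\<bar> + \<bar>vf t - I r * (v r + \<psi> r) / c\<bar>)"
      by (rule norm_triple_le)
    also have "\<bar>cosf t - I r * cos ((varied_angle \<theta> \<psi>) r)\<bar> \<le> \<bar>cosf r - cosf t\<bar> + (\<eta> * l) * I r"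
      using close(1) unfolding f(1) by linarith
    also have "\<bar>sinf t - I r * sin ((varied_angle \<theta> \<psi>) r)\<bar> \<le> \<bar>sinf r - sinf t\<bar> + (\<eta> * l) * I r"
      using close(2) unfolding f(2) by linarith
    also have "\<bar>vf t - I r * (v r + \<psi> r) / c\<bar> \<le> \<bar>vf r - vf t\<bar> + \<bar>1 - 1 / c\<bar> * \<bar>vf r\<bar> + (\<eta> / c) * I r"
    proof -
      have "vf t - I r * (v r + \<psi> r) / c = (vf t - vf r) + (1 - 1 / c) * vf r - I r * \<psi> r / c"
        unfolding f(3) using c by (simp add: field_simps)
      moreover have "\<bar>(1 - 1 / c) * vf r\<bar> = \<bar>1 - 1 / c\<bar> * \<bar>vf r\<bar>" by (rule abs_mult)
      ultimately show ?thesis using close(3) by linarith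
    qed
    finally show ?thesis unfolding G_def r_def[symmetric] by (simp add: algebra_simps)
  qed (use G0 in \<open>simp add: g_def\<close>)
  have "AE t in lebesgue. g t \<le> G t"
  proof (rule AE_I')
    have "negligible ({0, l, c * l} \<union> N \<union> (\<lambda>t. c * t) ` N)"
      using N negligible_dilation[OF N, of c] by (intro negligible_Un) auto
    then show "{0, l, c * l} \<union> N \<union> (\<lambda>t. c * t) ` N \<in> null_sets lebesgue" by (simp only: negligible_iff_null_sets)
    show "{t \<in> space lebesgue. \<not> g t \<le> G t} \<subseteq> {0, l, c * l} \<union> N \<union> (\<lambda>t. c * t) ` N"
      using bound by (intro subsetI) (metis (mono_tags, lifting) mem_Collect_eq)
  qed
  then have "(LINT t|lebesgue. g t) \<le> (LINT t|lebesgue. G t)"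
  proof (cases "integrable lebesgue g")
    case True
    then show ?thesis by (rule integral_mono_AE[OF _ G1]) fact
  next
    case False
    then show ?thesis using integral_nonneg_AE[of G lebesgue] G0 by (simp add: not_integrable_integral_eq)
  qed
  moreover have "W11_dist (l, q) (c * l, q1) = (LINT t|lebesgue. g t)"
  proof -
    have "q1 0 = q 0" by (simp add: q1_def varied_curve_def q varied_angle_ends)
    then show ?thesis unfolding W11_dist_def set_lebesgue_integral_def g_def L_def by simp
  qed
  ultimately show ?thesis unfolding G2 q1_def c1 using c by simp
qed

end

text \<open>A small variation that keeps the end point is an admissible competitor in the given neighbourhood. The
  conclusion is a statement on integrals over a fixed interval.\<close>

lemma local_minimizer_variation:
  assumes loc: "local_minimizer \<xi> q_in q_fin l q v" and l: "l > 0"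
    and q: "\<And>t. q t = (x t, y t, circle_of (\<theta> t))"
    and ac: "abs_continuous_on {0..l} \<theta>" and N: "negligible N"
    and \<theta>': "\<And>t. t \<in> {0..l} \<Longrightarrow> t \<notin> N \<Longrightarrow> (\<theta> has_real_derivative v t) (at t within {0..l})"
    and x': "\<And>t. t \<in> {0..l} \<Longrightarrow> (x has_real_derivative cos (\<theta> t)) (at t within {0..l})"
    and y': "\<And>t. t \<in> {0..l} \<Longrightarrow> (y has_real_derivative sin (\<theta> t)) (at t within {0..l})"
  shows "\<exists>\<delta>>0. \<forall>c \<psi>. \<bar>c - 1\<bar> \<le> \<delta> \<longrightarrow> continuous_on UNIV \<psi> \<longrightarrow> integral {0..l} \<psi> = 0 \<longrightarrow>
    (\<forall>t\<in>{0..l}. \<bar>\<psi> t\<bar> \<le> \<delta>) \<longrightarrow>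
    c * integral {0..l} (\<lambda>t. cos (varied_angle \<theta> \<psi> t)) = integral {0..l} (\<lambda>t. cos (\<theta> t)) \<longrightarrow>
    c * integral {0..l} (\<lambda>t. sin (varied_angle \<theta> \<psi> t)) = integral {0..l} (\<lambda>t. sin (\<theta> t)) \<longrightarrow>
    integral {0..l} (\<lambda>t. sqrt (\<xi>\<^sup>2 + (v t)\<^sup>2)) \<le> integral {0..l} (\<lambda>t. sqrt ((\<xi> * c)\<^sup>2 + (v t + \<psi> t)\<^sup>2))"
proof -
  have adm: "admissible q_in q_fin l q v" using loc unfolding local_minimizer_def by blast
  then have v: "set_integrable lebesgue {0..l} v" and q0: "q 0 = q_in" "q l = q_fin"
    unfolding admissible_def by auto
  obtain B where B: "W11_open B" "(l, q) \<in> B"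
    and least: "\<forall>l' q' v'. admissible q_in q_fin l' q' v' \<and> (l', q') \<in> B \<longrightarrow> cost \<xi> l v \<le> cost \<xi> l' v'"
    using loc unfolding local_minimizer_def by blast
  obtain r where r: "r > 0" and inB: "\<forall>c'\<in>W11. W11_dist (l, q) c' < r \<longrightarrow> c' \<in> B"
    using B unfolding W11_open_def by blast
  have cont\<theta>: "continuous_on {0..l} \<theta>" by (rule abs_continuous_on_imp_continuous_on[OF ac])
  define cosf where "cosf = (\<lambda>t. indicator {0..l} t * cos (\<theta> t))"
  define sinf where "sinf = (\<lambda>t. indicator {0..l} t * sin (\<theta> t))"
  define vf where "vf = (\<lambda>t. indicator {0..l} t * v t)"
  have cosi: "integrable lebesgue cosf"
    using absolutely_integrable_continuous_real[OF continuous_on_cos[OF cont\<theta>]]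
    unfolding set_integrable_def cosf_def by simp
  have sini: "integrable lebesgue sinf"
    using absolutely_integrable_continuous_real[OF continuous_on_sin[OF cont\<theta>]]
    unfolding set_integrable_def sinf_def by simp
  have vi: "integrable lebesgue vf" using v unfolding set_integrable_def vf_def by simp
  define V where "V = (LINT t|lebesgue. \<bar>vf t\<bar>)"
  have V: "V \<ge> 0" unfolding V_def by (rule integral_nonneg_AE) simp
  define E where "E c = (LINT t|lebesgue. \<bar>cosf (t / c) - cosf t\<bar>) + (LINT t|lebesgue. \<bar>sinf (t / c) - sinf t\<bar>)
    + (LINT t|lebesgue. \<bar>vf (t / c) - vf t\<bar>)" for c
  have "(E \<longlongrightarrow> 0 + 0 + 0) (at 1)"
    unfolding E_def using l
    by (intro tendsto_add dilation_continuous_L1[of _ l] cosi sini vi) (simp_all add: cosf_def sinf_def vf_def)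
  then have "eventually (\<lambda>c. E c < r / 2) (at 1)" using r by (intro order_tendstoD(2)) auto
  then obtain \<delta>1 where \<delta>1: "\<delta>1 > 0" and E1: "\<forall>c. c \<noteq> 1 \<and> dist c 1 < \<delta>1 \<longrightarrow> E c < r / 2"
    unfolding eventually_at by auto
  have E: "E c < r / 2" if "\<bar>c - 1\<bar> < \<delta>1" for c
    using E1 that r by (cases "c = 1") (simp_all add: E_def dist_real_def)
  define A where "A = 4 * l * l + V + l + 1"
  have A: "A > 0" using l V by (simp add: A_def add_nonneg_pos)
  define \<delta> where "\<delta> = min (1 / 2) (min (\<delta>1 / 2) (r / (2 * A)))"
  have \<delta>: "\<delta> > 0" using \<delta>1 r A by (simp add: \<delta>_def)
  have \<delta>_le: "\<delta> \<le> 1 / 2" "\<delta> < \<delta>1" "\<delta> \<le> r / (2 * A)" using \<delta>1 by (auto simp: \<delta>_def min_def)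
  have ftc: "integral {0..l} (\<lambda>t. cos (\<theta> t)) = x l - x 0" "integral {0..l} (\<lambda>t. sin (\<theta> t)) = y l - y 0"
  proof -
    have "((\<lambda>t. cos (\<theta> t)) has_integral x l - x 0) {0..l}"
      by (rule fundamental_theorem_of_calculus) (use l x' in \<open>simp_all add: has_real_derivative_iff_has_vector_derivative\<close>)
    then show "integral {0..l} (\<lambda>t. cos (\<theta> t)) = x l - x 0" by (rule integral_unique)
    have "((\<lambda>t. sin (\<theta> t)) has_integral y l - y 0) {0..l}"
      by (rule fundamental_theorem_of_calculus) (use l y' in \<open>simp_all add: has_real_derivative_iff_has_vector_derivative\<close>)
    then show "integral {0..l} (\<lambda>t. sin (\<theta> t)) = y l - y 0" by (rule integral_unique)
  qed
  show ?thesis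
  proof (intro exI[of _ \<delta>] conjI allI impI)
    fix c \<psi>
    assume c: "\<bar>c - 1\<bar> \<le> \<delta>" and \<psi>: "continuous_on UNIV \<psi>" "integral {0..l} \<psi> = 0" and small: "\<forall>t\<in>{0..l}. \<bar>\<psi> t\<bar> \<le> \<delta>"
      and e1: "c * integral {0..l} (\<lambda>t. cos (varied_angle \<theta> \<psi> t)) = integral {0..l} (\<lambda>t. cos (\<theta> t))"
      and e2: "c * integral {0..l} (\<lambda>t. sin (varied_angle \<theta> \<psi> t)) = integral {0..l} (\<lambda>t. sin (\<theta> t))"
    have c0: "c > 0" "c \<le> 2" using c \<delta>_le(1) by (auto simp: abs_le_iff)
    define q1 where "q1 = varied_curve c (varied_angle \<theta> \<psi>) (x 0) (y 0)"
    define v1 where "v1 s = (v (s / c) + \<psi> (s / c)) / c" for s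
    have adm1: "admissible q_in q_fin (c * l) q1 v1"
      using varied_curve_admissible[OF l ac N \<theta>' v \<psi> c0(1), of "x 0" "y 0"]
      unfolding e1 e2 ftc q1_def v1_def q0[symmetric] q by simp
    have "W11_dist (l, q) (c * l, q1) \<le> E c + (2 * \<delta> * l) * (c * l) + \<bar>c - 1\<bar> * V + \<delta> * l"
      unfolding q1_def E_def V_def
      by (rule varied_curve_W11_dist[OF l ac N \<theta>' v \<psi> c0(1) small[rule_format] q x' y' cosf_def cosi sinf_def sini vf_def vi])
    also have "\<dots> < r / 2 + \<delta> * A"
    proof -
      have "(2 * \<delta> * l) * (c * l) \<le> (2 * \<delta> * l) * (2 * l)"
        using c0 \<delta> l by (intro mult_left_mono mult_right_mono) auto
      moreover have "\<bar>c - 1\<bar> * V \<le> \<delta> * V" using c V by (rule mult_right_mono)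
      moreover have "\<delta> * A = (2 * \<delta> * l) * (2 * l) + \<delta> * V + \<delta> * l + \<delta>"
        by (simp add: A_def algebra_simps)
      moreover have "E c < r / 2" using c \<delta>_le(2) by (intro E) simp
      ultimately show ?thesis using \<delta> by linarith
    qed
    also have "\<dots> \<le> r"
    proof -
      have "\<delta> * A \<le> r / (2 * A) * A" using \<delta>_le(3) A by (intro mult_right_mono) auto
      also have "\<dots> = r / 2" using A by simp
      finally show ?thesis by simp
    qed
    finally have "W11_dist (l, q) (c * l, q1) < r" .
    moreover have "(c * l, q1) \<in> W11" using adm1 unfolding W11_def admissible_def by simp
    ultimately have "(c * l, q1) \<in> B" using inB by blast
    then have "cost \<xi> l v \<le> cost \<xi> (c * l) v1" using least adm1 by blast
    also have "cost \<xi> (c * l) v1 = integral {0..l} (\<lambda>t. sqrt ((\<xi> * c)\<^sup>2 + (v t + \<psi> t)\<^sup>2))"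
      unfolding v1_def by (rule varied_curve_cost[OF l ac N \<theta>' v \<psi> c0(1)])
    finally show "integral {0..l} (\<lambda>t. sqrt (\<xi>\<^sup>2 + (v t)\<^sup>2)) \<le> integral {0..l} (\<lambda>t. sqrt ((\<xi> * c)\<^sup>2 + (v t + \<psi> t)\<^sup>2))"
      unfolding cost_eq_integral[OF v] .
  qed (rule \<delta>)
qed

section \<open>The multiplier rule\<close>

lemma cos_first_order: "\<bar>cos (a + b) - cos a + b * sin a\<bar> \<le> b\<^sup>2" for a b :: real
proof -
  let ?f = "\<lambda>s. cos (a + s) + s * sin a"
  have "norm (?f b - ?f 0) \<le> \<bar>b\<bar> * norm (b - 0)"
  proof (rule field_differentiable_bound[of "{- \<bar>b\<bar>..\<bar>b\<bar>}" ?f "\<lambda>s. - sin (a + s) + sin a"])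
    fix s assume s: "s \<in> {- \<bar>b\<bar>..\<bar>b\<bar>}"
    show "(?f has_field_derivative - sin (a + s) + sin a) (at s within {- \<bar>b\<bar>..\<bar>b\<bar>})"
      by (auto intro!: derivative_eq_intros)
    have "\<bar>sin a - sin (a + s)\<bar> \<le> \<bar>a - (a + s)\<bar>" by (rule abs_sin_diff_le)
    also have "\<dots> \<le> \<bar>b\<bar>" using s by (simp add: abs_le_iff)
    finally show "norm (- sin (a + s) + sin a) \<le> \<bar>b\<bar>" by simp
  qed auto
  then show ?thesis by (simp add: power2_eq_square flip: abs_mult)
qed

lemma sin_first_order: "\<bar>sin (a + b) - sin a - b * cos a\<bar> \<le> b\<^sup>2" for a b :: real
  using cos_first_order[of "a - pi / 2" b] by (simp add: cos_diff sin_diff cos_add sin_add algebra_simps)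

text \<open>With \<open>n2\<close> the perturbed value, the upper bound is \<open>2 n n2 \<le> n\<^sup>2 + n2\<^sup>2\<close> and the lower bound is the
  Cauchy-Schwarz inequality.\<close>

lemma lagrangian_first_order:
  fixes \<xi> v \<sigma> z :: real
  assumes \<xi>: "\<xi> > 0"
  defines "n \<equiv> sqrt (\<xi>\<^sup>2 + v\<^sup>2)"
  shows "\<bar>sqrt ((\<xi> * (1 + \<sigma>))\<^sup>2 + (v + z)\<^sup>2) - n - (\<sigma> * \<xi> * (\<xi> / n) + v / n * z)\<bar> \<le> (\<xi>\<^sup>2 * \<sigma>\<^sup>2 + z\<^sup>2) / \<xi>"
proof -
  define n2 where "n2 = sqrt ((\<xi> * (1 + \<sigma>))\<^sup>2 + (v + z)\<^sup>2)"
  define L where "L = \<xi>\<^sup>2 * \<sigma> + v * z"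
  define Q where "Q = \<xi>\<^sup>2 * \<sigma>\<^sup>2 + z\<^sup>2"
  have Q: "Q \<ge> 0" by (simp add: Q_def)
  have n: "n \<ge> \<xi>" "n\<^sup>2 = \<xi>\<^sup>2 + v\<^sup>2" unfolding n_def using \<xi> by (auto intro: real_le_rsqrt)
  have n0: "n > 0" using n \<xi> by simp
  have n2: "n2 \<ge> 0" "n2\<^sup>2 = n\<^sup>2 + 2 * L + Q"
  proof -
    show "n2 \<ge> 0" by (simp add: n2_def)
    have "n2\<^sup>2 = (\<xi> * (1 + \<sigma>))\<^sup>2 + (v + z)\<^sup>2" by (simp add: n2_def)
    then show "n2\<^sup>2 = n\<^sup>2 + 2 * L + Q"
      unfolding n(2) L_def Q_def by (simp add: power2_eq_square algebra_simps)
  qed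
  have "(n\<^sup>2 + L)\<^sup>2 \<le> (n2 * n)\<^sup>2"
  proof -
    have "(n2 * n)\<^sup>2 - (n\<^sup>2 + L)\<^sup>2 = n\<^sup>2 * Q - L\<^sup>2"
      unfolding power_mult_distrib n2(2) by (simp add: power2_eq_square algebra_simps)
    also have "\<dots> = (\<xi> * z - \<xi> * \<sigma> * v)\<^sup>2"
      unfolding n(2) L_def Q_def by (simp add: power2_eq_square algebra_simps)
    finally have "(n2 * n)\<^sup>2 - (n\<^sup>2 + L)\<^sup>2 \<ge> 0" by simp
    then show ?thesis by linarith
  qed
  then have "n\<^sup>2 + L \<le> n2 * n" by (rule power2_le_imp_le) (use n2 n0 in simp)
  then have lower: "n + L / n \<le> n2" using n0 by (simp add: field_simps power2_eq_square)
  have "0 \<le> (n2 - n)\<^sup>2" by simp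
  then have "2 * n * n2 \<le> n2\<^sup>2 + n\<^sup>2" by (simp add: power2_eq_square algebra_simps)
  then have "2 * n * n2 \<le> 2 * n * n + 2 * L + Q" unfolding n2(2) by (simp add: power2_eq_square)
  then have upper: "n2 \<le> n + L / n + Q / (2 * n)" using n0 by (simp add: field_simps)
  have "Q / (2 * n) \<le> Q / \<xi>" using n n0 \<xi> Q by (intro divide_left_mono) auto
  moreover have "\<sigma> * \<xi> * (\<xi> / n) + v / n * z = L / n"
    by (simp add: L_def power2_eq_square add_divide_distrib mult_ac)
  ultimately show ?thesis using lower upper unfolding n2_def[symmetric] Q_def[symmetric]
    by (simp add: abs_le_iff)
qed

lemma sqrt_sum_squares_lipschitz:
  "\<bar>sqrt (a\<^sup>2 + b\<^sup>2) - sqrt (c\<^sup>2 + d\<^sup>2)\<bar> \<le> \<bar>a - c\<bar> + \<bar>b - d\<bar>" for a b c d :: real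
proof -
  have "\<bar>norm (a, b) - norm (c, d)\<bar> \<le> norm ((a, b) - (c, d))" by (rule norm_triangle_ineq3)
  also have "\<dots> \<le> norm (a - c) + norm (b - d)" using norm_Pair_le[of "a - c" "b - d"] by simp
  finally show ?thesis by (simp add: norm_Pair)
qed

lemma integral_abs_le:
  fixes f :: "real \<Rightarrow> real"
  assumes "f integrable_on {0..l}" "\<And>t. t \<in> {0..l} \<Longrightarrow> \<bar>f t\<bar> \<le> B" "0 \<le> l"
  shows "\<bar>integral {0..l} f\<bar> \<le> B * l"
proof -
  have "norm (integral {0..l} f) \<le> integral {0..l} (\<lambda>_. B)"
    by (rule integral_norm_bound_integral) (use assms in auto)
  then show ?thesis using assms(3) by (simp add: mult.commute)
qed

context
  fixes l \<xi> :: real and \<theta> v :: "real \<Rightarrow> real"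
  assumes l: "l > 0" and \<xi>: "\<xi> > 0" and cont\<theta>: "continuous_on {0..l} \<theta>"
    and v: "set_integrable lebesgue {0..l} v"
begin

text \<open>The parameter \<open>\<sigma>\<close> is the relative change of length: the homothety has ratio \<open>1 + \<sigma>\<close>.\<close>

definition endpoint_and_cost :: "real \<Rightarrow> (real \<Rightarrow> real) \<Rightarrow> real \<times> real \<times> real" where
  "endpoint_and_cost \<sigma> \<psi> =
    ((1 + \<sigma>) * integral {0..l} (\<lambda>t. cos (varied_angle \<theta> \<psi> t)),
     (1 + \<sigma>) * integral {0..l} (\<lambda>t. sin (varied_angle \<theta> \<psi> t)),
     integral {0..l} (\<lambda>t. sqrt ((\<xi> * (1 + \<sigma>))\<^sup>2 + (v t + \<psi> t)\<^sup>2)))"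

definition first_variation :: "real \<Rightarrow> (real \<Rightarrow> real) \<Rightarrow> real \<times> real \<times> real" where
  "first_variation \<sigma> \<psi> =
    (\<sigma> * integral {0..l} (\<lambda>t. cos (\<theta> t)) - integral {0..l} (\<lambda>t. integral {0..t} \<psi> * sin (\<theta> t)),
     \<sigma> * integral {0..l} (\<lambda>t. sin (\<theta> t)) + integral {0..l} (\<lambda>t. integral {0..t} \<psi> * cos (\<theta> t)),
     \<sigma> * \<xi> * integral {0..l} (\<lambda>t. \<xi> / sqrt (\<xi>\<^sup>2 + (v t)\<^sup>2)) + integral {0..l} (\<lambda>t. v t / sqrt (\<xi>\<^sup>2 + (v t)\<^sup>2) * \<psi> t))"

lemma cost_density_pos: "sqrt (\<xi>\<^sup>2 + z\<^sup>2) > 0"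
  using \<xi> by (simp add: sum_power2_gt_zero_iff)

lemma control_measurable: "v \<in> borel_measurable (lebesgue_on {0..l})"
proof -
  have "integrable (lebesgue_on {0..l}) v"
    using v unfolding set_integrable_def by (subst integrable_restrict_space) auto
  then show ?thesis by auto
qed

lemma momentum_measurable: "(\<lambda>t. v t / sqrt (\<xi>\<^sup>2 + (v t)\<^sup>2)) \<in> borel_measurable (lebesgue_on {0..l})"
  using control_measurable by measurable

lemma momentum_bounded: "\<bar>v t / sqrt (\<xi>\<^sup>2 + (v t)\<^sup>2)\<bar> \<le> 1"
proof -
  have "\<bar>v t\<bar> \<le> sqrt (\<xi>\<^sup>2 + (v t)\<^sup>2)" by (rule real_le_rsqrt) simp
  then show ?thesis using cost_density_pos[of "v t"] by (simp add: abs_divide)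
qed

lemma momentum_product_integrable:
  assumes "continuous_on UNIV \<psi>"
  shows "(\<lambda>t. v t / sqrt (\<xi>\<^sup>2 + (v t)\<^sup>2) * \<psi> t) integrable_on {0..l}"
proof -
  have "(\<lambda>t. v t / sqrt (\<xi>\<^sup>2 + (v t)\<^sup>2) * \<psi> t) absolutely_integrable_on {0..l}"
  proof (rule absolutely_integrable_bounded_measurable_product_real[OF momentum_measurable])
    show "bounded ((\<lambda>t. v t / sqrt (\<xi>\<^sup>2 + (v t)\<^sup>2)) ` {0..l})"
      unfolding bounded_iff using momentum_bounded by (intro exI[of _ 1]) auto
    show "\<psi> absolutely_integrable_on {0..l}"
      by (rule absolutely_integrable_continuous_real[OF continuous_on_subset[OF assms]]) simp
  qed simp
  then show ?thesis by (rule set_lebesgue_integral_eq_integral(1))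
qed

lemma slack_integrable: "(\<lambda>t. \<xi> / sqrt (\<xi>\<^sup>2 + (v t)\<^sup>2)) integrable_on {0..l}"
proof -
  have "(\<lambda>t. \<xi> / sqrt (\<xi>\<^sup>2 + (v t)\<^sup>2) * 1) absolutely_integrable_on {0..l}"
  proof (rule absolutely_integrable_bounded_measurable_product_real)
    show "(\<lambda>t. \<xi> / sqrt (\<xi>\<^sup>2 + (v t)\<^sup>2)) \<in> borel_measurable (lebesgue_on {0..l})"
      using control_measurable by measurable
    have "\<bar>\<xi> / sqrt (\<xi>\<^sup>2 + (v t)\<^sup>2)\<bar> \<le> 1" for t
    proof -
      have "\<bar>\<xi>\<bar> \<le> sqrt (\<xi>\<^sup>2 + (v t)\<^sup>2)" by (rule real_le_rsqrt) simp
      then show ?thesis using cost_density_pos[of "v t"] by (simp add: abs_divide)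
    qed
    then show "bounded ((\<lambda>t. \<xi> / sqrt (\<xi>\<^sup>2 + (v t)\<^sup>2)) ` {0..l})"
      unfolding bounded_iff by (intro exI[of _ 1]) auto
    show "(\<lambda>_. 1::real) absolutely_integrable_on {0..l}"
      by (rule absolutely_integrable_continuous_real) simp
  qed simp
  then show ?thesis by (simp add: set_lebesgue_integral_eq_integral(1))
qed

lemma varied_cost_integrable:
  assumes "continuous_on UNIV \<psi>"
  shows "(\<lambda>t. sqrt ((\<xi> * (1 + \<sigma>))\<^sup>2 + (v t + \<psi> t)\<^sup>2)) integrable_on {0..l}"
proof -
  have "set_integrable lebesgue {0..l} (\<lambda>t. v t + \<psi> t)"
    by (rule set_integral_add(1)[OF v])
      (rule absolutely_integrable_continuous_real[OF continuous_on_subset[OF assms]], simp)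
  from set_integrable_cost[OF this] show ?thesis by (rule set_lebesgue_integral_eq_integral(1))
qed

lemma primitive_continuous:
  fixes \<psi> :: "real \<Rightarrow> real"
  assumes "continuous_on UNIV \<psi>"
  shows "continuous_on {0..l} (\<lambda>t. integral {0..t} \<psi>)"
  by (rule indefinite_integral_continuous_1[OF integrable_continuous_interval[OF continuous_on_subset[OF assms]]]) simp

lemma primitive_bound:
  fixes \<psi> :: "real \<Rightarrow> real"
  assumes \<psi>: "continuous_on UNIV \<psi>" and m: "\<And>t. t \<in> {0..l} \<Longrightarrow> \<bar>\<psi> t\<bar> \<le> m" and t: "t \<in> {0..l}"
  shows "\<bar>integral {0..t} \<psi>\<bar> \<le> m * l"
proof -
  have "\<bar>integral {0..t} \<psi>\<bar> \<le> m * t"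
    by (rule integral_abs_le[OF integrable_continuous_interval[OF continuous_on_subset[OF \<psi>]]])
      (use m t in auto)
  also have "\<dots> \<le> m * l" using t order_trans[OF abs_ge_zero m[OF t]] by (intro mult_left_mono) auto
  finally show ?thesis .
qed

lemma varied_angle_continuous:
  assumes "continuous_on UNIV \<psi>"
  shows "continuous_on {0..l} (varied_angle \<theta> \<psi>)"
  unfolding varied_angle_def by (intro continuous_on_add cont\<theta> primitive_continuous assms)

lemma first_variation_add:
  assumes \<psi>: "continuous_on UNIV \<psi>" and \<omega>: "continuous_on UNIV \<omega>"
  shows "first_variation (\<sigma> + \<tau>) (\<lambda>t. \<psi> t + \<omega> t) = first_variation \<sigma> \<psi> + first_variation \<tau> \<omega>"
proof -
  have prim: "integral {0..t} (\<lambda>t. \<psi> t + \<omega> t) = integral {0..t} \<psi> + integral {0..t} \<omega>" for t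
    by (intro Henstock_Kurzweil_Integration.integral_add integrable_continuous_interval continuous_on_subset[OF \<psi>] continuous_on_subset[OF \<omega>]) auto
  have i: "(\<lambda>t. integral {0..t} \<psi>' * f (\<theta> t)) integrable_on {0..l}"
    if "continuous_on UNIV \<psi>'" "continuous_on UNIV f" for \<psi>' f :: "real \<Rightarrow> real"
    by (intro integrable_continuous_interval continuous_on_mult primitive_continuous that
        continuous_on_compose2[OF that(2) cont\<theta>]) auto
  have cs: "continuous_on UNIV (cos :: real \<Rightarrow> real)" "continuous_on UNIV (sin :: real \<Rightarrow> real)"
    by (intro continuous_intros)+
  show ?thesis
    unfolding first_variation_def prim distrib_left distrib_right
      Henstock_Kurzweil_Integration.integral_add[OF i[OF \<psi> cs(1)] i[OF \<omega> cs(1)]]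
      Henstock_Kurzweil_Integration.integral_add[OF i[OF \<psi> cs(2)] i[OF \<omega> cs(2)]]
      Henstock_Kurzweil_Integration.integral_add[OF momentum_product_integrable[OF \<psi>] momentum_product_integrable[OF \<omega>]]
    by simp
qed

lemma first_variation_scale:
  "first_variation (k * \<sigma>) (\<lambda>t. k * \<psi> t) = k *\<^sub>R first_variation \<sigma> \<psi>"
proof -
  have "integral {0..l} (\<lambda>t. v t / sqrt (\<xi>\<^sup>2 + (v t)\<^sup>2) * (k * \<psi> t))
      = k * integral {0..l} (\<lambda>t. v t / sqrt (\<xi>\<^sup>2 + (v t)\<^sup>2) * \<psi> t)"
    by (subst integral_mult_right[symmetric]) (simp add: mult_ac)
  then show ?thesis by (simp add: first_variation_def mult.assoc right_diff_distrib distrib_left)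
qed

text \<open>A quadratic remainder makes \<open>first_variation\<close> the Frechet derivative of \<open>endpoint_and_cost\<close> along every
  finite-dimensional family of variations.\<close>

lemma endpoint_and_cost_remainder:
  assumes \<psi>: "continuous_on UNIV \<psi>" and m: "\<And>t. t \<in> {0..l} \<Longrightarrow> \<bar>\<psi> t\<bar> \<le> m"
  shows "norm (endpoint_and_cost \<sigma> \<psi> - endpoint_and_cost 0 (\<lambda>_. 0) - first_variation \<sigma> \<psi>)
    \<le> (2 * (l\<^sup>2 + l ^ 3) + l * \<xi> + l / \<xi>) * (\<bar>\<sigma>\<bar> + m)\<^sup>2"
proof -
  have m0: "m \<ge> 0" using order_trans[OF abs_ge_zero m[of 0]] l by simp
  define \<phi> where "\<phi> t = integral {0..t} \<psi>" for t
  have va: "varied_angle \<theta> \<psi> t = \<theta> t + \<phi> t" "varied_angle \<theta> (\<lambda>_. 0) t = \<theta> t" for t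
    by (simp_all add: varied_angle_def \<phi>_def)
  have cont\<phi>: "continuous_on {0..l} \<phi>" unfolding \<phi>_def by (rule primitive_continuous[OF \<psi>])
  have \<phi>: "\<bar>\<phi> t\<bar> \<le> m * l" if "t \<in> {0..l}" for t unfolding \<phi>_def by (rule primitive_bound[OF \<psi> m that])
  have sq: "(\<phi> t)\<^sup>2 \<le> (m * l)\<^sup>2" if "t \<in> {0..l}" for t
    using \<phi>[OF that] abs_le_square_iff[of "\<phi> t" "m * l"] m0 l by simp
  have cint: "f integrable_on {0..l}" if "continuous_on {0..l} f" for f :: "real \<Rightarrow> real"
    using that by (rule integrable_continuous_interval)
  have trig: "\<bar>(1 + \<sigma>) * integral {0..l} (\<lambda>t. f (\<theta> t + \<phi> t)) - integral {0..l} (\<lambda>t. f (\<theta> t))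
      - (\<sigma> * integral {0..l} (\<lambda>t. f (\<theta> t)) + integral {0..l} (\<lambda>t. \<phi> t * f' (\<theta> t)))\<bar> \<le> (l\<^sup>2 + l ^ 3) * (\<bar>\<sigma>\<bar> + m)\<^sup>2"
    if f: "continuous_on UNIV f" "continuous_on UNIV f'" and lip: "\<And>a b. \<bar>f a - f b\<bar> \<le> \<bar>a - b\<bar>"
      and first: "\<And>a b. \<bar>f (a + b) - f a - b * f' a\<bar> \<le> b\<^sup>2" for f f' :: "real \<Rightarrow> real"
  proof -
    have c1: "continuous_on {0..l} (\<lambda>t. f (\<theta> t))" and c2: "continuous_on {0..l} (\<lambda>t. f (\<theta> t + \<phi> t))"
      and c3: "continuous_on {0..l} (\<lambda>t. \<phi> t * f' (\<theta> t))"
      using continuous_on_compose2[OF f(1) cont\<theta>] continuous_on_compose2[OF f(1) continuous_on_add[OF cont\<theta> cont\<phi>]]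
        continuous_on_mult[OF cont\<phi> continuous_on_compose2[OF f(2) cont\<theta>]] by auto
    define D where "D = integral {0..l} (\<lambda>t. f (\<theta> t + \<phi> t) - f (\<theta> t))"
    define R where "R = integral {0..l} (\<lambda>t. f (\<theta> t + \<phi> t) - f (\<theta> t) - \<phi> t * f' (\<theta> t))"
    have D: "D = integral {0..l} (\<lambda>t. f (\<theta> t + \<phi> t)) - integral {0..l} (\<lambda>t. f (\<theta> t))"
      unfolding D_def by (rule Henstock_Kurzweil_Integration.integral_diff[OF cint[OF c2] cint[OF c1]])
    have R: "R = D - integral {0..l} (\<lambda>t. \<phi> t * f' (\<theta> t))"
      unfolding D_def R_def
      by (rule Henstock_Kurzweil_Integration.integral_diff[OF cint[OF continuous_on_diff[OF c2 c1]] cint[OF c3]])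
    have "\<bar>D\<bar> \<le> (m * l) * l" unfolding D_def
    proof (rule integral_abs_le[OF cint[OF continuous_on_diff[OF c2 c1]]])
      fix t assume "t \<in> {0..l}"
      then show "\<bar>f (\<theta> t + \<phi> t) - f (\<theta> t)\<bar> \<le> m * l"
        using lip[of "\<theta> t + \<phi> t" "\<theta> t"] \<phi>[of t] by simp
    qed (use l in simp)
    then have b1: "\<bar>\<sigma> * D\<bar> \<le> \<bar>\<sigma>\<bar> * ((m * l) * l)" unfolding abs_mult by (rule mult_left_mono) simp
    have b2: "\<bar>R\<bar> \<le> (m * l)\<^sup>2 * l" unfolding R_def
    proof (rule integral_abs_le[OF cint[OF continuous_on_diff[OF continuous_on_diff[OF c2 c1] c3]]])
      fix t assume "t \<in> {0..l}"
      then show "\<bar>f (\<theta> t + \<phi> t) - f (\<theta> t) - \<phi> t * f' (\<theta> t)\<bar> \<le> (m * l)\<^sup>2"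
        by (rule order_trans[OF first sq])
    qed (use l in simp)
    have "(1 + \<sigma>) * integral {0..l} (\<lambda>t. f (\<theta> t + \<phi> t)) - integral {0..l} (\<lambda>t. f (\<theta> t))
      - (\<sigma> * integral {0..l} (\<lambda>t. f (\<theta> t)) + integral {0..l} (\<lambda>t. \<phi> t * f' (\<theta> t))) = \<sigma> * D + R"
      unfolding R unfolding D by (simp add: algebra_simps)
    also have "\<bar>\<dots>\<bar> \<le> \<bar>\<sigma>\<bar> * ((m * l) * l) + (m * l)\<^sup>2 * l" using b1 b2 by linarith
    also have "\<dots> = l\<^sup>2 * (\<bar>\<sigma>\<bar> * m) + l ^ 3 * m\<^sup>2" by (simp add: power2_eq_square power3_eq_cube)
    also have "\<dots> \<le> l\<^sup>2 * (\<bar>\<sigma>\<bar> + m)\<^sup>2 + l ^ 3 * (\<bar>\<sigma>\<bar> + m)\<^sup>2"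
    proof (intro add_mono mult_left_mono)
      show "\<bar>\<sigma>\<bar> * m \<le> (\<bar>\<sigma>\<bar> + m)\<^sup>2"
        unfolding power2_eq_square using m0 by (intro mult_mono) auto
      show "m\<^sup>2 \<le> (\<bar>\<sigma>\<bar> + m)\<^sup>2" using m0 by (intro power_mono) auto
    qed (use l in auto)
    finally show ?thesis by (simp only: distrib_right)
  qed
  have cs: "continuous_on UNIV (cos :: real \<Rightarrow> real)" "continuous_on UNIV (sin :: real \<Rightarrow> real)"
    "continuous_on UNIV (\<lambda>t. - sin t :: real)"
    by (intro continuous_intros)+
  have t1: "\<bar>(1 + \<sigma>) * integral {0..l} (\<lambda>t. cos (\<theta> t + \<phi> t)) - integral {0..l} (\<lambda>t. cos (\<theta> t))
      - (\<sigma> * integral {0..l} (\<lambda>t. cos (\<theta> t)) - integral {0..l} (\<lambda>t. \<phi> t * sin (\<theta> t)))\<bar> \<le> (l\<^sup>2 + l ^ 3) * (\<bar>\<sigma>\<bar> + m)\<^sup>2"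
    using trig[OF cs(1,3) abs_cos_diff_le] cos_first_order by simp
  have t2: "\<bar>(1 + \<sigma>) * integral {0..l} (\<lambda>t. sin (\<theta> t + \<phi> t)) - integral {0..l} (\<lambda>t. sin (\<theta> t))
      - (\<sigma> * integral {0..l} (\<lambda>t. sin (\<theta> t)) + integral {0..l} (\<lambda>t. \<phi> t * cos (\<theta> t)))\<bar> \<le> (l\<^sup>2 + l ^ 3) * (\<bar>\<sigma>\<bar> + m)\<^sup>2"
    by (rule trig[OF cs(2,1) abs_sin_diff_le sin_first_order])
  define n where "n t = sqrt (\<xi>\<^sup>2 + (v t)\<^sup>2)" for t
  define J where "J t = sqrt ((\<xi> * (1 + \<sigma>))\<^sup>2 + (v t + \<psi> t)\<^sup>2)" for t
  have iJ: "J integrable_on {0..l}" unfolding J_def by (rule varied_cost_integrable[OF \<psi>])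
  have i_n: "n integrable_on {0..l}"
    unfolding n_def using varied_cost_integrable[of "\<lambda>_. 0" 0] by simp
  have i_s: "(\<lambda>t. \<sigma> * \<xi> * (\<xi> / n t)) integrable_on {0..l}"
    unfolding n_def by (rule integrable_on_mult_right[OF slack_integrable])
  have ip: "(\<lambda>t. v t / n t * \<psi> t) integrable_on {0..l}"
    unfolding n_def by (rule momentum_product_integrable[OF \<psi>])
  have "integral {0..l} (\<lambda>t. J t - n t - (\<sigma> * \<xi> * (\<xi> / n t) + v t / n t * \<psi> t))
    = integral {0..l} J - integral {0..l} n - (\<sigma> * \<xi> * integral {0..l} (\<lambda>t. \<xi> / n t) + integral {0..l} (\<lambda>t. v t / n t * \<psi> t))"
    unfolding Henstock_Kurzweil_Integration.integral_diff[OF integrable_diff[OF iJ i_n] integrable_add[OF i_s ip]]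
      Henstock_Kurzweil_Integration.integral_diff[OF iJ i_n] Henstock_Kurzweil_Integration.integral_add[OF i_s ip]
      integral_mult_right ..
  moreover have "\<bar>integral {0..l} (\<lambda>t. J t - n t - (\<sigma> * \<xi> * (\<xi> / n t) + v t / n t * \<psi> t))\<bar> \<le> (l * \<xi> + l / \<xi>) * (\<bar>\<sigma>\<bar> + m)\<^sup>2"
  proof -
    have "\<bar>integral {0..l} (\<lambda>t. J t - n t - (\<sigma> * \<xi> * (\<xi> / n t) + v t / n t * \<psi> t))\<bar> \<le> ((\<xi> + 1 / \<xi>) * (\<bar>\<sigma>\<bar> + m)\<^sup>2) * l"
    proof (rule integral_abs_le[OF integrable_diff[OF integrable_diff[OF iJ i_n] integrable_add[OF i_s ip]]])
      fix t assume t: "t \<in> {0..l}"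
      have "\<bar>J t - n t - (\<sigma> * \<xi> * (\<xi> / n t) + v t / n t * \<psi> t)\<bar> \<le> (\<xi>\<^sup>2 * \<sigma>\<^sup>2 + (\<psi> t)\<^sup>2) / \<xi>"
        unfolding J_def n_def by (rule lagrangian_first_order[OF \<xi>])
      also have "\<dots> = \<xi> * \<bar>\<sigma>\<bar>\<^sup>2 + 1 / \<xi> * \<bar>\<psi> t\<bar>\<^sup>2" using \<xi> by (simp add: add_divide_distrib power2_eq_square)
      also have "\<dots> \<le> \<xi> * (\<bar>\<sigma>\<bar> + m)\<^sup>2 + 1 / \<xi> * (\<bar>\<sigma>\<bar> + m)\<^sup>2"
        using m[OF t] m0 \<xi> by (intro add_mono mult_left_mono power_mono) auto
      finally show "\<bar>J t - n t - (\<sigma> * \<xi> * (\<xi> / n t) + v t / n t * \<psi> t)\<bar> \<le> (\<xi> + 1 / \<xi>) * (\<bar>\<sigma>\<bar> + m)\<^sup>2"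
        by (simp only: distrib_right)
    qed (use l in simp)
    also have "((\<xi> + 1 / \<xi>) * (\<bar>\<sigma>\<bar> + m)\<^sup>2) * l = (l * \<xi> + l / \<xi>) * (\<bar>\<sigma>\<bar> + m)\<^sup>2"
      by (simp add: algebra_simps)
    finally show ?thesis .
  qed
  ultimately have t3: "\<bar>integral {0..l} J - integral {0..l} n - (\<sigma> * \<xi> * integral {0..l} (\<lambda>t. \<xi> / n t) + integral {0..l} (\<lambda>t. v t / n t * \<psi> t))\<bar>
      \<le> (l * \<xi> + l / \<xi>) * (\<bar>\<sigma>\<bar> + m)\<^sup>2" by simp
  have "norm (endpoint_and_cost \<sigma> \<psi> - endpoint_and_cost 0 (\<lambda>_. 0) - first_variation \<sigma> \<psi>)
    \<le> (l\<^sup>2 + l ^ 3) * (\<bar>\<sigma>\<bar> + m)\<^sup>2 + ((l\<^sup>2 + l ^ 3) * (\<bar>\<sigma>\<bar> + m)\<^sup>2 + (l * \<xi> + l / \<xi>) * (\<bar>\<sigma>\<bar> + m)\<^sup>2)"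
    unfolding endpoint_and_cost_def first_variation_def va \<phi>_def[symmetric] n_def[symmetric] J_def[symmetric] diff_Pair
    by (rule order_trans[OF norm_triple_le add_mono[OF _ add_mono]]) (use t1 t2 t3 in \<open>simp_all add: n_def[abs_def]\<close>)
  then show ?thesis by (simp add: algebra_simps)
qed

lemma endpoint_and_cost_lipschitz:
  assumes \<psi>: "continuous_on UNIV \<psi>" and \<omega>: "continuous_on UNIV \<omega>"
    and m: "\<And>t. t \<in> {0..l} \<Longrightarrow> \<bar>\<psi> t - \<omega> t\<bar> \<le> m"
  shows "\<bar>integral {0..l} (\<lambda>t. cos (varied_angle \<theta> \<psi> t)) - integral {0..l} (\<lambda>t. cos (varied_angle \<theta> \<omega> t))\<bar> \<le> (m * l) * l"
    "\<bar>integral {0..l} (\<lambda>t. sin (varied_angle \<theta> \<psi> t)) - integral {0..l} (\<lambda>t. sin (varied_angle \<theta> \<omega> t))\<bar> \<le> (m * l) * l"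
    "\<bar>integral {0..l} (\<lambda>t. sqrt ((\<xi> * (1 + \<sigma>))\<^sup>2 + (v t + \<psi> t)\<^sup>2)) -
      integral {0..l} (\<lambda>t. sqrt ((\<xi> * (1 + \<tau>))\<^sup>2 + (v t + \<omega> t)\<^sup>2))\<bar> \<le> (\<xi> * \<bar>\<sigma> - \<tau>\<bar> + m) * l"
proof -
  have close: "\<bar>varied_angle \<theta> \<psi> t - varied_angle \<theta> \<omega> t\<bar> \<le> m * l" if t: "t \<in> {0..l}" for t
  proof -
    have "integral {0..t} \<psi> - integral {0..t} \<omega> = integral {0..t} (\<lambda>t. \<psi> t - \<omega> t)"
      by (rule Henstock_Kurzweil_Integration.integral_diff[symmetric])
        (auto intro!: integrable_continuous_interval continuous_on_subset[OF \<psi>] continuous_on_subset[OF \<omega>])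
    then show ?thesis
      using primitive_bound[OF continuous_on_diff[OF \<psi> \<omega>] m t] by (simp add: varied_angle_def)
  qed
  have trig: "\<bar>integral {0..l} (\<lambda>t. f (varied_angle \<theta> \<psi> t)) - integral {0..l} (\<lambda>t. f (varied_angle \<theta> \<omega> t))\<bar> \<le> (m * l) * l"
    if f: "continuous_on UNIV f" and lip: "\<And>a b. \<bar>f a - f b\<bar> \<le> \<bar>a - b\<bar>" for f :: "real \<Rightarrow> real"
  proof -
    have c: "continuous_on {0..l} (\<lambda>t. f (varied_angle \<theta> \<psi>' t))" if "continuous_on UNIV \<psi>'" for \<psi>'
      by (rule continuous_on_compose2[OF f varied_angle_continuous[OF that]]) simp
    have "integral {0..l} (\<lambda>t. f (varied_angle \<theta> \<psi> t)) - integral {0..l} (\<lambda>t. f (varied_angle \<theta> \<omega> t))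
       = integral {0..l} (\<lambda>t. f (varied_angle \<theta> \<psi> t) - f (varied_angle \<theta> \<omega> t))"
      by (rule Henstock_Kurzweil_Integration.integral_diff[symmetric, OF integrable_continuous_interval[OF c[OF \<psi>]] integrable_continuous_interval[OF c[OF \<omega>]]])
    also have "\<bar>\<dots>\<bar> \<le> (m * l) * l"
      by (rule integral_abs_le[OF integrable_continuous_interval[OF continuous_on_diff[OF c[OF \<psi>] c[OF \<omega>]]] order_trans[OF lip close]])
        (use l in auto)
    finally show ?thesis .
  qed
  show "\<bar>integral {0..l} (\<lambda>t. cos (varied_angle \<theta> \<psi> t)) - integral {0..l} (\<lambda>t. cos (varied_angle \<theta> \<omega> t))\<bar> \<le> (m * l) * l"
    by (rule trig[OF continuous_on_cos[OF continuous_on_id] abs_cos_diff_le])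
  show "\<bar>integral {0..l} (\<lambda>t. sin (varied_angle \<theta> \<psi> t)) - integral {0..l} (\<lambda>t. sin (varied_angle \<theta> \<omega> t))\<bar> \<le> (m * l) * l"
    by (rule trig[OF continuous_on_sin[OF continuous_on_id] abs_sin_diff_le])
  let ?J = "\<lambda>\<sigma> \<psi> t. sqrt ((\<xi> * (1 + \<sigma>))\<^sup>2 + (v t + \<psi> t)\<^sup>2)"
  note iJ = varied_cost_integrable[OF \<psi>, of \<sigma>] varied_cost_integrable[OF \<omega>, of \<tau>]
  have "integral {0..l} (?J \<sigma> \<psi>) - integral {0..l} (?J \<tau> \<omega>) = integral {0..l} (\<lambda>t. ?J \<sigma> \<psi> t - ?J \<tau> \<omega> t)"
    by (rule Henstock_Kurzweil_Integration.integral_diff[symmetric, OF iJ])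
  also have "\<bar>\<dots>\<bar> \<le> (\<xi> * \<bar>\<sigma> - \<tau>\<bar> + m) * l"
  proof (rule integral_abs_le[OF integrable_diff[OF iJ]])
    fix t assume t: "t \<in> {0..l}"
    have "\<bar>?J \<sigma> \<psi> t - ?J \<tau> \<omega> t\<bar> \<le> \<bar>\<xi> * (1 + \<sigma>) - \<xi> * (1 + \<tau>)\<bar> + \<bar>(v t + \<psi> t) - (v t + \<omega> t)\<bar>"
      by (rule sqrt_sum_squares_lipschitz)
    also have "\<xi> * (1 + \<sigma>) - \<xi> * (1 + \<tau>) = \<xi> * (\<sigma> - \<tau>)" by (simp add: algebra_simps)
    also have "\<bar>\<xi> * (\<sigma> - \<tau>)\<bar> = \<xi> * \<bar>\<sigma> - \<tau>\<bar>" using \<xi> by (simp add: abs_mult)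
    finally show "\<bar>?J \<sigma> \<psi> t - ?J \<tau> \<omega> t\<bar> \<le> \<xi> * \<bar>\<sigma> - \<tau>\<bar> + m" using m[OF t] by simp
  qed (use l in simp)
  finally show "\<bar>integral {0..l} (?J \<sigma> \<psi>) - integral {0..l} (?J \<tau> \<omega>)\<bar> \<le> (\<xi> * \<bar>\<sigma> - \<tau>\<bar> + m) * l" .
qed

text \<open>If the first variations filled \<open>\<real>\<^sup>3\<close>, three of them could be chosen equal to the unit vectors. The
  corresponding family of variations is a continuous map of \<open>\<real>\<^sup>3\<close> whose derivative at 0 is the identity, so
  by Sussmann's theorem its image contains a neighbourhood of the original value; in particular some small
  variation has the same end point and a smaller cost. Hence the first variations lie in a proper subspace,
  and \<open>a\<close> is normal to it.\<close>

lemma multiplier_rule: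
  assumes min: "\<exists>\<delta>>0. \<forall>c \<psi>. \<bar>c - 1\<bar> \<le> \<delta> \<longrightarrow> continuous_on UNIV \<psi> \<longrightarrow> integral {0..l} \<psi> = 0 \<longrightarrow>
    (\<forall>t\<in>{0..l}. \<bar>\<psi> t\<bar> \<le> \<delta>) \<longrightarrow>
    c * integral {0..l} (\<lambda>t. cos (varied_angle \<theta> \<psi> t)) = integral {0..l} (\<lambda>t. cos (\<theta> t)) \<longrightarrow>
    c * integral {0..l} (\<lambda>t. sin (varied_angle \<theta> \<psi> t)) = integral {0..l} (\<lambda>t. sin (\<theta> t)) \<longrightarrow>
    integral {0..l} (\<lambda>t. sqrt (\<xi>\<^sup>2 + (v t)\<^sup>2)) \<le> integral {0..l} (\<lambda>t. sqrt ((\<xi> * c)\<^sup>2 + (v t + \<psi> t)\<^sup>2))"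
  shows "\<exists>a. a \<noteq> 0 \<and> (\<forall>\<sigma> \<psi>. continuous_on UNIV \<psi> \<longrightarrow> integral {0..l} \<psi> = 0 \<longrightarrow> a \<bullet> first_variation \<sigma> \<psi> = 0)"
proof -
  define W where "W = {first_variation \<sigma> \<psi> | \<sigma> \<psi>. continuous_on UNIV \<psi> \<and> integral {0..l} \<psi> = 0}"
  have WI: "first_variation \<sigma> \<psi> \<in> W" if "continuous_on UNIV \<psi>" "integral {0..l} \<psi> = 0" for \<sigma> \<psi>
    unfolding W_def using that by blast
  have int: "\<psi> integrable_on {0..l}" if "continuous_on UNIV \<psi>" for \<psi> :: "real \<Rightarrow> real"
    by (rule integrable_continuous_interval[OF continuous_on_subset[OF that]]) simp
  have W_add: "x + y \<in> W" if xy: "x \<in> W" "y \<in> W" for x y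
  proof -
    obtain \<sigma> \<psi> \<tau> \<omega> where p: "x = first_variation \<sigma> \<psi>" "continuous_on UNIV \<psi>" "integral {0..l} \<psi> = 0"
      "y = first_variation \<tau> \<omega>" "continuous_on UNIV \<omega>" "integral {0..l} \<omega> = 0"
      using xy unfolding W_def by blast
    have "x + y = first_variation (\<sigma> + \<tau>) (\<lambda>t. \<psi> t + \<omega> t)" using first_variation_add[OF p(2,5)] p by simp
    moreover have "integral {0..l} (\<lambda>t. \<psi> t + \<omega> t) = 0"
      using Henstock_Kurzweil_Integration.integral_add[OF int[OF p(2)] int[OF p(5)]] p(3,6) by simp
    ultimately show ?thesis using WI[OF continuous_on_add[OF p(2,5)]] by simp
  qed
  have W_scale: "k *\<^sub>R x \<in> W" if x: "x \<in> W" for k x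
  proof -
    obtain \<sigma> \<psi> where p: "x = first_variation \<sigma> \<psi>" "continuous_on UNIV \<psi>" "integral {0..l} \<psi> = 0"
      using x unfolding W_def by blast
    have "k *\<^sub>R x = first_variation (k * \<sigma>) (\<lambda>t. k * \<psi> t)" unfolding p(1) by (rule first_variation_scale[symmetric])
    moreover have "integral {0..l} (\<lambda>t. k * \<psi> t) = 0" using p(3) by simp
    ultimately show ?thesis using WI[OF continuous_on_mult_left[OF p(2)]] by simp
  qed
  have W_0: "0 \<in> W"
  proof -
    have "first_variation 0 (\<lambda>_. 0) \<in> W" by (rule WI) simp_all
    then show ?thesis using W_scale[of "first_variation 0 (\<lambda>_. 0)" 0] by simp
  qed
  have "subspace W" unfolding subspace_def using W_add W_scale W_0 by blast
  then have span: "span W = W" by (simp only: span_eq_iff)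
  have "W \<noteq> UNIV"
  proof
    assume full: "W = UNIV"
    then have mem: "(1, 0, 0) \<in> W" "(0, 1, 0) \<in> W" "(0, 0, 1) \<in> W" by auto
    obtain s1 p1 where 1: "first_variation s1 p1 = (1, 0, 0)" "continuous_on UNIV p1" "integral {0..l} p1 = 0"
      using mem(1) unfolding W_def by auto
    obtain s2 p2 where 2: "first_variation s2 p2 = (0, 1, 0)" "continuous_on UNIV p2" "integral {0..l} p2 = 0"
      using mem(2) unfolding W_def by auto
    obtain s3 p3 where 3: "first_variation s3 p3 = (0, 0, 1)" "continuous_on UNIV p3" "integral {0..l} p3 = 0"
      using mem(3) unfolding W_def by auto
    define sg :: "real \<times> real \<times> real \<Rightarrow> real" where "sg \<epsilon> = fst \<epsilon> * s1 + (fst (snd \<epsilon>) * s2 + snd (snd \<epsilon>) * s3)" for \<epsilon>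
    define ps :: "real \<times> real \<times> real \<Rightarrow> real \<Rightarrow> real" where "ps \<epsilon> = (\<lambda>t. fst \<epsilon> * p1 t + (fst (snd \<epsilon>) * p2 t + snd (snd \<epsilon>) * p3 t))" for \<epsilon>
    define \<Phi> where "\<Phi> \<epsilon> = endpoint_and_cost (sg \<epsilon>) (ps \<epsilon>)" for \<epsilon>
    note cm = continuous_on_mult_left[OF 1(2)] continuous_on_mult_left[OF 2(2)] continuous_on_mult_left[OF 3(2)]
    have ps_cont: "continuous_on UNIV (ps \<epsilon>)" for \<epsilon> unfolding ps_def by (intro continuous_on_add cm)
    have ps_int: "integral {0..l} (ps \<epsilon>) = 0" for \<epsilon>
      unfolding ps_def Henstock_Kurzweil_Integration.integral_add[OF int[OF cm(1)] int[OF continuous_on_add[OF cm(2,3)]]]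
        Henstock_Kurzweil_Integration.integral_add[OF int[OF cm(2)] int[OF cm(3)]]
      using 1(3) 2(3) 3(3) by simp
    have fv: "first_variation (sg \<epsilon>) (ps \<epsilon>) = \<epsilon>" for \<epsilon>
      unfolding sg_def ps_def first_variation_add[OF cm(1) continuous_on_add[OF cm(2,3)]] first_variation_add[OF cm(2,3)]
        first_variation_scale 1(1) 2(1) 3(1) by (simp add: prod_eq_iff)
    have bdd: "\<exists>M>0. \<forall>t\<in>{0..l}. \<bar>p t\<bar> \<le> M" if "continuous_on UNIV p" for p :: "real \<Rightarrow> real"
    proof -
      have "compact (p ` {0..l})" by (rule compact_continuous_image[OF continuous_on_subset[OF that]]) auto
      then show ?thesis using compact_imp_bounded[THEN bounded_pos[THEN iffD1]] by force
    qed
    obtain M1 M2 M3 where Mi: "M1 > 0" "\<forall>t\<in>{0..l}. \<bar>p1 t\<bar> \<le> M1" "M2 > 0" "\<forall>t\<in>{0..l}. \<bar>p2 t\<bar> \<le> M2"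
      "M3 > 0" "\<forall>t\<in>{0..l}. \<bar>p3 t\<bar> \<le> M3" using bdd[OF 1(2)] bdd[OF 2(2)] bdd[OF 3(2)] by blast
    define M where "M = M1 + M2 + M3"
    define S where "S = \<bar>s1\<bar> + \<bar>s2\<bar> + \<bar>s3\<bar>"
    have M0: "M > 0" "S \<ge> 0" using Mi by (simp_all add: M_def S_def)
    have comp: "\<bar>fst \<epsilon>\<bar> \<le> norm \<epsilon>" "\<bar>fst (snd \<epsilon>)\<bar> \<le> norm \<epsilon>" "\<bar>snd (snd \<epsilon>)\<bar> \<le> norm \<epsilon>" for \<epsilon> :: "real \<times> real \<times> real"
      using norm_fst_le[of "fst \<epsilon>" "snd \<epsilon>"] norm_snd_le[of "snd \<epsilon>" "fst \<epsilon>"]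
        norm_fst_le[of "fst (snd \<epsilon>)" "snd (snd \<epsilon>)"] norm_snd_le[of "snd (snd \<epsilon>)" "fst (snd \<epsilon>)"] by auto
    have combo: "\<bar>fst \<epsilon> * a + (fst (snd \<epsilon>) * b + snd (snd \<epsilon>) * d)\<bar> \<le> (a' + b' + d') * norm \<epsilon>"
      if "\<bar>a\<bar> \<le> a'" "\<bar>b\<bar> \<le> b'" "\<bar>d\<bar> \<le> d'" for \<epsilon> :: "real \<times> real \<times> real" and a b d a' b' d'
    proof -
      have *: "\<bar>z * w\<bar> \<le> w' * norm \<epsilon>" if "\<bar>z\<bar> \<le> norm \<epsilon>" "\<bar>w\<bar> \<le> w'" for z w w'
        unfolding abs_mult mult.commute[of "\<bar>z\<bar>"] using that by (intro mult_mono) auto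
      have "\<bar>fst \<epsilon> * a\<bar> \<le> a' * norm \<epsilon>" "\<bar>fst (snd \<epsilon>) * b\<bar> \<le> b' * norm \<epsilon>" "\<bar>snd (snd \<epsilon>) * d\<bar> \<le> d' * norm \<epsilon>"
        by (intro * comp that)+
      then show ?thesis unfolding distrib_right by linarith
    qed
    have sg_le: "\<bar>sg \<epsilon>\<bar> \<le> S * norm \<epsilon>" for \<epsilon> unfolding sg_def S_def by (rule combo) auto
    have ps_le: "\<bar>ps \<epsilon> t\<bar> \<le> M * norm \<epsilon>" if "t \<in> {0..l}" for \<epsilon> t
      unfolding ps_def M_def by (rule combo) (use Mi that in auto)
    have sg_diff: "sg \<epsilon> - sg \<epsilon>' = sg (\<epsilon> - \<epsilon>')" "ps \<epsilon> t - ps \<epsilon>' t = ps (\<epsilon> - \<epsilon>') t" for \<epsilon> \<epsilon>' t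
      by (simp_all add: sg_def ps_def left_diff_distrib)
    have zero: "sg 0 = 0" "ps 0 = (\<lambda>_. 0)" by (simp_all add: sg_def ps_def)
    define K where "K = 2 * (l\<^sup>2 + l ^ 3) + l * \<xi> + l / \<xi>"
    have K0: "K \<ge> 0" unfolding K_def using l \<xi> by simp
    have rem: "norm (\<Phi> \<epsilon> - \<Phi> 0 - \<epsilon>) \<le> K * (S + M)\<^sup>2 * (norm \<epsilon>)\<^sup>2" for \<epsilon>
    proof -
      have "norm (\<Phi> \<epsilon> - \<Phi> 0 - \<epsilon>) \<le> K * (\<bar>sg \<epsilon>\<bar> + M * norm \<epsilon>)\<^sup>2"
        using endpoint_and_cost_remainder[OF ps_cont[of \<epsilon>] ps_le[of _ \<epsilon>], of "sg \<epsilon>"]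
        unfolding fv \<Phi>_def zero K_def .
      also have "\<dots> \<le> K * (S * norm \<epsilon> + M * norm \<epsilon>)\<^sup>2"
        using sg_le[of \<epsilon>] M0 by (intro mult_left_mono power_mono K0) auto
      also have "\<dots> = K * (S + M)\<^sup>2 * (norm \<epsilon>)\<^sup>2" by (simp add: power_mult_distrib flip: distrib_right)
      finally show ?thesis .
    qed
    have der: "(\<Phi> has_derivative (\<lambda>\<epsilon>. \<epsilon>)) (at 0)"
    proof (rule has_derivativeI_sandwich[where e = 1 and H = "\<lambda>\<epsilon>. K * (S + M)\<^sup>2 * norm \<epsilon>"])
      fix \<epsilon> :: "real \<times> real \<times> real" assume "\<epsilon> \<noteq> 0"
      then show "norm (\<Phi> \<epsilon> - \<Phi> 0 - (\<epsilon> - 0)) / norm (\<epsilon> - 0) \<le> K * (S + M)\<^sup>2 * norm \<epsilon>"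
        using rem[of \<epsilon>] by (simp add: pos_divide_le_eq power2_eq_square mult.assoc)
    next
      show "((\<lambda>\<epsilon>. K * (S + M)\<^sup>2 * norm \<epsilon>) \<longlongrightarrow> 0) (at 0)"
        by (intro tendsto_mult_right_zero tendsto_norm_zero tendsto_ident_at)
    qed (auto intro: bounded_linear_ident)
    have lip: "continuous_on UNIV f" if "\<And>\<epsilon> \<epsilon>'. \<bar>f \<epsilon> - f \<epsilon>'\<bar> \<le> B * norm (\<epsilon> - \<epsilon>')" "B \<ge> 0"
      for f :: "real \<times> real \<times> real \<Rightarrow> real" and B
    proof (rule lipschitz_on_continuous_on[of B])
      show "B-lipschitz_on UNIV f" by (rule lipschitz_onI) (use that in \<open>simp_all add: dist_norm\<close>)
    qed
    have cont\<Phi>: "continuous_on UNIV \<Phi>"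
      unfolding \<Phi>_def endpoint_and_cost_def
    proof (intro continuous_on_Pair continuous_on_mult continuous_on_add continuous_on_const)
      show "continuous_on UNIV sg" unfolding sg_def by (intro continuous_intros)
      then show "continuous_on UNIV sg" .
      have diff: "\<bar>ps \<epsilon> t - ps \<epsilon>' t\<bar> \<le> M * norm (\<epsilon> - \<epsilon>')" if "t \<in> {0..l}" for \<epsilon> \<epsilon>' t
        unfolding sg_diff by (rule ps_le[OF that])
      note L = endpoint_and_cost_lipschitz[OF ps_cont ps_cont diff]
      show "continuous_on UNIV (\<lambda>\<epsilon>. integral {0..l} (\<lambda>t. cos (varied_angle \<theta> (ps \<epsilon>) t)))"
        by (rule lip[of _ "M * l * l"]) (use L(1) M0 l in \<open>simp_all add: mult_ac\<close>)
      show "continuous_on UNIV (\<lambda>\<epsilon>. integral {0..l} (\<lambda>t. sin (varied_angle \<theta> (ps \<epsilon>) t)))"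
        by (rule lip[of _ "M * l * l"]) (use L(2) M0 l in \<open>simp_all add: mult_ac\<close>)
      show "continuous_on UNIV (\<lambda>\<epsilon>. integral {0..l} (\<lambda>t. sqrt ((\<xi> * (1 + sg \<epsilon>))\<^sup>2 + (v t + ps \<epsilon> t)\<^sup>2)))"
      proof (rule lip[of _ "(\<xi> * S + M) * l"])
        fix \<epsilon> \<epsilon>' :: "real \<times> real \<times> real"
        have "\<xi> * \<bar>sg \<epsilon> - sg \<epsilon>'\<bar> \<le> \<xi> * (S * norm (\<epsilon> - \<epsilon>'))"
          unfolding sg_diff using \<xi> by (intro mult_left_mono sg_le) auto
        then have "(\<xi> * \<bar>sg \<epsilon> - sg \<epsilon>'\<bar> + M * norm (\<epsilon> - \<epsilon>')) * l \<le> (\<xi> * (S * norm (\<epsilon> - \<epsilon>')) + M * norm (\<epsilon> - \<epsilon>')) * l"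
          using l by (intro mult_right_mono) auto
        also have "\<dots> = (\<xi> * S + M) * l * norm (\<epsilon> - \<epsilon>')" by (simp add: algebra_simps)
        finally have "(\<xi> * \<bar>sg \<epsilon> - sg \<epsilon>'\<bar> + M * norm (\<epsilon> - \<epsilon>')) * l \<le> (\<xi> * S + M) * l * norm (\<epsilon> - \<epsilon>')" .
        from order_trans[OF L(3) this]
        show "\<bar>integral {0..l} (\<lambda>t. sqrt ((\<xi> * (1 + sg \<epsilon>))\<^sup>2 + (v t + ps \<epsilon> t)\<^sup>2)) -
            integral {0..l} (\<lambda>t. sqrt ((\<xi> * (1 + sg \<epsilon>'))\<^sup>2 + (v t + ps \<epsilon>' t)\<^sup>2))\<bar> \<le> (\<xi> * S + M) * l * norm (\<epsilon> - \<epsilon>')"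
          by simp
      qed (use M0 \<xi> l in simp)
    qed
    obtain \<delta> where \<delta>: "\<delta> > 0" and least: "\<forall>c \<psi>. \<bar>c - 1\<bar> \<le> \<delta> \<longrightarrow> continuous_on UNIV \<psi> \<longrightarrow> integral {0..l} \<psi> = 0 \<longrightarrow>
      (\<forall>t\<in>{0..l}. \<bar>\<psi> t\<bar> \<le> \<delta>) \<longrightarrow>
      c * integral {0..l} (\<lambda>t. cos (varied_angle \<theta> \<psi> t)) = integral {0..l} (\<lambda>t. cos (\<theta> t)) \<longrightarrow>
      c * integral {0..l} (\<lambda>t. sin (varied_angle \<theta> \<psi> t)) = integral {0..l} (\<lambda>t. sin (\<theta> t)) \<longrightarrow>
      integral {0..l} (\<lambda>t. sqrt (\<xi>\<^sup>2 + (v t)\<^sup>2)) \<le> integral {0..l} (\<lambda>t. sqrt ((\<xi> * c)\<^sup>2 + (v t + \<psi> t)\<^sup>2))"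
      using min by (elim exE conjE)
    define \<rho> where "\<rho> = \<delta> / (S + M)"
    have \<rho>: "\<rho> > 0" using \<delta> M0 by (simp add: \<rho>_def)
    have "\<Phi> 0 \<in> interior (\<Phi> ` ball 0 \<rho>)"
      by (rule sussmann_open_mapping[OF open_UNIV cont\<Phi> UNIV_I der bounded_linear_ident]) (use \<rho> in auto)
    then obtain e where e: "e > 0" "ball (\<Phi> 0) e \<subseteq> \<Phi> ` ball 0 \<rho>" unfolding mem_interior by (elim exE conjE)
    have "\<Phi> 0 - (0, 0, e / 2) \<in> ball (\<Phi> 0) e" using e(1) by (simp add: dist_norm norm_Pair)
    then have "\<Phi> 0 - (0, 0, e / 2) \<in> \<Phi> ` ball 0 \<rho>" using e(2) by (rule subsetD[rotated])
    then obtain \<epsilon> where eq: "\<Phi> 0 - (0, 0, e / 2) = \<Phi> \<epsilon>" and "\<epsilon> \<in> ball 0 \<rho>" by (rule imageE)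
    then have \<epsilon>: "norm \<epsilon> < \<rho>" "\<Phi> 0 - (0, 0, e / 2) = \<Phi> \<epsilon>" by simp_all
    have \<rho>_le: "S * norm \<epsilon> \<le> \<delta>" "M * norm \<epsilon> \<le> \<delta>"
    proof -
      have "(S + M) * norm \<epsilon> \<le> (S + M) * \<rho>" using \<epsilon>(1) M0 by (intro mult_left_mono) auto
      also have "\<dots> = \<delta>" using M0 by (simp add: \<rho>_def)
      finally have "S * norm \<epsilon> + M * norm \<epsilon> \<le> \<delta>" by (simp only: distrib_right)
      moreover have "0 \<le> S * norm \<epsilon>" "0 \<le> M * norm \<epsilon>" using M0 by simp_all
      ultimately show "S * norm \<epsilon> \<le> \<delta>" "M * norm \<epsilon> \<le> \<delta>" by linarith+
    qed
    have va0: "varied_angle \<theta> (\<lambda>_. 0) = \<theta>" by (simp add: varied_angle_def fun_eq_iff)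
    have eqs: "(1 + sg \<epsilon>) * integral {0..l} (\<lambda>t. cos (varied_angle \<theta> (ps \<epsilon>) t)) = integral {0..l} (\<lambda>t. cos (\<theta> t))"
      "(1 + sg \<epsilon>) * integral {0..l} (\<lambda>t. sin (varied_angle \<theta> (ps \<epsilon>) t)) = integral {0..l} (\<lambda>t. sin (\<theta> t))"
      "integral {0..l} (\<lambda>t. sqrt ((\<xi> * (1 + sg \<epsilon>))\<^sup>2 + (v t + ps \<epsilon> t)\<^sup>2)) = integral {0..l} (\<lambda>t. sqrt (\<xi>\<^sup>2 + (v t)\<^sup>2)) - e / 2"
      using \<epsilon>(2) unfolding \<Phi>_def endpoint_and_cost_def zero va0 by simp_all
    have "integral {0..l} (\<lambda>t. sqrt (\<xi>\<^sup>2 + (v t)\<^sup>2)) \<le> integral {0..l} (\<lambda>t. sqrt ((\<xi> * (1 + sg \<epsilon>))\<^sup>2 + (v t + ps \<epsilon> t)\<^sup>2))"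
    proof (rule least[rule_format, OF _ ps_cont ps_int _ eqs(1,2)])
      show "\<bar>1 + sg \<epsilon> - 1\<bar> \<le> \<delta>" using order_trans[OF sg_le \<rho>_le(1)] by simp
      show "\<bar>ps \<epsilon> t\<bar> \<le> \<delta>" if "t \<in> {0..l}" for t by (rule order_trans[OF ps_le[OF that] \<rho>_le(2)])
    qed
    then show False using eqs(3) e(1) by simp
  qed
  then have "span W \<noteq> UNIV" unfolding span .
  then obtain a where a: "a \<noteq> 0" "\<forall>x\<in>span W. a \<bullet> x = 0" using span_not_UNIV_orthogonal by blast
  show ?thesis
  proof (intro exI[of _ a] conjI allI impI a(1))
    fix \<sigma> :: real and \<psi> :: "real \<Rightarrow> real"
    assume "continuous_on UNIV \<psi>" "integral {0..l} \<psi> = 0"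
    then have "first_variation \<sigma> \<psi> \<in> span W" unfolding span by (rule WI)
    then show "a \<bullet> first_variation \<sigma> \<psi> = 0" using a(2) by blast
  qed
qed

end

section \<open>Local minimizers are extremals\<close>

lemma continuous_le_of_AE:
  fixes f :: "real \<Rightarrow> real"
  assumes f: "continuous_on {a..b} f" and ab: "a < b" and N: "negligible N"
    and le: "\<And>t. t \<in> {a..b} \<Longrightarrow> t \<notin> N \<Longrightarrow> f t \<le> c" and t: "t \<in> {a..b}"
  shows "f t \<le> c"
proof (rule ccontr)
  assume "\<not> f t \<le> c"
  then have "f t - c > 0" by simp
  then obtain d where d: "d > 0" and near: "\<forall>s\<in>{a..b}. dist s t < d \<longrightarrow> dist (f s) (f t) < f t - c"
    using f[unfolded continuous_on_iff] t by blast
  define a' where "a' = max a (t - d / 2)"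
  define b' where "b' = min b (t + d / 2)"
  have "a' < b'" using d ab t by (simp add: a'_def b'_def)
  have "{a'..b'} \<subseteq> N"
  proof
    fix s assume s: "s \<in> {a'..b'}"
    then have sI: "s \<in> {a..b}" "dist s t < d" using d by (auto simp: a'_def b'_def dist_real_def abs_less_iff)
    then have "dist (f s) (f t) < f t - c" using near by blast
    then have "\<not> f s \<le> c" by (simp add: dist_real_def abs_less_iff)
    then show "s \<in> N" using le[OF sI(1)] by blast
  qed
  then have "negligible (cbox a' b')" using negligible_subset[OF N] by simp
  then have "box a' b' = {}" by (simp only: negligible_interval)
  then show False using \<open>a' < b'\<close> by simp
qed

lemma continuous_eq_of_AE:
  fixes f :: "real \<Rightarrow> real"
  assumes f: "continuous_on {a..b} f" and ab: "a < b" and N: "negligible N"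
    and eq: "\<And>t. t \<in> {a..b} \<Longrightarrow> t \<notin> N \<Longrightarrow> f t = c" and t: "t \<in> {a..b}"
  shows "f t = c"
proof (rule antisym)
  show "f t \<le> c" by (rule continuous_le_of_AE[OF f ab N _ t]) (simp add: eq)
  have "- f t \<le> - c" by (rule continuous_le_of_AE[OF continuous_on_minus[OF f] ab N _ t]) (simp add: eq)
  then show "c \<le> f t" by simp
qed

lemma exists_outside_negligible:
  assumes "negligible N" "(l::real) > 0"
  shows "\<exists>t\<in>{0<..<l}. t \<notin> N"
proof (rule ccontr)
  assume "\<not> ?thesis"
  then have "box 0 l \<subseteq> N" by auto
  then have "negligible (box 0 l)" by (rule negligible_subset[OF assms(1)])
  then have "box 0 l = {}" by (simp only: negligible_interval)
  then show False using assms(2) by simp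
qed

text \<open>The Legendre transform of the cost density: the bounded momentum \<open>h\<close> determines the control.\<close>

lemma control_of_momentum:
  fixes \<xi> v :: real
  assumes \<xi>: "\<xi> > 0" and h: "v / sqrt (\<xi>\<^sup>2 + v\<^sup>2) = h"
  shows "\<bar>h\<bar> < 1" "\<xi> / sqrt (\<xi>\<^sup>2 + v\<^sup>2) = sqrt (1 - h\<^sup>2)" "v = \<xi> * h / sqrt (1 - h\<^sup>2)"
proof -
  define n where "n = sqrt (\<xi>\<^sup>2 + v\<^sup>2)"
  have n: "n > 0" "n\<^sup>2 = \<xi>\<^sup>2 + v\<^sup>2" using \<xi> by (simp_all add: n_def sum_power2_gt_zero_iff)
  have h': "h = v / n" using h by (simp add: n_def)
  have "1 - h\<^sup>2 = (n\<^sup>2 - v\<^sup>2) / n\<^sup>2" using n(1) by (simp add: h' power_divide diff_divide_distrib)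
  also have "\<dots> = (\<xi> / n)\<^sup>2" by (simp add: n(2) power_divide)
  finally have e: "1 - h\<^sup>2 = (\<xi> / n)\<^sup>2" .
  have pos: "\<xi> / n > 0" using \<xi> n(1) by simp
  have r': "sqrt (1 - h\<^sup>2) = \<xi> / n" unfolding e using pos by (simp only: real_sqrt_abs abs_of_pos)
  then show "\<xi> / sqrt (\<xi>\<^sup>2 + v\<^sup>2) = sqrt (1 - h\<^sup>2)" by (simp only: n_def)
  have "h\<^sup>2 < 1" using e zero_less_power[OF pos, of 2] by linarith
  then show "\<bar>h\<bar> < 1" by (simp only: abs_square_less_1)
  show "v = \<xi> * h / sqrt (1 - h\<^sup>2)"
    unfolding r' using \<xi> n(1) by (simp add: h')
qed

lemma integration_by_parts_zero:
  fixes \<psi> u :: "real \<Rightarrow> real"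
  assumes l: "l \<ge> 0" and \<psi>: "continuous_on {0..l} \<psi>" and u: "continuous_on {0..l} u" and \<psi>0: "integral {0..l} \<psi> = 0"
  shows "integral {0..l} (\<lambda>t. integral {0..t} \<psi> * u t) = - integral {0..l} (\<lambda>t. \<psi> t * integral {0..t} u)"
proof -
  define \<phi> where "\<phi> t = integral {0..t} \<psi>" for t
  define R where "R t = integral {0..t} u" for t
  have d\<phi>: "(\<phi> has_real_derivative \<psi> t) (at t within {0..l})" if "t \<in> {0..l}" for t
    unfolding \<phi>_def by (rule integral_has_real_derivative[OF \<psi> that])
  have dR: "(R has_real_derivative u t) (at t within {0..l})" if "t \<in> {0..l}" for t
    unfolding R_def by (rule integral_has_real_derivative[OF u that])
  have cont: "continuous_on {0..l} \<phi>" "continuous_on {0..l} R"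
    by (rule DERIV_continuous_on[OF d\<phi>], assumption, rule DERIV_continuous_on[OF dR], assumption)
  have i: "(\<lambda>t. \<psi> t * R t) integrable_on {0..l}" "(\<lambda>t. \<phi> t * u t) integrable_on {0..l}"
    by (intro integrable_continuous_interval continuous_on_mult \<psi> u cont)+
  have "((\<lambda>t. \<psi> t * R t + \<phi> t * u t) has_integral \<phi> l * R l - \<phi> 0 * R 0) {0..l}"
  proof (rule fundamental_theorem_of_calculus[OF l])
    fix t assume t: "t \<in> {0..l}"
    have "((\<lambda>t. \<phi> t * R t) has_real_derivative \<psi> t * R t + \<phi> t * u t) (at t within {0..l})"
      using DERIV_mult[OF d\<phi>[OF t] dR[OF t]] by (simp add: add.commute mult.commute)
    then show "((\<lambda>t. \<phi> t * R t) has_vector_derivative \<psi> t * R t + \<phi> t * u t) (at t within {0..l})"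
      by (simp only: has_real_derivative_iff_has_vector_derivative)
  qed
  then have "integral {0..l} (\<lambda>t. \<psi> t * R t + \<phi> t * u t) = 0"
    using \<psi>0 by (simp add: integral_unique \<phi>_def)
  then have "integral {0..l} (\<lambda>t. \<psi> t * R t) + integral {0..l} (\<lambda>t. \<phi> t * u t) = 0"
    unfolding Henstock_Kurzweil_Integration.integral_add[OF i] .
  then show ?thesis unfolding \<phi>_def R_def by linarith
qed

text \<open>The function \<open>sqrt (1 - h\<^sup>2)\<close> may fail to be differentiable where \<open>\<bar>h\<bar> = 1\<close>, a null set that could be
  complicated. Adding \<open>1 / (n + 1)\<close> under the root removes the singularity, and \<open>\<bar>h' v\<bar>\<close> dominates all the
  regularized derivatives.\<close>

lemma slack_increment:
  fixes h h' v :: "real \<Rightarrow> real"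
  assumes T: "0 \<le> T" and h: "\<And>t. t \<in> {0..T} \<Longrightarrow> (h has_real_derivative h' t) (at t within {0..T})"
    and h': "continuous_on {0..T} h'" and h1: "\<And>t. t \<in> {0..T} \<Longrightarrow> \<bar>h t\<bar> \<le> 1" and N: "negligible N"
    and v: "\<And>t. t \<in> {0..T} \<Longrightarrow> t \<notin> N \<Longrightarrow> \<bar>h t\<bar> < 1 \<and> v t = \<xi> * h t / sqrt (1 - (h t)\<^sup>2)"
    and vi: "(\<lambda>t. h' t * v t) absolutely_integrable_on {0..T}"
  shows "\<xi> * sqrt (1 - (h T)\<^sup>2) - \<xi> * sqrt (1 - (h 0)\<^sup>2) = - integral {0..T} (\<lambda>t. h' t * v t)"
proof -
  define e where "e n = 1 / real (Suc n)" for n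
  have e: "e n > 0" for n by (simp add: e_def)
  have lime: "e \<longlonglongrightarrow> 0" unfolding e_def using LIMSEQ_inverse_real_of_nat by (simp add: inverse_eq_divide)
  define w where "w n t = \<xi> * sqrt (1 - (h t)\<^sup>2 + e n)" for n t
  define f where "f n t = - (h' t * (\<xi> * h t / sqrt (1 - (h t)\<^sup>2 + e n)))" for n t
  have sq: "(h t)\<^sup>2 \<le> 1" if "t \<in> {0..T}" for t using h1[OF that] by (simp only: abs_square_le_1)
  have pos: "1 - (h t)\<^sup>2 + e n > 0" if "t \<in> {0..T}" for t n using sq[OF that] e[of n] by linarith
  have conth: "continuous_on {0..T} h" by (rule DERIV_continuous_on[OF h])
  have contf: "continuous_on {0..T} (f n)" for n
    unfolding f_def using pos by (intro continuous_intros h' conth) (auto simp: less_le)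
  have intf: "(f n has_integral w n T - w n 0) {0..T}" for n
  proof (rule fundamental_theorem_of_calculus[OF T])
    fix t assume t: "t \<in> {0..T}"
    have "((\<lambda>t. (h t)\<^sup>2) has_real_derivative of_nat 2 * (h' t * h t ^ (2 - Suc 0))) (at t within {0..T})"
      by (rule DERIV_power[OF h[OF t]])
    then have sq': "((\<lambda>t. (h t)\<^sup>2) has_real_derivative 2 * (h' t * h t)) (at t within {0..T})" by simp
    have d1: "((\<lambda>t. 1 - (h t)\<^sup>2 + e n) has_real_derivative 0 - 2 * (h' t * h t) + 0) (at t within {0..T})"
      by (rule DERIV_add[OF DERIV_diff[OF DERIV_const sq'] DERIV_const])
    have "(w n has_real_derivative \<xi> * (inverse (sqrt (1 - (h t)\<^sup>2 + e n)) / 2 * (0 - 2 * (h' t * h t) + 0))) (at t within {0..T})"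
      unfolding w_def by (rule DERIV_cmult[OF DERIV_chain2[OF DERIV_real_sqrt[OF pos[OF t]] d1]])
    moreover have "\<xi> * (inverse (sqrt (1 - (h t)\<^sup>2 + e n)) / 2 * (0 - 2 * (h' t * h t) + 0)) = f n t"
      unfolding f_def divide_inverse by algebra
    ultimately have "(w n has_real_derivative f n t) (at t within {0..T})" by (simp only:)
    then show "(w n has_vector_derivative f n t) (at t within {0..T})"
      by (simp only: has_real_derivative_iff_has_vector_derivative)
  qed
  define g where "g n t = (if t \<in> N then 0 else f n t)" for n t
  define g0 where "g0 t = (if t \<in> N then 0 else - (h' t * v t))" for t
  have intg: "(g n has_integral w n T - w n 0) {0..T}" for n
    by (rule has_integral_spike[OF N _ intf]) (simp add: g_def)
  have abs: "(\<lambda>t. \<bar>h' t * v t\<bar>) integrable_on {0..T}"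
    using vi unfolding absolutely_integrable_on_def by (simp only: real_norm_def)
  have lim: "(\<lambda>n. integral {0..T} (g n)) \<longlonglongrightarrow> integral {0..T} g0"
  proof (rule dominated_convergence(2)[OF _ abs])
    show "g n integrable_on {0..T}" for n using intg by (rule has_integral_integrable)
    fix t assume t: "t \<in> {0..T}"
    show "norm (g n t) \<le> \<bar>h' t * v t\<bar>" for n
    proof (cases "t \<in> N")
      case False
      have v': "\<bar>h t\<bar> < 1" "v t = \<xi> * h t / sqrt (1 - (h t)\<^sup>2)"
        by (rule conjunct1[OF v[OF t False]], rule conjunct2[OF v[OF t False]])
      have p: "1 - (h t)\<^sup>2 > 0" using v'(1) abs_square_less_1[of "h t"] by simp
      define A where "A = \<xi> * h t"
      define r where "r = sqrt (1 - (h t)\<^sup>2)"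
      define s where "s = sqrt (1 - (h t)\<^sup>2 + e n)"
      have rs: "r > 0" "r \<le> s" "s > 0" unfolding r_def s_def using p e[of n] by simp_all
      have "norm (g n t) = \<bar>h' t\<bar> * (\<bar>A\<bar> / s)"
        using False rs(3) unfolding g_def f_def A_def[symmetric] s_def[symmetric] by (simp add: abs_mult abs_divide)
      also have "\<dots> \<le> \<bar>h' t\<bar> * (\<bar>A\<bar> / r)"
        using rs by (intro mult_left_mono divide_left_mono) auto
      also have "\<dots> = \<bar>h' t * v t\<bar>"
        unfolding v'(2) A_def[symmetric] r_def[symmetric] using rs(1) by (simp add: abs_mult abs_divide)
      finally show ?thesis .
    qed (simp add: g_def)
    show "(\<lambda>n. g n t) \<longlonglongrightarrow> g0 t"
    proof (cases "t \<in> N")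
      case False
      have v': "\<bar>h t\<bar> < 1" "v t = \<xi> * h t / sqrt (1 - (h t)\<^sup>2)"
        by (rule conjunct1[OF v[OF t False]], rule conjunct2[OF v[OF t False]])
      have p: "sqrt (1 - (h t)\<^sup>2 + 0) \<noteq> 0" using v'(1) abs_square_less_1[of "h t"] by simp
      have "(\<lambda>n. - (h' t * (\<xi> * h t / sqrt (1 - (h t)\<^sup>2 + e n)))) \<longlonglongrightarrow> - (h' t * (\<xi> * h t / sqrt (1 - (h t)\<^sup>2 + 0)))"
        by (intro tendsto_minus tendsto_mult tendsto_divide tendsto_real_sqrt tendsto_add tendsto_const lime p)
      then show ?thesis unfolding g_def g0_def f_def v'(2) using False by simp
    qed (simp add: g_def g0_def)
  qed
  have "(\<lambda>n. w n T - w n 0) \<longlonglongrightarrow> \<xi> * sqrt (1 - (h T)\<^sup>2 + 0) - \<xi> * sqrt (1 - (h 0)\<^sup>2 + 0)"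
    unfolding w_def by (intro tendsto_diff tendsto_mult tendsto_real_sqrt tendsto_add tendsto_const lime)
  moreover have "integral {0..T} (g n) = w n T - w n 0" for n by (rule integral_unique[OF intg])
  ultimately have "integral {0..T} g0 = \<xi> * sqrt (1 - (h T)\<^sup>2) - \<xi> * sqrt (1 - (h 0)\<^sup>2)"
    using LIMSEQ_unique[OF lim] by simp
  moreover have "integral {0..T} g0 = integral {0..T} (\<lambda>t. - (h' t * v t))"
    by (rule integral_spike[OF N]) (simp add: g0_def)
  moreover have "integral {0..T} (\<lambda>t. - (h' t * v t)) = - integral {0..T} (\<lambda>t. h' t * v t)"
    by (rule integral_neg)
  ultimately show ?thesis by linarith
qed

text \<open>The two expressions are the components of \<open>(a, b)\<close> in the frame rotated by \<open>t\<close>. For a momentum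
  they are the Hamiltonian part \<open>p1 cos \<theta> + p2 sin \<theta>\<close> and the derivative \<open>h'\<close>.\<close>

lemma rotation_norm:
  "(a * cos t + b * sin t)\<^sup>2 + (a * sin t - b * cos t)\<^sup>2 = a\<^sup>2 + b\<^sup>2" for a b t :: real
proof -
  have "(a * cos t + b * sin t)\<^sup>2 + (a * sin t - b * cos t)\<^sup>2 = (a\<^sup>2 + b\<^sup>2) * ((sin t)\<^sup>2 + (cos t)\<^sup>2)"
    by algebra
  then show ?thesis by simp
qed

text \<open>The multipliers \<open>(a1, a2, mu)\<close> are tested in two ways. Variations of the angle give, by du Bois-Reymond,
  an affine relation between \<open>v / sqrt (\<xi>\<^sup>2 + v\<^sup>2)\<close> and the primitive \<open>R\<close> of \<open>a2 cos \<theta> - a1 sin \<theta>\<close>. The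
  multiplier \<open>mu\<close> is not zero: otherwise \<open>a2 cos \<theta> - a1 sin \<theta>\<close> vanishes, the curve is a straight segment
  parallel to \<open>(a1, a2)\<close>, and the homothety relation says that its displacement is orthogonal to \<open>(a1, a2)\<close>.
  Dividing by \<open>mu\<close> gives the momenta. The Hamiltonian is conserved, and the homothety says that
  its mean is zero.\<close>

lemma local_minimizer_imp_extremal:
  assumes \<xi>: "\<xi> > 0" and loc: "local_minimizer \<xi> q_in q_fin l q v" and l: "l > 0"
  shows "extremal_on \<xi> q v 0 l"
proof -
  have adm: "admissible q_in q_fin l q v" using loc unfolding local_minimizer_def by blast
  then have v: "set_integrable lebesgue {0..l} v" unfolding admissible_def by auto
  obtain x y \<theta> N where q: "\<And>t. q t = (x t, y t, circle_of (\<theta> t))"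
    and ac: "abs_continuous_on {0..l} \<theta>" and cont\<theta>: "continuous_on {0..l} \<theta>" and N: "negligible N"
    and \<theta>': "\<And>t. t \<in> {0..l} \<Longrightarrow> t \<notin> N \<Longrightarrow> (\<theta> has_real_derivative v t) (at t within {0..l})"
    and x': "\<And>t. t \<in> {0..l} \<Longrightarrow> (x has_real_derivative cos (\<theta> t)) (at t within {0..l})"
    and y': "\<And>t. t \<in> {0..l} \<Longrightarrow> (y has_real_derivative sin (\<theta> t)) (at t within {0..l})"
    using admissible_lift[OF adm] by metis
  have hd: "cos_circle (heading (q t)) = cos (\<theta> t)" "sin_circle (heading (q t)) = sin (\<theta> t)" for t
    by (simp_all add: q heading_def)
  define hv where "hv t = v t / sqrt (\<xi>\<^sup>2 + (v t)\<^sup>2)" for t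
  define Cx where "Cx = integral {0..l} (\<lambda>t. cos (\<theta> t))"
  define Cy where "Cy = integral {0..l} (\<lambda>t. sin (\<theta> t))"
  define G where "G = integral {0..l} (\<lambda>t. \<xi> / sqrt (\<xi>\<^sup>2 + (v t)\<^sup>2))"
  have "\<exists>a. a \<noteq> 0 \<and> (\<forall>\<sigma> \<psi>. continuous_on UNIV \<psi> \<longrightarrow> integral {0..l} \<psi> = 0 \<longrightarrow> a \<bullet> first_variation l \<xi> \<theta> v \<sigma> \<psi> = 0)"
    by (rule multiplier_rule[OF l \<xi> cont\<theta> v local_minimizer_variation[OF loc l q ac N \<theta>' x' y']])
  then obtain a where a: "a \<noteq> 0" and mult: "\<forall>\<sigma> \<psi>. continuous_on UNIV \<psi> \<longrightarrow> integral {0..l} \<psi> = 0 \<longrightarrow> a \<bullet> first_variation l \<xi> \<theta> v \<sigma> \<psi> = 0"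
    by (elim exE conjE)
  obtain a1 a2 mu where a_eq: "a = (a1, a2, mu)" by (cases a)
  have fv: "first_variation l \<xi> \<theta> v \<sigma> \<psi> =
    (\<sigma> * Cx - integral {0..l} (\<lambda>t. integral {0..t} \<psi> * sin (\<theta> t)),
     \<sigma> * Cy + integral {0..l} (\<lambda>t. integral {0..t} \<psi> * cos (\<theta> t)),
     \<sigma> * \<xi> * G + integral {0..l} (\<lambda>t. hv t * \<psi> t))" for \<sigma> \<psi>
    unfolding first_variation_def[OF l \<xi> cont\<theta> v] Cx_def Cy_def G_def hv_def by (rule refl)
  \<comment> \<open>Pure homothety: \<open>\<sigma> = 1\<close> and \<open>\<psi> = 0\<close>.\<close>
  have hom: "a1 * Cx + a2 * Cy + mu * (\<xi> * G) = 0"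
  proof -
    have "a \<bullet> first_variation l \<xi> \<theta> v 1 (\<lambda>_. 0) = 0" using mult by simp
    then show ?thesis unfolding fv a_eq by (simp add: inner_Pair algebra_simps)
  qed
  define u where "u t = a2 * cos (\<theta> t) - a1 * sin (\<theta> t)" for t
  define R where "R t = integral {0..t} u" for t
  have contu: "continuous_on {0..l} u" unfolding u_def by (intro continuous_intros cont\<theta>)
  have R': "(R has_real_derivative u t) (at t within {0..l})" if "t \<in> {0..l}" for t
    unfolding R_def by (rule integral_has_real_derivative[OF contu that])
  have contR: "continuous_on {0..l} R" by (rule DERIV_continuous_on[OF R'])
  have ortho: "integral {0..l} (\<lambda>t. (mu * hv t - R t) * \<psi> t) = 0"
    if \<psi>: "continuous_on UNIV \<psi>" "integral {0..l} \<psi> = 0" for \<psi>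
  proof -
    have \<psi>c: "continuous_on {0..l} \<psi>" by (rule continuous_on_subset[OF \<psi>(1)]) simp
    have prim: "continuous_on {0..l} (\<lambda>t. integral {0..t} \<psi>)"
      by (rule indefinite_integral_continuous_1[OF integrable_continuous_interval[OF \<psi>c]])
    have i1: "(\<lambda>t. integral {0..t} \<psi> * sin (\<theta> t)) integrable_on {0..l}" "(\<lambda>t. integral {0..t} \<psi> * cos (\<theta> t)) integrable_on {0..l}"
      by (intro integrable_continuous_interval continuous_intros prim cont\<theta>)+
    have i2: "(\<lambda>t. hv t * \<psi> t) integrable_on {0..l}"
      unfolding hv_def by (rule momentum_product_integrable[OF l \<xi> cont\<theta> v \<psi>(1)])
    have i3: "(\<lambda>t. \<psi> t * R t) integrable_on {0..l}"
      by (intro integrable_continuous_interval continuous_on_mult \<psi>c contR)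
    have "a \<bullet> first_variation l \<xi> \<theta> v 0 \<psi> = 0" using mult \<psi> by blast
    then have e: "a2 * integral {0..l} (\<lambda>t. integral {0..t} \<psi> * cos (\<theta> t)) - a1 * integral {0..l} (\<lambda>t. integral {0..t} \<psi> * sin (\<theta> t))
        + mu * integral {0..l} (\<lambda>t. hv t * \<psi> t) = 0"
      unfolding fv a_eq by (simp add: inner_Pair algebra_simps)
    have "integral {0..l} (\<lambda>t. integral {0..t} \<psi> * u t)
       = integral {0..l} (\<lambda>t. a2 * (integral {0..t} \<psi> * cos (\<theta> t)) - a1 * (integral {0..t} \<psi> * sin (\<theta> t)))"
      by (simp add: u_def algebra_simps)
    also have "\<dots> = a2 * integral {0..l} (\<lambda>t. integral {0..t} \<psi> * cos (\<theta> t)) - a1 * integral {0..l} (\<lambda>t. integral {0..t} \<psi> * sin (\<theta> t))"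
      by (simp only: Henstock_Kurzweil_Integration.integral_diff[OF integrable_on_mult_right[OF i1(2)] integrable_on_mult_right[OF i1(1)]]
          integral_mult_right)
    finally have "- integral {0..l} (\<lambda>t. \<psi> t * R t) + mu * integral {0..l} (\<lambda>t. hv t * \<psi> t) = 0"
      using e integration_by_parts_zero[OF less_imp_le[OF l] \<psi>c contu \<psi>(2)] unfolding R_def by linarith
    moreover have "integral {0..l} (\<lambda>t. (mu * hv t - R t) * \<psi> t) = integral {0..l} (\<lambda>t. mu * (hv t * \<psi> t) - \<psi> t * R t)"
      by (simp add: algebra_simps)
    moreover have "\<dots> = mu * integral {0..l} (\<lambda>t. hv t * \<psi> t) - integral {0..l} (\<lambda>t. \<psi> t * R t)"
      by (simp only: Henstock_Kurzweil_Integration.integral_diff[OF integrable_on_mult_right[OF i2] i3] integral_mult_right)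
    ultimately show ?thesis by linarith
  qed
  have "compact (R ` {0..l})" by (rule compact_continuous_image[OF contR]) simp
  then have "bounded (R ` {0..l})" by (rule compact_imp_bounded)
  then obtain B where "B > 0" and B': "\<forall>z\<in>R ` {0..l}. norm z \<le> B"
    unfolding bounded_pos by (elim exE conjE)
  have B: "\<bar>R t\<bar> \<le> B" if "t \<in> {0..l}" for t using bspec[OF B' imageI[OF that]] by simp
  have "\<exists>m. negligible {t \<in> {0..l}. mu * hv t - R t \<noteq> m}"
  proof (rule du_bois_reymond[OF _ _ l ortho])
    have "hv \<in> borel_measurable (lebesgue_on {0..l})"
      unfolding hv_def by (rule momentum_measurable[OF l \<xi> cont\<theta> v])
    moreover have "R \<in> borel_measurable (lebesgue_on {0..l})"
      by (rule continuous_imp_measurable_on_sets_lebesgue[OF contR]) simp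
    ultimately show "(\<lambda>t. mu * hv t - R t) \<in> borel_measurable (lebesgue_on {0..l})" by measurable
    fix t assume t: "t \<in> {0..l}"
    have "\<bar>mu * hv t\<bar> \<le> \<bar>mu\<bar> * 1"
      unfolding abs_mult hv_def by (rule mult_left_mono[OF momentum_bounded[OF l \<xi> cont\<theta> v]]) simp
    then show "\<bar>mu * hv t - R t\<bar> \<le> \<bar>mu\<bar> + B" using B[OF t] by linarith
  qed
  then obtain m where m: "negligible {t \<in> {0..l}. mu * hv t - R t \<noteq> m}" by blast
  define Z where "Z = {t \<in> {0..l}. mu * hv t - R t \<noteq> m}"
  have Z: "negligible Z" using m unfolding Z_def .
  have hvR: "mu * hv t = m + R t" if "t \<in> {0..l}" "t \<notin> Z" for t using that by (simp add: Z_def)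
  have mu: "mu \<noteq> 0"
  proof
    assume mu0: "mu = 0"
    have "R t = - m" if "t \<in> {0..l}" "t \<notin> Z" for t
      using hvR[OF that] mu0 by (simp add: add_eq_0_iff)
    then have Rm: "R t = - m" if "t \<in> {0..l}" for t
      by (rule continuous_eq_of_AE[OF contR l Z _ that])
    have u0: "u t = 0" if t: "t \<in> {0..l}" for t
    proof (rule continuous_eq_of_AE[OF contu l _ _ t])
      show "negligible {0, l}" by simp
      fix s assume s: "s \<in> {0..l}" "s \<notin> {0, l}"
      then have s': "0 < s" "s < l" by auto
      have "((\<lambda>_. - m) has_real_derivative u s) (at s within {0..l})"
        by (rule has_field_derivative_transform_within[OF R'[OF s(1)] zero_less_one s(1)]) (simp add: Rm)
      then have "((\<lambda>_. - m) has_real_derivative u s) (at s)" using at_within_Icc_at[OF s'] by simp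
      then show "u s = 0" by (rule DERIV_unique[OF _ DERIV_const])
    qed
    define w where "w t = a1 * cos (\<theta> t) + a2 * sin (\<theta> t)" for t
    have contw: "continuous_on {0..l} w" unfolding w_def by (intro continuous_intros cont\<theta>)
    have w2: "(w t)\<^sup>2 = a1\<^sup>2 + a2\<^sup>2" if "t \<in> {0..l}" for t
      using rotation_norm[of a1 "\<theta> t" a2] u0[OF that] by (simp add: w_def u_def)
    define P where "P = sqrt (a1\<^sup>2 + a2\<^sup>2)"
    have "w ` {0..l} \<subseteq> {P, - P}"
    proof
      fix z assume "z \<in> w ` {0..l}"
      then have "z\<^sup>2 = P\<^sup>2" using w2 by (auto simp: P_def)
      then show "z \<in> {P, - P}" by (simp add: power2_eq_iff)
    qed
    then have "finite (w ` {0..l})" by (rule finite_subset) simp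
    then have "w constant_on {0..l}"
      by (intro continuous_finite_range_constant contw) (simp_all add: is_interval_connected)
    then obtain k where k': "\<forall>t\<in>{0..l}. w t = k" unfolding constant_on_def by (elim exE)
    have k: "w t = k" if "t \<in> {0..l}" for t using k' that by (rule bspec)
    have "integral {0..l} w = integral {0..l} (\<lambda>_. k)" by (rule Henstock_Kurzweil_Integration.integral_cong) (rule k)
    then have "integral {0..l} w = k * l" using l by simp
    moreover have "integral {0..l} w = a1 * Cx + a2 * Cy"
    proof -
      have i: "(\<lambda>t. cos (\<theta> t)) integrable_on {0..l}" "(\<lambda>t. sin (\<theta> t)) integrable_on {0..l}"
        by (intro integrable_continuous_interval continuous_intros cont\<theta>)+
      show ?thesis unfolding w_def Cx_def Cy_def
        by (simp only: Henstock_Kurzweil_Integration.integral_add[OF integrable_on_mult_right[OF i(1)] integrable_on_mult_right[OF i(2)]] integral_mult_right)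
    qed
    ultimately have "k * l = 0" using hom mu0 by simp
    then have "w 0 = 0" using k[of 0] l by simp
    then have "a1\<^sup>2 + a2\<^sup>2 = 0" using w2[of 0] l by simp
    then have "a1 = 0" "a2 = 0" by (simp_all add: sum_power2_eq_zero_iff)
    then show False using a a_eq mu0 by (simp add: zero_prod_def)
  qed
  define p1 where "p1 = - a1 / mu"
  define p2 where "p2 = - a2 / mu"
  define h where "h t = (m + R t) / mu" for t
  define h' where "h' t = p1 * sin (\<theta> t) - p2 * cos (\<theta> t)" for t
  have dh: "(h has_real_derivative h' t) (at t within {0..l})" if t: "t \<in> {0..l}" for t
  proof -
    have "(h has_real_derivative (0 + u t) / mu) (at t within {0..l})"
      unfolding h_def by (intro DERIV_cdivide DERIV_add DERIV_const R' t)
    moreover have "(0 + u t) / mu = h' t" by (simp add: u_def h'_def p1_def p2_def diff_divide_distrib)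
    ultimately show ?thesis by simp
  qed
  have conth: "continuous_on {0..l} h" by (rule DERIV_continuous_on[OF dh])
  have conth': "continuous_on {0..l} h'" unfolding h'_def by (intro continuous_intros cont\<theta>)
  have hv_h: "hv t = h t" if "t \<in> {0..l}" "t \<notin> Z" for t
    using hvR[OF that] mu by (simp add: h_def field_simps)
  have good: "\<bar>h t\<bar> < 1" "\<xi> / sqrt (\<xi>\<^sup>2 + (v t)\<^sup>2) = sqrt (1 - (h t)\<^sup>2)" "v t = \<xi> * h t / sqrt (1 - (h t)\<^sup>2)"
    if "t \<in> {0..l}" "t \<notin> Z" for t
    using control_of_momentum[OF \<xi> hv_h[OF that, unfolded hv_def]] by auto
  have h_le: "\<bar>h t\<bar> \<le> 1" if "t \<in> {0..l}" for t
    by (rule continuous_le_of_AE[OF continuous_on_rabs[OF conth] l Z _ that]) (use good(1) in \<open>simp add: less_imp_le\<close>)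
  define w where "w t = \<xi> * sqrt (1 - (h t)\<^sup>2)" for t
  define h1 where "h1 t = p1 * cos (\<theta> t) + p2 * sin (\<theta> t)" for t
  \<comment> \<open>The Hamiltonian \<open>h1 - w\<close> is conserved: both terms change at the rate \<open>- h' v\<close>.\<close>
  have conserved: "h1 T - h1 0 = w T - w 0" if T: "T \<in> {0..l}" for T
  proof -
    have sub: "{0..T} \<subseteq> {0..l}" using T by auto
    have vT: "v absolutely_integrable_on {0..T}" by (rule set_integrable_subset[OF v _ sub]) simp
    have abs: "(\<lambda>t. h' t * v t) absolutely_integrable_on {0..T}"
    proof (rule absolutely_integrable_bounded_measurable_product_real[OF _ _ _ vT])
      have c: "continuous_on {0..T} h'" by (rule continuous_on_subset[OF conth' sub])
      show "h' \<in> borel_measurable (lebesgue_on {0..T})" by (rule continuous_imp_measurable_on_sets_lebesgue[OF c]) simp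
      show "bounded (h' ` {0..T})" by (rule compact_imp_bounded[OF compact_continuous_image[OF c]]) simp
    qed simp
    have "w T - w 0 = - integral {0..T} (\<lambda>t. h' t * v t)"
      unfolding w_def
    proof (rule slack_increment[OF _ DERIV_subset[OF dh sub] continuous_on_subset[OF conth' sub] h_le Z _ abs])
      fix t assume "t \<in> {0..T}" "t \<notin> Z"
      then have "t \<in> {0..l}" "t \<notin> Z" using sub by auto
      then show "\<bar>h t\<bar> < 1 \<and> v t = \<xi> * h t / sqrt (1 - (h t)\<^sup>2)" using good(1,3) by blast
    qed (use sub T in auto)
    moreover have "h1 T - h1 0 = integral {0..T} (\<lambda>t. - (h' t * v t))"
    proof (rule ac_increment_eq_integral[OF _ _ _ N])
      show "0 \<le> T" using T by simp
      show "abs_continuous_on {0..T} h1"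
      proof (rule abs_continuous_on_dominated[OF abs_continuous_on_subset[OF ac sub] zero_less_one order_refl])
        show "0 \<le> \<bar>p1\<bar> + \<bar>p2\<bar>" by simp
        fix s t
        have "\<bar>p1 * (cos (\<theta> s) - cos (\<theta> t))\<bar> \<le> \<bar>p1\<bar> * \<bar>\<theta> s - \<theta> t\<bar>"
          unfolding abs_mult by (rule mult_left_mono[OF abs_cos_diff_le]) simp
        moreover have "\<bar>p2 * (sin (\<theta> s) - sin (\<theta> t))\<bar> \<le> \<bar>p2\<bar> * \<bar>\<theta> s - \<theta> t\<bar>"
          unfolding abs_mult by (rule mult_left_mono[OF abs_sin_diff_le]) simp
        ultimately show "dist (h1 s) (h1 t) \<le> 0 * (t - s) + (\<bar>p1\<bar> + \<bar>p2\<bar>) * dist (\<theta> s) (\<theta> t)"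
          unfolding dist_real_def h1_def distrib_right right_diff_distrib by linarith
      qed
      show "(\<lambda>t. - (h' t * v t)) integrable_on {0..T}"
        by (rule integrable_neg[OF set_lebesgue_integral_eq_integral(1)[OF abs]])
      fix t assume t: "t \<in> {0..T}" "t \<notin> N"
      have "(\<theta> has_real_derivative v t) (at t within {0..T})"
        by (rule DERIV_subset[OF \<theta>' sub]) (use t sub in auto)
      then show "(h1 has_real_derivative - (h' t * v t)) (at t within {0..T})"
        unfolding h1_def h'_def by (auto intro!: derivative_eq_intros simp: algebra_simps)
    qed
    ultimately show ?thesis by (simp only: integral_neg)
  qed
  have eq: "h1 t = w t" if t: "t \<in> {0..l}" for t
  proof -
    have i: "(\<lambda>t. cos (\<theta> t)) integrable_on {0..l}" "(\<lambda>t. sin (\<theta> t)) integrable_on {0..l}"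
      by (intro integrable_continuous_interval continuous_intros cont\<theta>)+
    have "integral {0..l} h1 = p1 * Cx + p2 * Cy" unfolding h1_def Cx_def Cy_def
      by (simp only: Henstock_Kurzweil_Integration.integral_add[OF integrable_on_mult_right[OF i(1)] integrable_on_mult_right[OF i(2)]] integral_mult_right)
    also have "\<dots> = \<xi> * G" using hom mu by (simp add: p1_def p2_def field_simps)
    also have "\<dots> = integral {0..l} (\<lambda>t. \<xi> * (\<xi> / sqrt (\<xi>\<^sup>2 + (v t)\<^sup>2)))" unfolding G_def by (simp only: integral_mult_right)
    also have "\<dots> = integral {0..l} w"
    proof (rule integral_spike[OF Z])
      fix t assume "t \<in> {0..l} - Z"
      then have "\<xi> / sqrt (\<xi>\<^sup>2 + (v t)\<^sup>2) = sqrt (1 - (h t)\<^sup>2)" by (intro good(2)) auto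
      then show "w t = \<xi> * (\<xi> / sqrt (\<xi>\<^sup>2 + (v t)\<^sup>2))" unfolding w_def by simp
    qed
    also have "\<dots> = integral {0..l} (\<lambda>t. h1 t - (h1 0 - w 0))"
      by (rule Henstock_Kurzweil_Integration.integral_cong) (use conserved in \<open>simp add: algebra_simps\<close>)
    also have "\<dots> = integral {0..l} h1 - (h1 0 - w 0) * l"
    proof -
      have "h1 integrable_on {0..l}" unfolding h1_def by (intro integrable_continuous_interval continuous_intros cont\<theta>)
      then show ?thesis using l by (subst Henstock_Kurzweil_Integration.integral_diff) auto
    qed
    finally have "h1 0 - w 0 = 0" using l by simp
    then show ?thesis using conserved[OF t] by simp
  qed
  have p_nonzero: "\<not> (p1 = 0 \<and> p2 = 0)"
  proof
    assume p: "p1 = 0 \<and> p2 = 0"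
    obtain t where t: "t \<in> {0<..<l}" "t \<notin> Z" using exists_outside_negligible[OF Z l] by blast
    then have tI: "t \<in> {0..l}" by simp
    have "w t = 0" using eq[OF tI] p by (simp add: h1_def)
    moreover have "(h t)\<^sup>2 < 1" using good(1)[OF tI t(2)] by (simp only: abs_square_less_1)
    ultimately show False using \<xi> by (simp add: w_def)
  qed
  \<comment> \<open>At an interior point with \<open>\<bar>h\<bar> = 1\<close> both \<open>h'\<close> and \<open>h1 = w\<close> vanish, so the momentum would be zero.\<close>
  have strict: "\<bar>h t\<bar> < 1" if t: "t \<in> {0<..<l}" for t
  proof (rule ccontr)
    assume "\<not> \<bar>h t\<bar> < 1"
    moreover have tI: "t \<in> {0..l}" using t by simp
    ultimately have h_one: "\<bar>h t\<bar> = 1" using h_le[of t] by simp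
    then have "(h t)\<^sup>2 = 1" by (simp only: abs_square_eq_1)
    then have "h1 t = 0" using eq[OF tI] by (simp add: w_def)
    have d: "(h has_real_derivative h' t) (at t)" using dh[OF tI] at_within_Icc_at[of 0 t l] t by simp
    have near: "\<bar>h s\<bar> \<le> 1" if "\<bar>t - s\<bar> < min t (l - t)" for s
    proof (rule h_le)
      have "\<bar>t - s\<bar> < t" "\<bar>t - s\<bar> < l - t" using that by simp_all
      then show "s \<in> {0..l}" by (simp add: abs_less_iff)
    qed
    have dpos: "min t (l - t) > 0" using t by simp
    have "h' t = 0"
    proof (cases "h t = 1")
      case True
      have "\<forall>s. \<bar>t - s\<bar> < min t (l - t) \<longrightarrow> h s \<le> h t"
      proof (intro allI impI)
        fix s assume "\<bar>t - s\<bar> < min t (l - t)"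
        from abs_le_D1[OF near[OF this]] show "h s \<le> h t" unfolding True .
      qed
      then show ?thesis by (rule DERIV_local_max[OF d dpos])
    next
      case False
      then have m1: "h t = - 1" using h_one by linarith
      have "\<forall>s. \<bar>t - s\<bar> < min t (l - t) \<longrightarrow> h t \<le> h s"
      proof (intro allI impI)
        fix s assume "\<bar>t - s\<bar> < min t (l - t)"
        from abs_le_D2[OF near[OF this]] show "h t \<le> h s" unfolding m1 by linarith
      qed
      then show ?thesis by (rule DERIV_local_min[OF d dpos])
    qed
    then have "p1\<^sup>2 + p2\<^sup>2 = 0" using rotation_norm[of p1 "\<theta> t" p2] \<open>h1 t = 0\<close> by (simp add: h1_def h'_def)
    then show False using p_nonzero by (simp add: sum_power2_eq_zero_iff)
  qed
  show ?thesis
    unfolding extremal_on_def hd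
  proof (intro exI conjI ballI)
    fix t assume t: "t \<in> {0<..<l}"
    then have tI: "t \<in> {0..l}" by simp
    show "(h has_real_derivative p1 * sin (\<theta> t) - p2 * cos (\<theta> t)) (at t)"
      using dh[OF tI] at_within_Icc_at[of 0 t l] t unfolding h'_def by simp
    show "\<bar>h t\<bar> < 1" by (rule strict[OF t])
    show "p1 * cos (\<theta> t) + p2 * sin (\<theta> t) = \<xi> * sqrt (1 - (h t)\<^sup>2)" using eq[OF tI] unfolding h1_def w_def .
  next
    show "negligible {t \<in> {0<..<l}. v t \<noteq> \<xi> * h t / sqrt (1 - (h t)\<^sup>2)}"
    proof (rule negligible_subset[OF Z], rule subsetI, rule ccontr)
      fix t assume t: "t \<in> {t \<in> {0<..<l}. v t \<noteq> \<xi> * h t / sqrt (1 - (h t)\<^sup>2)}" "t \<notin> Z"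
      then have "t \<in> {0..l}" by simp
      from good(3)[OF this t(2)] t(1) show False by simp
    qed
  qed
qed

section \<open>Geodesics are extremals, and the alternative\<close>

lemma global_minimizer_imp_local_minimizer:
  assumes "global_minimizer \<xi> q_in q_fin l q v"
  shows "local_minimizer \<xi> q_in q_fin l q v"
proof -
  have adm: "admissible q_in q_fin l q v" using assms unfolding global_minimizer_def by blast
  have "W11_open W11" unfolding W11_open_def by (auto intro: exI[of _ 1])
  moreover have "(l, q) \<in> W11" using adm unfolding W11_def admissible_def by simp
  ultimately show ?thesis using assms adm unfolding local_minimizer_def global_minimizer_def by blast
qed

lemma stationary_global_minimizer: "global_minimizer \<xi> p p 0 (\<lambda>_. p) (\<lambda>_. 0)"
  unfolding global_minimizer_def
proof (intro conjI allI impI)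
  have "abs_continuous_on {0..0} (\<lambda>_. p)" by (rule abs_continuous_on_lipschitz[of 0]) auto
  moreover have "AE s in lebesgue. s \<in> {0..0} \<longrightarrow>
      has_velocity (\<lambda>_. p) (cos_circle (heading p), sin_circle (heading p), 0) (at s within {0..0})"
  proof (rule AE_I')
    show "{0::real} \<in> null_sets lebesgue" by (simp add: negligible_iff_null_sets[symmetric])
  qed auto
  ultimately show "admissible p p 0 (\<lambda>_. p) (\<lambda>_. 0)"
    unfolding admissible_def by (simp add: set_integrable_def)
  fix l' q' v'
  have "cost \<xi> 0 (\<lambda>_. 0) = 0"
    by (subst cost_eq_integral) (simp_all add: set_integrable_def)
  also have "0 \<le> cost \<xi> l' v'"
    unfolding cost_def set_lebesgue_integral_def by (rule integral_nonneg_AE) (simp add: indicator_def)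
  finally show "cost \<xi> 0 (\<lambda>_. 0) \<le> cost \<xi> l' v'" .
qed

lemma extremal_on_shift:
  assumes "extremal_on \<xi> (\<lambda>s. q (t1 + s)) (\<lambda>s. v (t1 + s)) 0 T"
  shows "extremal_on \<xi> q v t1 (t1 + T)"
proof -
  obtain p1 p2 h where h: "\<forall>t\<in>{0<..<T}.
        (h has_real_derivative p1 * sin_circle (heading (q (t1 + t))) - p2 * cos_circle (heading (q (t1 + t)))) (at t) \<and>
        \<bar>h t\<bar> < 1 \<and>
        p1 * cos_circle (heading (q (t1 + t))) + p2 * sin_circle (heading (q (t1 + t))) = \<xi> * sqrt (1 - (h t)\<^sup>2)"
    and N: "negligible {t \<in> {0<..<T}. v (t1 + t) \<noteq> \<xi> * h t / sqrt (1 - (h t)\<^sup>2)}"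
    using assms unfolding extremal_on_def by (elim exE conjE)
  show ?thesis
    unfolding extremal_on_def
  proof (rule exI[of _ p1], rule exI[of _ p2], rule exI[of _ "\<lambda>t. h (t - t1)"], intro conjI ballI)
    fix t assume "t \<in> {t1<..<t1 + T}"
    then have tI: "t - t1 \<in> {0<..<T}" by auto
    note ht = h[THEN bspec, OF tI, unfolded add_diff_cancel_left' diff_add_cancel add.commute[of t1 "t - t1"]]
    have "((\<lambda>t. t - t1) has_real_derivative 1) (at t)" by (auto intro!: derivative_eq_intros)
    from DERIV_chain2[OF ht[THEN conjunct1] this]
    show "((\<lambda>t. h (t - t1)) has_real_derivative p1 * sin_circle (heading (q t)) - p2 * cos_circle (heading (q t))) (at t)"
      by simp
    show "\<bar>h (t - t1)\<bar> < 1" "p1 * cos_circle (heading (q t)) + p2 * sin_circle (heading (q t)) = \<xi> * sqrt (1 - (h (t - t1))\<^sup>2)"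
      using ht by blast+
  next
    show "negligible {t \<in> {t1<..<t1 + T}. v t \<noteq> \<xi> * h (t - t1) / sqrt (1 - (h (t - t1))\<^sup>2)}"
    proof (rule negligible_subset[OF negligible_translation[OF N, of t1]], rule subsetI)
      fix t assume "t \<in> {t \<in> {t1<..<t1 + T}. v t \<noteq> \<xi> * h (t - t1) / sqrt (1 - (h (t - t1))\<^sup>2)}"
      then have "t - t1 \<in> {t \<in> {0<..<T}. v (t1 + t) \<noteq> \<xi> * h t / sqrt (1 - (h t)\<^sup>2)}" by simp
      then have "t1 + (t - t1) \<in> (+) t1 ` {t \<in> {0<..<T}. v (t1 + t) \<noteq> \<xi> * h t / sqrt (1 - (h t)\<^sup>2)}" by (rule imageI)
      then show "t \<in> (+) t1 ` {t \<in> {0<..<T}. v (t1 + t) \<noteq> \<xi> * h t / sqrt (1 - (h t)\<^sup>2)}" by simp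
    qed
  qed
qed

lemma momentum_of_control:
  fixes \<xi> h :: real
  assumes "\<xi> > 0" "\<bar>h\<bar> < 1" and v: "v = \<xi> * h / sqrt (1 - h\<^sup>2)"
  shows "h = v / sqrt (\<xi>\<^sup>2 + v\<^sup>2)"
proof -
  have "sqrt (1 - h\<^sup>2) > 0" using assms(2) abs_square_less_1[of h] by simp
  then show ?thesis unfolding v lagrangian_at_extremal[OF assms(1,2)] using assms(1) by simp
qed

lemma circle_rotation_zero:
  assumes "a * sin_circle p - b * cos_circle p = 0" "a * cos_circle p + b * sin_circle p = 0"
  shows "a = 0" "b = 0"
proof -
  obtain t where t: "circle_of t = p" using circle_of_surj by blast
  have "a\<^sup>2 + b\<^sup>2 = 0" using rotation_norm[of a t b] assms unfolding t[symmetric] by simp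
  then show "a = 0" "b = 0" by (simp_all add: sum_power2_eq_zero_iff)
qed

text \<open>On the overlap \<open>h\<close> is determined by the control, hence so are \<open>h' = p1 sin \<theta> - p2 cos \<theta>\<close> and
  \<open>p1 cos \<theta> + p2 sin \<theta> = \<xi> sqrt (1 - h\<^sup>2)\<close>, which are the components of \<open>(p1, p2)\<close> in a rotated frame.\<close>

lemma extremal_on_glue:
  assumes \<xi>: "\<xi> > 0" and 1: "extremal_on \<xi> q v a b" and 2: "extremal_on \<xi> q v c d"
    and ord: "a \<le> c" "c < b" "b \<le> d"
  shows "extremal_on \<xi> q v a d"
proof -
  define C where "C t = cos_circle (heading (q t))" for t
  define S where "S t = sin_circle (heading (q t))" for t
  obtain p1 p2 h where h: "\<forall>t\<in>{a<..<b}. (h has_real_derivative p1 * S t - p2 * C t) (at t) \<and> \<bar>h t\<bar> < 1 \<and>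
      p1 * C t + p2 * S t = \<xi> * sqrt (1 - (h t)\<^sup>2)"
    and N: "negligible {t \<in> {a<..<b}. v t \<noteq> \<xi> * h t / sqrt (1 - (h t)\<^sup>2)}"
    using 1 unfolding extremal_on_def C_def S_def by (elim exE conjE)
  obtain p1' p2' g where g: "\<forall>t\<in>{c<..<d}. (g has_real_derivative p1' * S t - p2' * C t) (at t) \<and> \<bar>g t\<bar> < 1 \<and>
      p1' * C t + p2' * S t = \<xi> * sqrt (1 - (g t)\<^sup>2)"
    and N': "negligible {t \<in> {c<..<d}. v t \<noteq> \<xi> * g t / sqrt (1 - (g t)\<^sup>2)}"
    using 2 unfolding extremal_on_def C_def S_def by (elim exE conjE)
  note hd = h[THEN bspec, THEN conjunct1] and h1 = h[THEN bspec, THEN conjunct2, THEN conjunct1]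
    and hP = h[THEN bspec, THEN conjunct2, THEN conjunct2]
  note gd = g[THEN bspec, THEN conjunct1] and g1 = g[THEN bspec, THEN conjunct2, THEN conjunct1]
    and gP = g[THEN bspec, THEN conjunct2, THEN conjunct2]
  define Z where "Z = {t \<in> {a<..<b}. v t \<noteq> \<xi> * h t / sqrt (1 - (h t)\<^sup>2)} \<union> {t \<in> {c<..<d}. v t \<noteq> \<xi> * g t / sqrt (1 - (g t)\<^sup>2)}"
  have Z: "negligible Z" unfolding Z_def by (rule negligible_Un[OF N N'])
  have agree: "h t = g t" if t: "t \<in> {c<..<b}" for t
  proof -
    define a' where "a' = (c + t) / 2"
    define b' where "b' = (t + b) / 2"
    have ab': "c < a'" "a' < t" "t < b'" "b' < b" using t by (auto simp: a'_def b'_def)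
    have I: "s \<in> {a<..<b}" "s \<in> {c<..<d}" if "s \<in> {a'..b'}" for s using that ab' ord by auto
    have "h t - g t = 0"
    proof (rule continuous_eq_of_AE[of a' b' "\<lambda>t. h t - g t", OF _ _ Z])
      show "continuous_on {a'..b'} (\<lambda>t. h t - g t)"
        by (rule continuous_on_diff; rule DERIV_continuous_on; rule has_field_derivative_at_within)
          (rule hd[OF I(1)], assumption, rule gd[OF I(2)], assumption)
      fix s assume s: "s \<in> {a'..b'}" "s \<notin> Z"
      have "v s = \<xi> * h s / sqrt (1 - (h s)\<^sup>2)" "v s = \<xi> * g s / sqrt (1 - (g s)\<^sup>2)"
        using s(2) I[OF s(1)] unfolding Z_def by blast+
      then show "h s - g s = 0"
        using momentum_of_control[OF \<xi> h1[OF I(1)[OF s(1)]], of "v s"]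
          momentum_of_control[OF \<xi> g1[OF I(2)[OF s(1)]], of "v s"] by simp
    qed (use ab' in auto)
    then show ?thesis by simp
  qed
  define t0 where "t0 = (c + b) / 2"
  have t0: "t0 \<in> {c<..<b}" "t0 \<in> {a<..<b}" "t0 \<in> {c<..<d}" using ord by (auto simp: t0_def)
  have "(g has_real_derivative p1 * S t0 - p2 * C t0) (at t0)"
    by (rule has_field_derivative_transform_within_open[OF hd[OF t0(2)] open_greaterThanLessThan t0(1) agree])
  then have "p1 * S t0 - p2 * C t0 = p1' * S t0 - p2' * C t0" by (rule DERIV_unique[OF _ gd[OF t0(3)]])
  moreover have "p1 * C t0 + p2 * S t0 = p1' * C t0 + p2' * S t0"
    unfolding hP[OF t0(2)] gP[OF t0(3)] agree[OF t0(1)] by (rule refl)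
  ultimately have "p1 - p1' = 0" "p2 - p2' = 0"
    using circle_rotation_zero[of "p1 - p1'" "heading (q t0)" "p2 - p2'"]
    unfolding C_def S_def left_diff_distrib by linarith+
  then have p: "p1' = p1" "p2' = p2" by simp_all
  define f where "f t = (if t < b then h t else g t)" for t
  have fh: "f t = h t" if "t \<in> {a<..<b}" for t using that by (simp add: f_def)
  have fg: "f t = g t" if "t \<in> {c<..<d}" for t using that agree[of t] by (simp add: f_def)
  show ?thesis
    unfolding extremal_on_def C_def[symmetric] S_def[symmetric]
  proof (rule exI[of _ p1], rule exI[of _ p2], rule exI[of _ f], rule conjI)
    show "\<forall>t\<in>{a<..<d}. (f has_real_derivative p1 * S t - p2 * C t) (at t) \<and> \<bar>f t\<bar> < 1 \<and>
      p1 * C t + p2 * S t = \<xi> * sqrt (1 - (f t)\<^sup>2)"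
    proof
      fix t assume t: "t \<in> {a<..<d}"
      show "(f has_real_derivative p1 * S t - p2 * C t) (at t) \<and> \<bar>f t\<bar> < 1 \<and>
        p1 * C t + p2 * S t = \<xi> * sqrt (1 - (f t)\<^sup>2)"
      proof (cases "t < b")
        case True
        then have tI: "t \<in> {a<..<b}" using t by simp
        have "(f has_real_derivative p1 * S t - p2 * C t) (at t)"
          by (rule has_field_derivative_transform_within_open[OF hd[OF tI] open_greaterThanLessThan tI fh[symmetric]])
        then show ?thesis using h1[OF tI] hP[OF tI] unfolding fh[OF tI] by blast
      next
        case False
        then have tI: "t \<in> {c<..<d}" using t ord by simp
        have "(f has_real_derivative p1' * S t - p2' * C t) (at t)"
          by (rule has_field_derivative_transform_within_open[OF gd[OF tI] open_greaterThanLessThan tI fg[symmetric]])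
        then show ?thesis using g1[OF tI] gP[OF tI] unfolding fg[OF tI] p by blast
      qed
    qed
    show "negligible {t \<in> {a<..<d}. v t \<noteq> \<xi> * f t / sqrt (1 - (f t)\<^sup>2)}"
    proof (rule negligible_subset[OF Z], rule subsetI)
      fix t assume t: "t \<in> {t \<in> {a<..<d}. v t \<noteq> \<xi> * f t / sqrt (1 - (f t)\<^sup>2)}"
      show "t \<in> Z"
      proof (cases "t < b")
        case True
        then have tI: "t \<in> {a<..<b}" using t by simp
        then show ?thesis using t fh[OF tI] unfolding Z_def by simp
      next
        case False
        then have tI: "t \<in> {c<..<d}" using t ord by simp
        then show ?thesis using t fg[OF tI] unfolding Z_def by simp
      qed
    qed
  qed
qed

text \<open>Pieces of length at most \<open>\<delta>\<close> are extremals; consecutive ones are chosen with overlap \<open>\<delta> / 2\<close>.\<close>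

lemma geodesic_imp_extremal:
  assumes \<xi>: "\<xi> > 0" and geo: "geodesic \<xi> q_in q_fin l q v" and l: "l > 0"
  shows "extremal_on \<xi> q v 0 l"
proof -
  obtain \<delta> where \<delta>: "\<delta> > 0" and gm: "\<forall>t\<^sub>1 t\<^sub>2. 0 \<le> t\<^sub>1 \<and> t\<^sub>1 \<le> t\<^sub>2 \<and> t\<^sub>2 \<le> l \<and> t\<^sub>2 - t\<^sub>1 \<le> \<delta> \<longrightarrow>
        global_minimizer \<xi> (q t\<^sub>1) (q t\<^sub>2) (t\<^sub>2 - t\<^sub>1) (\<lambda>s. q (t\<^sub>1 + s)) (\<lambda>s. v (t\<^sub>1 + s))"
    using geo unfolding geodesic_def by (elim exE conjE)
  have short: "extremal_on \<xi> q v t1 t2" if t: "0 \<le> t1" "t1 < t2" "t2 \<le> l" "t2 - t1 \<le> \<delta>" for t1 t2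
  proof -
    have "global_minimizer \<xi> (q t1) (q t2) (t2 - t1) (\<lambda>s. q (t1 + s)) (\<lambda>s. v (t1 + s))"
      using gm t by simp
    then have "extremal_on \<xi> (\<lambda>s. q (t1 + s)) (\<lambda>s. v (t1 + s)) 0 (t2 - t1)"
      by (intro local_minimizer_imp_extremal[OF \<xi> global_minimizer_imp_local_minimizer]) (use t in simp_all)
    then have "extremal_on \<xi> q v t1 (t1 + (t2 - t1))" by (rule extremal_on_shift)
    then show ?thesis by simp
  qed
  define \<eta> where "\<eta> = \<delta> / 2"
  have \<eta>: "\<eta> > 0" "2 * \<eta> = \<delta>" using \<delta> by (simp_all add: \<eta>_def)
  have "extremal_on \<xi> q v 0 (min l (real (Suc n) * \<eta>))" for n
  proof (induction n)
    case 0
    show ?case by (rule short) (use l \<eta> in \<open>auto simp: min_def\<close>)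
  next
    case (Suc n)
    show ?case
    proof (cases "l \<le> real (Suc n) * \<eta>")
      case True
      moreover have "real (Suc n) * \<eta> \<le> real (Suc (Suc n)) * \<eta>" using \<eta> by (intro mult_right_mono) auto
      ultimately have "l \<le> real (Suc (Suc n)) * \<eta>" by linarith
      then show ?thesis using Suc.IH True by (simp only: min_absorb1)
    next
      case False
      have eqs: "real (Suc n) * \<eta> = real n * \<eta> + \<eta>" "real (Suc (Suc n)) * \<eta> = real n * \<eta> + 2 * \<eta>"
        by (simp_all add: algebra_simps)
      have n0: "0 \<le> real n * \<eta>" using \<eta> by simp
      have IH: "extremal_on \<xi> q v 0 (real (Suc n) * \<eta>)" using Suc.IH False by (simp only: min_absorb2 not_le less_imp_le)
      have next_piece: "extremal_on \<xi> q v (real n * \<eta>) (min l (real (Suc (Suc n)) * \<eta>))"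
        by (rule short) (use False \<eta> n0 eqs in linarith)+
      show ?thesis
        by (rule extremal_on_glue[OF \<xi> IH next_piece]) (use False \<eta> n0 eqs in linarith)+
    qed
  qed
  moreover obtain n :: nat where "l / \<eta> \<le> real n" using real_arch_simple by blast
  then have "l \<le> real n * \<eta>" using \<eta> by (simp add: pos_divide_le_eq)
  moreover have "real n * \<eta> \<le> real (Suc n) * \<eta>" using \<eta> by (intro mult_right_mono) auto
  ultimately show ?thesis by (metis min_absorb1 order_trans)
qed

lemma global_minimizer_exists_if:
  assumes \<xi>: "\<xi> > 0" and "local_minimizer \<xi> q_in q_fin l q v \<or> geodesic \<xi> q_in q_fin l q v"
  shows "\<exists>l q v. global_minimizer \<xi> q_in q_fin l q v"
proof -
  have adm: "admissible q_in q_fin l q v"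
    using assms(2) unfolding local_minimizer_def geodesic_def by blast
  then have l: "0 \<le> l" and ends: "q 0 = q_in" "q l = q_fin" unfolding admissible_def by auto
  show ?thesis
  proof (cases "l = 0")
    case True
    then have "q_in = q_fin" using ends by simp
    then show ?thesis using stationary_global_minimizer[of \<xi> q_in] by blast
  next
    case False
    then have l: "l > 0" using l by simp
    then have "extremal_on \<xi> q v 0 l"
      using assms(2) local_minimizer_imp_extremal[OF \<xi> _ l] geodesic_imp_extremal[OF \<xi> _ l] by blast
    from extremal_imp_global_minimizer[OF \<xi> adm l this] show ?thesis by blast
  qed
qed

text \<open>A minimizer would be an extremal, along which \<open>p1 x + p2 y\<close> increases strictly; the displacement
  \<open>(- 1, 0)\<close> forces \<open>- p1 > 0\<close>. At the initial heading 0, however, the nonnegative quantity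
  \<open>p1 cos \<theta> + p2 sin \<theta>\<close> equals \<open>p1\<close>.\<close>

lemma no_minimizer_backwards:
  assumes \<xi>: "\<xi> > 0"
  shows "\<not> global_minimizer \<xi> (0, 0, circle_of 0) (- 1, 0, circle_of 0) l q v"
proof
  assume gm: "global_minimizer \<xi> (0, 0, circle_of 0) (- 1, 0, circle_of 0) l q v"
  then have adm: "admissible (0, 0, circle_of 0) (- 1, 0, circle_of 0) l q v" unfolding global_minimizer_def by blast
  then have l0: "0 \<le> l" and ends: "q 0 = (0, 0, circle_of 0)" "q l = (- 1, 0, circle_of 0)" unfolding admissible_def by auto
  have "l \<noteq> 0" using ends by auto
  then have l: "l > 0" using l0 by simp
  have ext: "extremal_on \<xi> q v 0 l"
    by (rule local_minimizer_imp_extremal[OF \<xi> global_minimizer_imp_local_minimizer[OF gm] l])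
  obtain x y \<theta> N where q: "\<And>t. q t = (x t, y t, circle_of (\<theta> t))" and cont\<theta>: "continuous_on {0..l} \<theta>"
    and x': "\<And>t. t \<in> {0..l} \<Longrightarrow> (x has_real_derivative cos (\<theta> t)) (at t within {0..l})"
    and y': "\<And>t. t \<in> {0..l} \<Longrightarrow> (y has_real_derivative sin (\<theta> t)) (at t within {0..l})"
    using admissible_lift[OF adm] by metis
  have hd: "cos_circle (heading (q t)) = cos (\<theta> t)" "sin_circle (heading (q t)) = sin (\<theta> t)" for t
    by (simp_all add: q heading_def)
  obtain p1 p2 h where h: "\<forall>t\<in>{0<..<l}. (h has_real_derivative p1 * sin (\<theta> t) - p2 * cos (\<theta> t)) (at t) \<and>
      \<bar>h t\<bar> < 1 \<and> p1 * cos (\<theta> t) + p2 * sin (\<theta> t) = \<xi> * sqrt (1 - (h t)\<^sup>2)"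
    using ext unfolding extremal_on_def hd by (elim exE conjE)
  define f where "f t = p1 * cos (\<theta> t) + p2 * sin (\<theta> t)" for t
  have pos: "f t > 0" if t: "t \<in> {0<..<l}" for t
  proof -
    have "sqrt (1 - (h t)\<^sup>2) > 0"
      using h[THEN bspec, OF t, THEN conjunct2, THEN conjunct1] abs_square_less_1[of "h t"] by simp
    then show ?thesis
      using h[THEN bspec, OF t, THEN conjunct2, THEN conjunct2] \<xi> unfolding f_def by (simp only: mult_pos_pos)
  qed
  have contf: "continuous_on {0..l} f" unfolding f_def by (intro continuous_intros cont\<theta>)
  have "- f 0 \<le> 0"
  proof (rule continuous_le_of_AE[OF continuous_on_minus[OF contf] l, of "{0, l}"])
    fix t assume "t \<in> {0..l}" "t \<notin> {0, l}"
    then have "t \<in> {0<..<l}" by auto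
    from pos[OF this] show "- f t \<le> 0" by simp
  qed (use l in auto)
  moreover have "f 0 = p1"
  proof -
    have "circle_of (\<theta> 0) = circle_of 0" using ends(1) unfolding q by simp
    then have "cos (\<theta> 0) = cos 0" "sin (\<theta> 0) = sin 0" by (metis cos_circle_of, metis sin_circle_of)
    then show ?thesis by (simp add: f_def)
  qed
  ultimately have p1: "p1 \<ge> 0" by simp
  define X where "X t = p1 * x t + p2 * y t" for t
  have X': "(X has_real_derivative f t) (at t within {0..l})" if "t \<in> {0..l}" for t
    unfolding X_def f_def using x'[OF that] y'[OF that] by (auto intro!: derivative_eq_intros)
  have "X 0 < X l"
  proof (rule DERIV_pos_imp_increasing_open[OF l])
    fix t assume t: "0 < t" "t < l"
    then have "(X has_real_derivative f t) (at t)" using X'[of t] at_within_Icc_at[OF t] by simp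
    moreover have "f t > 0" by (rule pos) (use t in simp)
    ultimately show "\<exists>y. (X has_real_derivative y) (at t) \<and> y > 0" by blast
  qed (rule DERIV_continuous_on[OF X'])
  moreover have "x 0 = 0" "y 0 = 0" "x l = - 1" "y l = 0" using ends unfolding q by simp_all
  ultimately show False using p1 by (simp add: X_def)
qed

theorem theorem2:
  fixes \<xi> :: real
  assumes "\<xi> > 0"
  shows "(\<forall>q_in q_fin.
            (\<exists>l q v. global_minimizer \<xi> q_in q_fin l q v) \<or>
            (\<not> (\<exists>l q v. global_minimizer \<xi> q_in q_fin l q v) \<and>
             \<not> (\<exists>l q v. local_minimizer \<xi> q_in q_fin l q v) \<and>
             \<not> (\<exists>l q v. geodesic \<xi> q_in q_fin l q v)))
       \<and> (\<exists>q_in q_fin. \<exists>l q v. global_minimizer \<xi> q_in q_fin l q v)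
       \<and> (\<exists>q_in q_fin.
            \<not> (\<exists>l q v. global_minimizer \<xi> q_in q_fin l q v) \<and>
            \<not> (\<exists>l q v. local_minimizer \<xi> q_in q_fin l q v) \<and>
            \<not> (\<exists>l q v. geodesic \<xi> q_in q_fin l q v))"
proof -
  have alternative: "\<not> (\<exists>l q v. local_minimizer \<xi> q_in q_fin l q v) \<and> \<not> (\<exists>l q v. geodesic \<xi> q_in q_fin l q v)"
    if "\<not> (\<exists>l q v. global_minimizer \<xi> q_in q_fin l q v)" for q_in q_fin
    using global_minimizer_exists_if[OF assms] that by blast
  moreover have "\<exists>q_in q_fin. \<exists>l q v. global_minimizer \<xi> q_in q_fin l q v"
    using stationary_global_minimizer by blast
  moreover have "\<exists>q_in q_fin. \<not> (\<exists>l q v. global_minimizer \<xi> q_in q_fin l q v)"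
    using no_minimizer_backwards[OF assms] by blast
  ultimately show ?thesis by blast
qed

end
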